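(* Let $0<a<1$ and let $\beta:=\frac{e^{2\pi}\Phi(0)}{4\pi^2}-1\approx 5.059069$. Let $\mu>0$ be the real number satisfying $\mu(1-a^{\mu})=\beta$, and let $m$ be an integer with $m\ge\lceil\mu\rceil$. Put $c_k(a)=1-a^{k+1}$ for $k=0,1,\dots,m-1$, and $$c=\frac{\beta}{m-\sum_{k=1}^{m}a^k}.$$ Define $$g(m,a;t)=\cosh\!\left(\tfrac{9t}{4}\right)+c\sum_{k=0}^{m-1}c_k(a)\cosh\!\left(\tfrac{9kt}{4m}\right),\qquad \Phi_{S2}(m,a;t)=4\pi^2 g(m,a;t)\exp(-2\pi\cosh t),$$ and $\Xi_{S2}(m,a;2z)=\int_{-\infty}^{\infty}\Phi_{S2}(m,a;t)e^{izt}\,dt$. Then $$\Xi_{S2}(m,a;2z)=4\pi^2\big(G_{2\pi}(iz+9/4)+G_{2\pi}(iz-9/4)\big)+4\pi^2 c\sum_{k=0}^{m-1}c_k(a)\big(G_{2\pi}(iz+9k/(4m))+G_{2\pi}(iz-9k/(4m))\big),$$ and moreover: (A) $\Phi_{S2}(m,a;t)\to\Phi(t)$ as $t\to\infty$ (i.e. $\Phi_{S2}(m,a;t)-\Phi(t)\to0$); (B) $\Phi_{S2}(m,a;0)=\Phi(0)$; (C) the entire function $\Xi_{S2}(m,a;z)$ has only real zeros.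
   Context: $\Phi(t)=\sum_{n=1}^{\infty}\left(2\pi^2n^4e^{9t/4}-3\pi n^2e^{5t/4}\right)\exp(-\pi n^2e^{t})$ is the kernel of the Riemann $\Xi$-function (so $\Xi(2z)=\int_{-\infty}^{\infty}\Phi(t)e^{izt}dt$); $\Phi(0)\approx0.446696$. For $a>0$ and complex $\nu$, $K_\nu(a)=\int_0^\infty \exp(-a\cosh t)\cosh(\nu t)\,dt$ is the modified Bessel function of the second kind, and $G_a(\nu):=K_\nu(a)$. *)

theory Defs
  imports "HOL-Analysis.Analysis"
begin

(* The kernel of the Riemann Xi-function.  The series runs over n \<ge> 1, hence the Suc. *)
definition Phi :: "real \<Rightarrow> real" where
  "Phi t = (\<Sum>n. (2 * pi\<^sup>2 * real (Suc n) ^ 4 * exp (9 * t / 4)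
                  - 3 * pi * (real (Suc n))\<^sup>2 * exp (5 * t / 4))
                 * exp (- pi * (real (Suc n))\<^sup>2 * exp t))"

definition bessel_K :: "complex \<Rightarrow> real \<Rightarrow> complex" where
  "bessel_K \<nu> a = (LINT t:{0..}|lborel. of_real (exp (- a * cosh t)) * cosh (\<nu> * of_real t))"

definition G :: "real \<Rightarrow> complex \<Rightarrow> complex" where
  "G a \<nu> = bessel_K \<nu> a"

definition beta :: real where
  "beta = exp (2 * pi) * Phi 0 / (4 * pi\<^sup>2) - 1"

definition c_k :: "real \<Rightarrow> nat \<Rightarrow> real" where
  "c_k a k = 1 - a ^ (k + 1)"

definition c_S2 :: "nat \<Rightarrow> real \<Rightarrow> real" where
  "c_S2 m a = beta / (real m - (\<Sum>k=1..m. a ^ k))"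

definition g_S2 :: "nat \<Rightarrow> real \<Rightarrow> real \<Rightarrow> real" where
  "g_S2 m a t = cosh (9 * t / 4)
     + c_S2 m a * (\<Sum>k<m. c_k a k * cosh (9 * real k * t / (4 * real m)))"

definition Phi_S2 :: "nat \<Rightarrow> real \<Rightarrow> real \<Rightarrow> real" where
  "Phi_S2 m a t = 4 * pi\<^sup>2 * g_S2 m a t * exp (- 2 * pi * cosh t)"

(* The Fourier transform of Phi_S2 at z is the value of Xi_S2 at 2 z; hence z / 2 in the exponent. *)
definition Xi_S2 :: "nat \<Rightarrow> real \<Rightarrow> complex \<Rightarrow> complex" where
  "Xi_S2 m a z = (LINT t|lborel. of_real (Phi_S2 m a t) * exp (\<i> * (z / 2) * of_real t))"

end

theory Submission
  imports Defs
    "HOL-Complex_Analysis.Complex_Analysis"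
    "HOL-Computational_Algebra.Fundamental_Theorem_Algebra"
    "HOL-Probability.Probability"
    "HOL-Real_Asymp.Real_Asymp"
begin

text \<open>
  Write \<open>f z = \<integral> exp (- 2 \<pi> cosh t) exp (\<i> z t) dt\<close>, which is \<open>2 G (2 \<pi>) (\<i> z)\<close>. Up to a constant,
  \<open>Xi_S2 m a (2 z)\<close> is \<open>\<Sum>k\<le>m. \<beta>\<^sub>k (f (z - \<i> k \<delta>) + f (z + \<i> k \<delta>))\<close> with \<open>\<delta> = 9 / (4 m)\<close>.
  The zeros of \<open>f\<close> are real, because Bessel's equation in the argument is a Sturm--Liouville
  problem with spectral parameter \<open>z\<^sup>2\<close>. Since \<open>f\<close> grows more slowly than \<open>exp (\<epsilon> |z|\<^sup>2)\<close> for every \<open>\<epsilon>\<close>,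
  it is a locally uniform limit of functions \<open>exp (b z) p z\<close> with \<open>b\<close> real and \<open>p\<close> a polynomial with
  real roots. If all roots of \<open>P x = \<Sum>k\<le>m. \<beta>\<^sub>k x\<^sup>k\<close> lie in the open unit disc, then the operator
  \<open>P T\<close>, where \<open>T\<close> is the shift by \<open>- \<i> \<delta>\<close>, moves the zeros of such a function into the upper
  half-plane, one linear factor after the other; adding the reflected function then leaves no zeros
  in the lower half-plane, and Hurwitz' theorem carries this over to \<open>f\<close>.

  The largest lower coefficient \<open>c (1 - a\<^sup>m)\<close> of \<open>P\<close> may exceed its leading coefficient \<open>1\<close>, so the
  Enestroem--Kakeya theorem does not locate the roots of \<open>P\<close>. Instead, the reversed polynomial is
  multiplied by \<open>1 - y\<close> and its two parts are compared on the unit circle; there the definition of \<open>\<mu>\<close>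
  enters, together with \<open>m \<ge> 6\<close>, which holds because \<open>beta > 5\<close>.
\<close>

section \<open>Geometric sums\<close>

text \<open>The comparison on the unit circle has no slack at y = 1, where both parts agree. In the
  variable u = (1 - Re y) / 2 it becomes, in the critical case, a concave quadratic in u against a
  multiple of the minimum of m^2 u and 1, which bends only at u = 1 / m^2. Hence it suffices to
  check u = 1 / m^2 and u = 1, and the inequalities for geometric sums below serve these two points.
  The equation for \<mu> enters as beta \<le> m (1 - a^m), because x (1 - a^x) increases with x. The
  point u = 1 / m^2 is numerically delicate; this is where m \<ge> 6 is spent, and beta > 5, which
  supplies it, has little room itself. For the approximants exp (b z) p z it matters that b is real:
  a vertical shift then multiplies the exponential by a number of modulus 1 and does not disturb the
  comparison of |p| at z and at z - \<i> \<delta>. Evenness of f provides this: with f' 0 = 0, b is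
  a sum of reciprocals of real zeros.\<close>

lemma minus_ln_ge:
  fixes x :: real
  assumes "0 < x" "x \<le> 1"
  shows "2 * (1 - x) / (1 + x) \<le> - ln x"
proof -
  define F where "F = (\<lambda>t::real. - ln t - 2 * (1 - t) / (1 + t))"
  have "F 1 \<le> F x"
  proof (rule DERIV_nonpos_imp_nonincreasing[OF assms(2)])
    fix t assume t: "x \<le> t" "t \<le> 1"
    with assms have "t > 0" by simp
    have "(F has_real_derivative - (1 / t) - (- 2 * (1 + t) - 2 * (1 - t)) / ((1 + t) * (1 + t))) (at t)"
      unfolding F_def using \<open>t > 0\<close> by (auto intro!: derivative_eq_intros)
    also have "- (1 / t) - (- 2 * (1 + t) - 2 * (1 - t)) / ((1 + t) * (1 + t)) = 4 / (1 + t)\<^sup>2 - 1 / t"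
      by (simp add: power2_eq_square)
    finally have "(F has_real_derivative 4 / (1 + t)\<^sup>2 - 1 / t) (at t)" .
    moreover have "4 * t \<le> (1 + t)\<^sup>2"
      using zero_le_power2[of "1 - t"] by (simp add: power2_eq_square algebra_simps)
    then have "4 / (1 + t)\<^sup>2 - 1 / t \<le> 0" using \<open>t > 0\<close> by (simp add: field_simps)
    ultimately show "\<exists>y. (F has_real_derivative y) (at t) \<and> y \<le> 0" by blast
  qed
  then show ?thesis by (simp add: F_def)
qed

text \<open>Dividing the terms of a geometric sum by their geometric mean centres the exponents at
  0; this is the second moment of these exponents, needed in
  \<open>geometric_sum_ge_log\<close>.\<close>

lemma sum_centered_squares:
  "(\<Sum>k<m. (real m - 1 - 2 * real k)\<^sup>2) = real m * ((real m)\<^sup>2 - 1) / 3"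
proof -
  have 1: "(\<Sum>k<m. real k) = real m * (real m - 1) / 2"
    by (induction m) (auto simp: field_simps)
  have 2: "(\<Sum>k<m. (real k)\<^sup>2) = real m * (real m - 1) * (2 * real m - 1) / 6"
    by (induction m) (auto simp: field_simps power2_eq_square)
  have "(\<Sum>k<m. (real m - 1 - 2 * real k)\<^sup>2)
      = (\<Sum>k<m. (real m - 1)\<^sup>2 - 4 * (real m - 1) * real k + 4 * (real k)\<^sup>2)"
    by (intro sum.cong) (auto simp: algebra_simps power2_eq_square)
  also have "\<dots> = real m * (real m - 1)\<^sup>2 - 4 * (real m - 1) * (\<Sum>k<m. real k)
      + 4 * (\<Sum>k<m. (real k)\<^sup>2)"
    by (simp add: sum.distrib sum_subtractf sum_distrib_left)
  finally show ?thesis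
    unfolding 1 2 by (simp add: field_simps power2_eq_square)
qed

lemma sum_power_reverse:
  fixes a :: "'a :: comm_semiring_1"
  shows "(\<Sum>k<m. a ^ (m - Suc k)) = (\<Sum>k<m. a ^ k)"
  by (rule sum.reindex_bij_witness[of _ "\<lambda>k. m - Suc k" "\<lambda>k. m - Suc k"]) auto

text \<open>Trapezoidal bound for a convex sequence: a^k is paired with a^(m-k), and (1 - a^k) (1 -
  a^(m-k)) \<ge> 0 bounds each pair by the two end terms.\<close>

lemma one_plus_times_geometric_sum_le:
  fixes a :: real
  assumes "0 \<le> a" "a \<le> 1"
  shows "(1 + a) * (\<Sum>k<m. a ^ k) \<le> real m * (1 + a ^ m)"
proof -
  have "(1 + a) * (\<Sum>k<m. a ^ k) = (\<Sum>k<m. a ^ k) + a * (\<Sum>k<m. a ^ (m - Suc k))"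
    by (simp add: sum_power_reverse algebra_simps)
  also have "\<dots> = (\<Sum>k<m. a ^ k + a ^ (m - k))"
    by (simp add: sum.distrib sum_distrib_left power_Suc[symmetric] Suc_diff_Suc del: power_Suc)
  also have "\<dots> \<le> (\<Sum>k<m. 1 + a ^ m)"
  proof (rule sum_mono)
    fix k assume "k \<in> {..<m}"
    then have "a ^ m = a ^ k * a ^ (m - k)" by (simp flip: power_add)
    moreover have "0 \<le> (1 - a ^ k) * (1 - a ^ (m - k))"
      using assms by (intro mult_nonneg_nonneg) (auto simp: power_le_one)
    ultimately show "a ^ k + a ^ (m - k) \<le> 1 + a ^ m" by (simp add: algebra_simps)
  qed
  finally show ?thesis by simp
qed

text \<open>Twice the sum exceeds \<open>2 m\<close> times the geometric mean \<open>e\<^bsup>m-1\<^esup>\<close> of its terms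
  by the sum of the squares \<open>(e\<^sup>k - e\<^bsup>m-1-k\<^esup>)\<^sup>2\<close>; only the outermost two are kept.\<close>

lemma geometric_sum_ge_square:
  fixes e :: real
  assumes "m \<ge> 2"
  shows "(\<Sum>k<m. (e\<^sup>2) ^ k) \<ge> real m * e ^ (m - 1) + (1 - e ^ (m - 1))\<^sup>2"
proof -
  define d where "d = e ^ (m - 1)"
  have "(\<Sum>k<m. (e ^ k - e ^ (m - 1 - k))\<^sup>2)
      = (\<Sum>k<m. (e\<^sup>2) ^ k + (e\<^sup>2) ^ (m - 1 - k) - 2 * d)"
  proof (rule sum.cong)
    fix k assume "k \<in> {..<m}"
    then have "d = e ^ k * e ^ (m - 1 - k)" by (simp add: d_def flip: power_add)
    then show "(e ^ k - e ^ (m - 1 - k))\<^sup>2 = (e\<^sup>2) ^ k + (e\<^sup>2) ^ (m - 1 - k) - 2 * d"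
      by (simp add: power2_diff flip: power_mult) (simp add: mult.commute)
  qed simp
  also have "\<dots> = 2 * (\<Sum>k<m. (e\<^sup>2) ^ k) - 2 * real m * d"
    by (simp add: sum.distrib sum_subtractf sum_power_reverse)
  finally have eq: "(\<Sum>k<m. (e ^ k - e ^ (m - 1 - k))\<^sup>2) = 2 * (\<Sum>k<m. (e\<^sup>2) ^ k) - 2 * real m * d" .
  have "(\<Sum>k\<in>{0, m - 1}. (e ^ k - e ^ (m - 1 - k))\<^sup>2) \<le> (\<Sum>k<m. (e ^ k - e ^ (m - 1 - k))\<^sup>2)"
    using assms by (intro sum_mono2) auto
  moreover have "(\<Sum>k\<in>{0, m - 1}. (e ^ k - e ^ (m - 1 - k))\<^sup>2) = 2 * (1 - d)\<^sup>2"
    using assms by (simp add: d_def power2_commute)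
  ultimately show ?thesis using eq by (simp add: d_def)
qed

text \<open>Second-order refinement of the inequality of means: with d the geometric mean, the terms
  k and m-1-k add up to 2 d cosh ((m-1-2k) ln e), and cosh x \<ge> 1 + x^2 / 2. It is the bound used
  when d is not small.\<close>

lemma geometric_sum_ge_log:
  fixes e :: real
  assumes "0 < e" "m \<ge> 1"
  shows "(\<Sum>k<m. (e\<^sup>2) ^ k) \<ge> real m * e ^ (m - 1) * (1 + (ln e)\<^sup>2 * ((real m)\<^sup>2 - 1) / 6)"
proof -
  define d where "d = e ^ (m - 1)"
  define h where "h = ln e"
  have e: "e = exp h" using assms by (simp add: h_def)
  have d: "d = exp (real (m - 1) * h)" by (simp add: d_def e exp_of_nat_mult)
  have "2 * (\<Sum>k<m. (e\<^sup>2) ^ k) = (\<Sum>k<m. (e\<^sup>2) ^ k + (e\<^sup>2) ^ (m - 1 - k))"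
    by (simp add: sum.distrib sum_power_reverse)
  also have "\<dots> \<ge> (\<Sum>k<m. 2 * d + d * h\<^sup>2 * (real m - 1 - 2 * real k)\<^sup>2)"
  proof (rule sum_mono)
    fix k assume k: "k \<in> {..<m}"
    define x where "x = (real m - 1 - 2 * real k) * h"
    have "1 + x\<^sup>2 / 2 \<le> cosh x"
    proof -
      have "(\<Sum>n<3. if even n then x ^ n /\<^sub>R fact n else 0) \<le> (\<Sum>n. if even n then x ^ n /\<^sub>R fact n else 0)"
        using cosh_converges[of x] by (intro sum_le_suminf) (auto simp: sums_iff)
      then show ?thesis
        using cosh_converges[of x] by (simp add: sums_iff eval_nat_numeral)
    qed
    moreover have "(e\<^sup>2) ^ k + (e\<^sup>2) ^ (m - 1 - k) = d * (2 * cosh x)"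
    proof -
      have "(e\<^sup>2) ^ k = exp (2 * real k * h)"
        by (simp add: e exp_of_nat_mult[symmetric] power_mult[symmetric] mult_ac)
      moreover have "(e\<^sup>2) ^ (m - 1 - k) = exp (2 * real (m - 1 - k) * h)"
        by (simp add: e exp_of_nat_mult[symmetric] power_mult[symmetric] mult_ac)
      moreover have "d * (2 * cosh x) = exp (real (m - 1) * h + x) + exp (real (m - 1) * h - x)"
        by (simp add: d cosh_def exp_add exp_diff exp_minus field_simps)
      moreover have "real (m - 1) * h + x = 2 * real (m - 1 - k) * h"
        "real (m - 1) * h - x = 2 * real k * h"
        using k by (auto simp: x_def of_nat_diff algebra_simps)
      ultimately show ?thesis by simp
    qed
    moreover have "d > 0" using assms by (simp add: d_def)
    ultimately have "(e\<^sup>2) ^ k + (e\<^sup>2) ^ (m - 1 - k) \<ge> d * (2 * (1 + x\<^sup>2 / 2))" by simp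
    also have "d * (2 * (1 + x\<^sup>2 / 2)) = 2 * d + d * h\<^sup>2 * (real m - 1 - 2 * real k)\<^sup>2"
      unfolding x_def power_mult_distrib by (simp add: distrib_left mult_ac)
    finally show "2 * d + d * h\<^sup>2 * (real m - 1 - 2 * real k)\<^sup>2 \<le> (e\<^sup>2) ^ k + (e\<^sup>2) ^ (m - 1 - k)" .
  qed
  finally have "2 * (\<Sum>k<m. (e\<^sup>2) ^ k) \<ge> 2 * real m * d + d * h\<^sup>2 * (real m * ((real m)\<^sup>2 - 1) / 3)"
    by (simp add: sum.distrib sum_distrib_left[symmetric] sum_centered_squares)
  then show ?thesis by (simp add: d_def h_def algebra_simps)
qed


section \<open>Inequalities for the two critical points of the circle\<close>

text \<open>Prepares the point u = 1. With S the sum and A = a^m: if 1 + a \<le> m (1 - a), then (1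
  + a) S \<le> m (1 - A) is enough; otherwise 2 a S = (1 + a) S - (1 - a) S combines the trapezoidal
  bound with the closed form of S.\<close>

lemma geometric_sum_mean_less:
  fixes a :: real
  assumes "0 < a" "a < 1" "m \<ge> 1"
  shows "a * (\<Sum>k<m. a ^ k) < real m * (a ^ m + a * (1 - (a ^ m)\<^sup>2) / (1 + a))"
proof -
  define S where "S = (\<Sum>k<m. a ^ k)"
  define A where "A = a ^ m"
  have A: "0 < A" "A < 1" using assms by (auto simp: A_def power_less_one_iff)
  have S: "(1 - a) * S = 1 - A" unfolding S_def A_def by (rule one_diff_power_eq[symmetric])
  have E: "(1 + a) * S \<le> real m * (1 + A)"
    unfolding S_def A_def using assms by (intro one_plus_times_geometric_sum_le) auto
  have "(1 + a) * (a * S) < real m * (A * (1 + a) + a * (1 - A\<^sup>2))"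
  proof (cases "1 + a \<le> real m * (1 - a)")
    case True
    have "S \<ge> 0" unfolding S_def using assms by (intro sum_nonneg) auto
    then have "(1 + a) * S \<le> real m * (1 - a) * S" using True by (rule mult_right_mono[rotated])
    also have "\<dots> = real m * (1 - A)" by (simp add: S[symmetric])
    finally have "a * ((1 + a) * S) \<le> a * (real m * (1 - A))" using assms by (intro mult_left_mono) auto
    moreover have "a * (1 - A) < A * (1 + a) + a * (1 - A\<^sup>2)"
    proof -
      have "0 < A + a * A * (2 - A)" using A assms by (intro add_pos_pos mult_pos_pos) auto
      then show ?thesis by (simp add: algebra_simps power2_eq_square)
    qed
    then have "real m * (a * (1 - A)) < real m * (A * (1 + a) + a * (1 - A\<^sup>2))"
      using assms by simp
    ultimately show ?thesis by (simp add: algebra_simps)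
  next
    case False
    have "2 * (a * S) = (1 + a) * S - (1 - a) * S" by (simp add: algebra_simps)
    also have "\<dots> \<le> real m * (1 + A) - (1 - A)" using E S by simp
    finally have "2 * (a * S) \<le> 2 * real m * A + (real m - 1) * (1 - A)" by (simp add: algebra_simps)
    then have "(1 + a) * (2 * (a * S)) \<le> (1 + a) * (2 * real m * A + (real m - 1) * (1 - A))"
      using assms by (intro mult_left_mono) auto
    moreover have "(1 + a) * (real m - 1) < 2 * real m * a * (1 + A)"
    proof -
      have "(1 + a) * (real m - 1) < 2 * real m * a" using False by (simp add: algebra_simps)
      also have "\<dots> \<le> 2 * real m * a * (1 + A)" using A assms by simp
      finally show ?thesis .
    qed
    then have "(1 - A) * ((1 + a) * (real m - 1)) < (1 - A) * (2 * real m * a * (1 + A))"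
      using A by simp
    ultimately show ?thesis by (simp add: algebra_simps power2_eq_square)
  qed
  then show ?thesis
    using assms unfolding S_def[symmetric] A_def[symmetric] by (simp add: field_simps)
qed

text \<open>Prepares the point u = 1 / m^2. For the threshold l0 = (1 - a S / m) / (1 - A)^2 one has
  w = (1 - l0) (1 - A)^2, so w > 0 means l0 < 1. The right-hand side is the excess in the inequality
  of means. The proof splits on d = a^((m-1)/2), with a different lower bound for S on each
  side.\<close>

lemma geometric_sum_excess:
  fixes a :: real
  assumes "0 < a" "a < 1" "m \<ge> 6"
  defines "S \<equiv> (\<Sum>k<m. a ^ k)" and "A \<equiv> a ^ m"
  defines "w \<equiv> a * S / real m - 2 * A + A\<^sup>2"
  assumes "w > 0"
  shows "w * (1 + 4 * a * S\<^sup>2 / ((real m)\<^sup>2 * (1 - A)\<^sup>2)) < a * S\<^sup>2 - (real m)\<^sup>2 * A"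
proof -
  define M where "M = real m"
  have M: "M \<ge> 6" using assms by (simp add: M_def)
  have A: "0 < A" "A < 1" using assms by (auto simp: A_def power_less_one_iff)
  have S: "(1 - a) * S = 1 - A" unfolding S_def A_def by (rule one_diff_power_eq[symmetric])
  have E: "(1 + a) * S \<le> M * (1 + A)"
    unfolding S_def A_def M_def using assms by (intro one_plus_times_geometric_sum_le) auto
  have Spos: "S > 0" unfolding S_def using assms by (intro sum_pos) (auto simp: lessThan_empty_iff)
  have "S \<le> (\<Sum>k<m. 1)" unfolding S_def using assms by (intro sum_mono) (auto simp: power_le_one)
  then have SM: "S \<le> M" by (simp add: M_def)
  \<comment> \<open>Writing 4 a S^2 as ((1 + a) S)^2 - ((1 - a) S)^2 and using the trapezoidal bound
    eliminates a and S in favour of A.\<close>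
  have F: "1 + 4 * a * S\<^sup>2 / (M\<^sup>2 * (1 - A)\<^sup>2) \<le> 2 * (1 + A\<^sup>2) / (1 - A)\<^sup>2"
  proof -
    have "4 * a * S\<^sup>2 = ((1 + a) * S)\<^sup>2 - ((1 - a) * S)\<^sup>2" by (simp add: power2_eq_square algebra_simps)
    also have "\<dots> \<le> (M * (1 + A))\<^sup>2 - 0"
      using E Spos assms by (intro diff_mono power_mono) auto
    finally have "4 * a * S\<^sup>2 \<le> M\<^sup>2 * (1 + A)\<^sup>2" by (simp add: power_mult_distrib)
    then have "4 * a * S\<^sup>2 / (M\<^sup>2 * (1 - A)\<^sup>2) \<le> (M\<^sup>2 * (1 + A)\<^sup>2) / (M\<^sup>2 * (1 - A)\<^sup>2)"
      by (intro divide_right_mono) auto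
    also have "\<dots> = (1 + A)\<^sup>2 / (1 - A)\<^sup>2" using M by simp
    also have "1 + \<dots> = 2 * (1 + A\<^sup>2) / (1 - A)\<^sup>2"
      using A by (simp add: field_simps) (simp add: power2_eq_square algebra_simps)
    finally show ?thesis by simp
  qed
  have wle: "w \<le> (1 - A) * (1 / 2 - A)"
  proof -
    have "2 * (a * S) = (1 + a) * S - (1 - a) * S" by (simp add: algebra_simps)
    also have "\<dots> \<le> M * (1 + A)" using E S A by simp
    finally have "a * S / M \<le> (1 + A) / 2" using M by (simp add: field_simps)
    moreover have "(1 + A) / 2 - 2 * A + A\<^sup>2 = (1 - A) * (1 / 2 - A)"
      by (simp add: field_simps power2_eq_square)
    ultimately show ?thesis unfolding w_def M_def[symmetric] by linarith
  qed
  have "0 < (1 - A) * (1 / 2 - A)" using wle \<open>w > 0\<close> by simp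
  then have A2: "A < 1 / 2" using A by (simp add: zero_less_mult_iff)
  define e where "e = sqrt a"
  have e: "0 < e" "e < 1" "a = e\<^sup>2" using assms by (auto simp: e_def)
  define d where "d = e ^ (m - 1)"
  have d: "0 < d" "d \<le> 1" using e by (auto simp: d_def power_le_one)
  have ed: "e ^ m = e * d" using assms by (cases m) (auto simp: d_def)
  have Ad: "A = a * d\<^sup>2"
  proof -
    have "A = (e ^ m)\<^sup>2" by (simp add: A_def e(3) flip: power_mult) (simp add: mult.commute)
    then show ?thesis by (simp add: ed e(3) power_mult_distrib)
  qed
  have S_d: "S \<ge> M * d + (1 - d)\<^sup>2"
    using geometric_sum_ge_square[of m e] assms(3) unfolding S_def e(3) d_def M_def by simp
  show ?thesis
  \<comment> \<open>The threshold 2/5 is small enough for 2 (1 + d^4) < 6 (1 - d)^2 on one side, and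
    large enough to keep Y = sqrt A above 33/100 on the other.\<close>
  proof (cases "d \<le> 2 / 5")
    case True
    define D where "D = d\<^sup>2"
    have D: "0 < D" "D \<le> 4 / 25"
      using d True power_mono[of d "2/5" 2] by (auto simp: D_def power2_eq_square)
    have AD: "A \<le> D" unfolding Ad D_def using assms(1,2) by (intro mult_left_le_one_le) auto
    have w1: "w \<le> a * (S / M) * (1 - D)\<^sup>2"
    proof -
      have "w = a * (S / M - D * (2 - A))"
        by (simp add: w_def M_def[symmetric] Ad D_def algebra_simps power2_eq_square)
      also have "D * (2 - A) \<ge> (S / M) * (D * (2 - A))"
        using SM M D A by (intro mult_left_le_one_le) (auto simp: Spos less_imp_le)
      then have "a * (S / M - D * (2 - A)) \<le> a * (S / M - (S / M) * (D * (2 - A)))"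
        using assms by (intro mult_left_mono) auto
      also have "\<dots> = a * (S / M) * (1 - D * (2 - A))"
        by (simp only: right_diff_distrib mult.assoc mult_1_right)
      also have "\<dots> \<le> a * (S / M) * (1 - D)\<^sup>2"
        using AD D mult_left_mono[of A D D] Spos M assms
        by (intro mult_left_mono) (auto simp: algebra_simps power2_eq_square)
      finally show ?thesis .
    qed
    have f1: "2 * (1 + A\<^sup>2) / (1 - A)\<^sup>2 \<le> 2 * (1 + D\<^sup>2) / (1 - D)\<^sup>2"
      using AD A D by (intro frac_le mult_left_mono add_left_mono power_mono) auto
    have "w * (1 + 4 * a * S\<^sup>2 / (M\<^sup>2 * (1 - A)\<^sup>2))
        \<le> (a * (S / M) * (1 - D)\<^sup>2) * (2 * (1 + D\<^sup>2) / (1 - D)\<^sup>2)"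
      using w1 order.trans[OF F f1] \<open>w > 0\<close> assms(1) by (intro mult_mono) auto
    also have "\<dots> = a * S * (2 * (1 + D\<^sup>2) / M)" using D by simp
    also have "\<dots> < a * S * (1 - d)\<^sup>2"
    proof -
      have "D\<^sup>2 \<le> (4 / 25)\<^sup>2" using D by (intro power_mono) auto
      then have "2 * (1 + D\<^sup>2) < 6 * (3 / 5)\<^sup>2" by (simp add: power2_eq_square)
      also have "\<dots> \<le> M * (1 - d)\<^sup>2" using M d True by (intro mult_mono power_mono) auto
      finally have "2 * (1 + D\<^sup>2) / M < (1 - d)\<^sup>2" using M by (simp add: field_simps)
      then show ?thesis using Spos assms(1) by (intro mult_strict_left_mono) auto
    qed
    also have "\<dots> \<le> a * ((S + M * d) * (S - M * d))"
    proof -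
      have "S * (1 - d)\<^sup>2 \<le> (S + M * d) * (S - M * d)"
        using Spos S_d M d by (intro mult_mono) auto
      then show ?thesis using assms(1) by (simp add: mult.assoc)
    qed
    also have "\<dots> = a * S\<^sup>2 - M\<^sup>2 * A" by (simp add: Ad power2_eq_square algebra_simps)
    finally show ?thesis by (simp add: M_def)
  next
    case False
    define Y where "Y = e * d"
    have AY: "A = Y\<^sup>2" by (simp add: Ad Y_def e(3) power_mult_distrib)
    have Y0: "Y > 0" using e d by (simp add: Y_def)
    \<comment> \<open>From m \<ge> 6 one gets d \<le> e^5, while (83/100)^5 < 2/5.\<close>
    have "e \<ge> 83 / 100"
    proof (rule ccontr)
      assume "\<not> ?thesis"
      then have "e ^ 5 \<le> (83 / 100) ^ 5" using e by (intro power_mono) auto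
      moreover have "d \<le> e ^ 5" unfolding d_def using e assms(3) by (intro power_decreasing) auto
      ultimately show False using False by (simp add: eval_nat_numeral)
    qed
    then have "Y \<ge> 83 / 100 * (2 / 5)" unfolding Y_def using False by (intro mult_mono) auto
    then have Y1: "Y \<ge> 33 / 100" by simp
    have Y2: "Y < 708 / 1000"
    proof (rule ccontr)
      assume "\<not> ?thesis"
      then have "(708 / 1000)\<^sup>2 \<le> Y\<^sup>2" by (intro power_mono) auto
      then show False using A2 AY by (simp add: power2_eq_square)
    qed
    \<comment> \<open>This is 3 (1 + Y)^3 < 140 Y^2 (1 - Y) multiplied out, where 140/3 = 4 (6^2 -
      1) / 3. On the interval found for Y, the convex function Y^2 lies below its chord; applying
      this to Y^3 and Y^2 leaves a linear inequality.\<close>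
    have poly: "143 * Y ^ 3 + 9 * Y + 3 < 131 * Y\<^sup>2"
    proof -
      have "(Y - 33 / 100) * (708 / 1000 - Y) \<ge> 0" using Y1 Y2 by simp
      then have 1: "Y\<^sup>2 \<le> (1038 / 1000) * Y - 23364 / 100000"
        by (simp add: power2_eq_square field_simps)
      then have "Y * Y\<^sup>2 \<le> Y * ((1038 / 1000) * Y - 23364 / 100000)"
        using Y0 by (intro mult_left_mono) auto
      then have 2: "Y ^ 3 \<le> (1038 / 1000) * Y\<^sup>2 - 23364 / 100000 * Y"
        by (simp add: power2_eq_square power3_eq_cube algebra_simps)
      show ?thesis using 1 2 Y1 Y2 by (simp add: algebra_simps)
    qed
    define h where "h = ln e"
    have SL: "S \<ge> M * d * (1 + h\<^sup>2 * (M\<^sup>2 - 1) / 6)"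
      using geometric_sum_ge_log[of e m] assms(3) e unfolding S_def e(3) d_def M_def h_def by simp
    define \<kappa> where "\<kappa> = h\<^sup>2 * (M\<^sup>2 - 1) / 6"
    have MM: "M\<^sup>2 \<ge> 36" using M power_mono[of 6 M 2] by simp
    have k0: "\<kappa> \<ge> 0" unfolding \<kappa>_def using MM by (intro divide_nonneg_nonneg mult_nonneg_nonneg) auto
    have "(M * d * (1 + \<kappa>))\<^sup>2 \<le> S\<^sup>2" using SL M d k0 unfolding \<kappa>_def[symmetric] by (intro power_mono) auto
    moreover have "(M * d)\<^sup>2 * (1 + 2 * \<kappa>) \<le> (M * d * (1 + \<kappa>))\<^sup>2"
      unfolding power_mult_distrib[of "M * d"]
      by (intro mult_left_mono zero_le_power2) (simp add: power2_sum)
    ultimately have "a * ((M * d)\<^sup>2 * (1 + 2 * \<kappa>)) \<le> a * S\<^sup>2" using assms(1) by simp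
    then have low: "M\<^sup>2 * A * (2 * \<kappa>) \<le> a * S\<^sup>2 - M\<^sup>2 * A"
      by (simp add: Ad power_mult_distrib algebra_simps)
    \<comment> \<open>The excess M^2 A (2 \<kappa>) thereby equals A ((M^2 - 1) / 3) (ln Y)^2, and
      only ln Y remains to be estimated.\<close>
    have lnY: "ln Y = M * h"
    proof -
      have "ln (e ^ m) = real m * ln e" using e by (simp add: ln_realpow)
      then show ?thesis by (simp add: Y_def ed h_def M_def)
    qed
    have "(2 * (1 - Y) / (1 + Y))\<^sup>2 \<le> (- ln Y)\<^sup>2"
      using Y0 Y2 minus_ln_ge[of Y] by (intro power_mono) auto
    then have l2: "4 * (1 - Y)\<^sup>2 / (1 + Y)\<^sup>2 \<le> M\<^sup>2 * h\<^sup>2"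
      unfolding lnY power_divide power_mult_distrib power2_minus by simp
    have "w * (1 + 4 * a * S\<^sup>2 / (M\<^sup>2 * (1 - A)\<^sup>2)) \<le> ((1 - A) * (1 / 2 - A)) * (2 * (1 + A\<^sup>2) / (1 - A)\<^sup>2)"
      using wle F \<open>w > 0\<close> assms(1) A A2 by (intro mult_mono) auto
    also have "\<dots> = (1 / 2 - A) * (2 * (1 + A\<^sup>2)) / (1 - A)"
    proof -
      have "(t * x) * (y / t\<^sup>2) = x * y / t" if "t \<noteq> 0" for t x y :: real
        using that by (simp add: power2_eq_square)
      then show ?thesis using A by simp
    qed
    also have "(1 / 2 - A) * (2 * (1 + A\<^sup>2)) = (1 - 2 * A) * (1 + A\<^sup>2)" by (simp add: algebra_simps)
    also have "(1 - 2 * A) * (1 + A\<^sup>2) / (1 - A) \<le> 1 - A"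
    proof -
      have "(1 - 2 * A) * (1 + A\<^sup>2) \<le> (1 - A) * (1 - A)"
        using A by (simp add: algebra_simps power2_eq_square)
      then show ?thesis using A by (simp add: field_simps)
    qed
    also have "\<dots> = (1 - Y) * (1 + Y)" by (simp add: AY power2_eq_square algebra_simps)
    also have "\<dots> < Y\<^sup>2 * (35 / 3) * (4 * (1 - Y)\<^sup>2 / (1 + Y)\<^sup>2)"
    proof -
      have "3 * (1 + Y) ^ 3 < 140 * Y\<^sup>2 * (1 - Y)"
        using poly by (simp add: power3_eq_cube power2_eq_square algebra_simps)
      then have "(1 - Y) * (3 * (1 + Y) ^ 3) < (1 - Y) * (140 * Y\<^sup>2 * (1 - Y))" using Y2 by simp
      then have "(1 - Y) * (1 + Y) * (1 + Y)\<^sup>2 < 140 / 3 * Y\<^sup>2 * (1 - Y)\<^sup>2"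
        by (simp add: power2_eq_square power3_eq_cube mult_ac)
      then have "(1 - Y) * (1 + Y) < 140 / 3 * Y\<^sup>2 * (1 - Y)\<^sup>2 / (1 + Y)\<^sup>2"
        using Y0 by (subst pos_less_divide_eq) auto
      then show ?thesis by (simp add: mult_ac)
    qed
    also have "\<dots> \<le> A * ((M\<^sup>2 - 1) / 3) * (M\<^sup>2 * h\<^sup>2)"
      unfolding AY using l2 MM by (intro mult_mono) auto
    also have "\<dots> = M\<^sup>2 * A * (2 * \<kappa>)" by (simp add: \<kappa>_def)
    also note low
    finally show ?thesis by (simp add: M_def)
  qed
qed

section \<open>Roots of the coefficient polynomial\<close>

text \<open>Strict inequality of means: the geometric mean of 1, a, ..., a^(m-1) is
  a^((m-1)/2).\<close>

lemma geometric_sum_amgm: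
  fixes a :: real
  assumes "0 < a" "a < 1" "m \<ge> 2"
  shows "(real m)\<^sup>2 * a ^ m < a * (\<Sum>k<m. a ^ k)\<^sup>2"
proof -
  define e where "e = sqrt a"
  have e: "0 < e" "e < 1" "a = e\<^sup>2" using assms by (auto simp: e_def)
  have "e ^ (m - 1) < 1" using e assms by (simp add: power_less_one_iff)
  then have "(1 - e ^ (m - 1))\<^sup>2 > 0" by simp
  then have "real m * e ^ (m - 1) < (\<Sum>k<m. a ^ k)"
    using geometric_sum_ge_square[of m e] assms(3) unfolding e(3) by linarith
  then have "(real m * e ^ (m - 1))\<^sup>2 < (\<Sum>k<m. a ^ k)\<^sup>2" using e by (intro power_strict_mono) auto
  then have "a * (real m * e ^ (m - 1))\<^sup>2 < a * (\<Sum>k<m. a ^ k)\<^sup>2" using assms by simp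
  moreover have "a * (real m * e ^ (m - 1))\<^sup>2 = (real m)\<^sup>2 * a ^ m"
  proof -
    have "a ^ m = a * a ^ (m - 1)" using assms by (cases m) auto
    also have "a ^ (m - 1) = (e ^ (m - 1))\<^sup>2"
      by (simp add: e(3) power_mult[symmetric] mult.commute)
    finally show ?thesis by (simp add: power_mult_distrib)
  qed
  ultimately show ?thesis by simp
qed

text \<open>\<open>l\<close> is the least value of 1 / (c (1 - a^m)) permitted by b \<le> m (1 -
  a^m), where c = b / (m - a S). The first inequality, squared, is the comparison at u = 1; the
  second keeps the zero of l + (1 - l) y outside the closed unit disc.\<close>

lemma half_less_threshold:
  fixes a :: real
  assumes "0 < a" "a < 1" "m \<ge> 1"
  defines "S \<equiv> (\<Sum>k<m. a ^ k)" and "A \<equiv> a ^ m"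
  defines "l \<equiv> (1 - a * S / real m) / (1 - A)\<^sup>2"
  shows "(1 + A) < (2 * l - 1) * ((1 + a) * S)" and "1 / 2 < l"
proof -
  define s where "s = a * S / real m"
  have A: "0 < A" "A < 1" using assms(1-3) by (auto simp: A_def power_less_one_iff)
  have S: "(1 - a) * S = 1 - A" unfolding S_def A_def by (rule one_diff_power_eq[symmetric])
  have Spos: "S > 0" unfolding S_def using assms(1-3) by (intro sum_pos) (auto simp: lessThan_empty_iff)
  have "s < A + a * (1 - A\<^sup>2) / (1 + a)"
    using geometric_sum_mean_less[OF assms(1-3)] assms(3)
    unfolding s_def S_def[symmetric] A_def[symmetric] by (simp add: field_simps)
  then have "s * (1 + a) < A * (1 + a) + a * (1 - A\<^sup>2)" using assms(1) by (simp add: field_simps)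
  then have 1: "(1 - A\<^sup>2) * (1 - a) < (1 + 2 * A - A\<^sup>2 - 2 * s) * (1 + a)"
    by (simp add: algebra_simps)
  have "(1 - A\<^sup>2) * (1 - a) * S < (1 + 2 * A - A\<^sup>2 - 2 * s) * (1 + a) * S"
    using 1 Spos by simp
  also have "(1 - A\<^sup>2) * (1 - a) * S = (1 + A) * (1 - A)\<^sup>2"
    unfolding mult.assoc S by (simp add: power2_eq_square algebra_simps)
  finally have 2: "(1 + A) * (1 - A)\<^sup>2 < (1 + 2 * A - A\<^sup>2 - 2 * s) * ((1 + a) * S)"
    by (simp add: mult.assoc)
  have l: "(2 * l - 1) * (1 - A)\<^sup>2 = 1 + 2 * A - A\<^sup>2 - 2 * s"
  proof -
    have "l * (1 - A)\<^sup>2 = 1 - s" using A by (simp add: l_def s_def)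
    then show ?thesis by (simp add: left_diff_distrib) (simp add: power2_eq_square algebra_simps)
  qed
  have "(1 + A) * (1 - A)\<^sup>2 < ((2 * l - 1) * ((1 + a) * S)) * (1 - A)\<^sup>2"
    using 2 unfolding l[symmetric] by (simp add: mult_ac)
  then show 3: "(1 + A) < (2 * l - 1) * ((1 + a) * S)" using A by simp
  have "0 < (2 * l - 1) * ((1 + a) * S)" using 3 A by linarith
  moreover have "0 < (1 + a) * S" using Spos assms(1) by simp
  ultimately have "0 < 2 * l - 1" by (rule zero_less_mult_pos2)
  then show "1 / 2 < l" by simp
qed

text \<open>Here u and v stand for (1 - Re y) / 2 and (1 - Re (y^m)) / 2 with |y| = 1. The
  right-hand side is quadratic in u with leading coefficient of the sign of l (l - 1). For l \<ge> 1
  the inequality of means suffices; for l < 1 the quadratic is concave, and the inequality spreads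
  from u = 1 / m^2 and u = 1 to the whole range.\<close>

lemma circle_comparison:
  fixes a l u v :: real
  assumes am: "0 < a" "a < 1" "m \<ge> 6"
  defines "S \<equiv> (\<Sum>k<m. a ^ k)" and "A \<equiv> a ^ m"
  assumes l: "(1 - a * S / real m) / (1 - A)\<^sup>2 \<le> l"
    and u: "0 < u" "u \<le> 1" and v: "v \<le> 1" "v \<le> (real m)\<^sup>2 * u"
  shows "(1 - A)\<^sup>2 + 4 * A * v < (1 - 4 * l * (1 - l) * u) * ((1 - A)\<^sup>2 + 4 * a * S\<^sup>2 * u)"
proof -
  define M where "M = real m"
  define N where "N = (1 - A)\<^sup>2"
  define p where "p = 4 * a * S\<^sup>2"
  define q where "q = 4 * A"
  define r where "r = 4 * l * (1 - l)"
  have M: "M \<ge> 6" using am by (simp add: M_def)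
  have A: "0 < A" "A < 1" using am by (auto simp: A_def power_less_one_iff)
  have N: "N > 0" using A by (simp add: N_def)
  have q: "q > 0" using A by (simp add: q_def)
  have pq: "M\<^sup>2 * q < p"
    using geometric_sum_amgm[OF am(1,2), of m] am(3) by (simp add: p_def q_def M_def S_def A_def)
  have "M\<^sup>2 * q > 0" using q M by simp
  then have p: "p > 0" using pq by linarith
  have S: "(1 - a) * S = 1 - A" unfolding S_def A_def by (rule one_diff_power_eq[symmetric])
  have v': "q * v \<le> q * (M\<^sup>2 * u)" "q * v \<le> q" using v q by (auto simp: M_def)
  have "N + q * v < (1 - r * u) * (N + p * u)"
  proof (cases "l \<ge> 1")
    case True
    then have "r \<le> 0" unfolding r_def by (simp add: mult_nonneg_nonpos)
    then have "1 \<le> 1 - r * u" using u by (simp add: mult_nonpos_nonneg)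
    then have *: "1 * (N + p * u) \<le> (1 - r * u) * (N + p * u)"
      using N p u by (intro mult_right_mono) auto
    have "M\<^sup>2 * q * u < p * u" using pq u by simp
    then have "N + q * v < 1 * (N + p * u)" using v'(1) by (simp add: mult_ac)
    also note *
    finally show ?thesis .
  next
    case False
    define l0 where "l0 = (1 - a * S / real m) / (1 - A)\<^sup>2"
    define w where "w = a * S / real m - 2 * A + A\<^sup>2"
    have l0: "l0 \<le> l" "l < 1" using l False by (auto simp: l0_def)
    have h: "1 / 2 < l0" and h': "1 + A < (2 * l0 - 1) * ((1 + a) * S)"
      using half_less_threshold[of a m] am unfolding S_def[symmetric] A_def[symmetric] l0_def[symmetric] by auto
    have "l0 * N = 1 - a * S / real m" using A by (simp add: l0_def N_def)
    then have l0N: "l0 * N = N - w" by (simp add: N_def w_def power2_eq_square algebra_simps)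
    have "l0 * N < 1 * N" using l0 N by (intro mult_strict_right_mono) auto
    then have w: "w > 0" using l0N by simp
    \<comment> \<open>Beyond 1/2 the function l (1 - l) decreases, so the threshold l0 is the worst
      case.\<close>
    have r0: "r \<le> 4 * l0 * (1 - l0)"
    proof -
      have "(l - l0) * (l + l0 - 1) \<ge> 0" using l0 h by (intro mult_nonneg_nonneg) auto
      then show ?thesis by (simp add: r_def algebra_simps)
    qed
    have rpos: "r \<ge> 0" using l0 h by (simp add: r_def)
    have one: "N + q < (1 - r) * (N + p)"
    proof -
      have Np: "N + p = ((1 + a) * S)\<^sup>2"
        unfolding N_def S[symmetric] p_def by (simp add: power2_eq_square algebra_simps)
      have "N + q = (1 + A)\<^sup>2" by (simp add: N_def q_def power2_eq_square algebra_simps)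
      also have "\<dots> < ((2 * l0 - 1) * ((1 + a) * S))\<^sup>2"
        using h' A by (intro power_strict_mono) auto
      also have "\<dots> = (1 - 4 * l0 * (1 - l0)) * (N + p)"
        unfolding Np power_mult_distrib by (simp add: power2_eq_square algebra_simps)
      also have "\<dots> \<le> (1 - r) * (N + p)" using r0 N p by (intro mult_right_mono) auto
      finally show ?thesis .
    qed
    have two: "r * (N + p / M\<^sup>2) < p - M\<^sup>2 * q"
    proof -
      have "r * N \<le> 4 * (1 - l0) * N * 1"
      proof -
        have "r * N \<le> 4 * l0 * (1 - l0) * N" using r0 N by simp
        also have "\<dots> = 4 * (1 - l0) * N * l0" by (simp add: mult_ac)
        also have "\<dots> \<le> 4 * (1 - l0) * N * 1" using l0 N by (intro mult_left_mono) auto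
        finally show ?thesis .
      qed
      also have "\<dots> = 4 * w" using l0N by (simp add: algebra_simps)
      finally have rN: "r * N \<le> 4 * w" .
      have "r * (N + p / M\<^sup>2) = r * N * (1 + p / (M\<^sup>2 * N))"
        using N M by (simp add: field_simps)
      also have "\<dots> \<le> 4 * w * (1 + p / (M\<^sup>2 * N))" using rN p N by (intro mult_right_mono) auto
      also have "\<dots> < 4 * (a * S\<^sup>2 - M\<^sup>2 * A)"
      proof -
        have "w * (1 + 4 * a * S\<^sup>2 / (M\<^sup>2 * N)) < a * S\<^sup>2 - M\<^sup>2 * A"
          unfolding w_def N_def S_def A_def M_def
          by (rule geometric_sum_excess[OF am]) (use w in \<open>simp add: w_def S_def A_def\<close>)
        then show ?thesis by (simp add: p_def)
      qed
      finally show ?thesis by (simp add: p_def q_def algebra_simps)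
    qed
    have "q * v < u * (p - r * N) - r * p * u\<^sup>2"
    proof (cases "u \<le> 1 / M\<^sup>2")
      case True
      have "M\<^sup>2 * q < p - r * (N + p / M\<^sup>2)" using two by linarith
      then have "u * (M\<^sup>2 * q) < u * (p - r * (N + p / M\<^sup>2))" using u(1) by (rule mult_strict_left_mono)
      then have "q * (M\<^sup>2 * u) < u * (p - r * (N + p / M\<^sup>2))" by (simp add: mult_ac)
      also have "\<dots> = u * (p - r * N) - (r * p * u) * (1 / M\<^sup>2)" by (simp add: algebra_simps)
      also have "\<dots> \<le> u * (p - r * N) - (r * p * u) * u"
        using True rpos p u by (intro diff_left_mono mult_left_mono) auto
      finally show ?thesis using v' by (simp add: power2_eq_square mult_ac)
    next
      case False
      define U where "U = 1 / M\<^sup>2"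
      have U: "0 < U" "U < u" "U < 1" "U * M\<^sup>2 = 1" using False M u by (auto simp: U_def)
      \<comment> \<open>For u above 1 / M^2 the bound v \<le> 1 takes over. \<open>h\<close> is the
        difference of the two sides for v = 1; it is concave, hence positive between U and 1 once it
        is positive at both ends.\<close>
      define h where "h = (\<lambda>t. t * (p - r * N) - r * p * t\<^sup>2 - q)"
      have hU: "h U > 0"
      proof -
        have "r * (N + p * U) < p - M\<^sup>2 * q" using two by (simp add: U_def)
        then have "U * (r * (N + p * U)) < U * (p - M\<^sup>2 * q)" using U(1) by (rule mult_strict_left_mono)
        moreover have "U * (p - M\<^sup>2 * q) = U * p - q" using U by (simp add: algebra_simps)
        ultimately have "U * (r * (N + p * U)) < U * p - q" by linarith
        then show ?thesis by (simp add: h_def power2_eq_square algebra_simps)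
      qed
      have h1: "h 1 > 0" using one by (simp add: h_def algebra_simps)
      have "(1 - u) * h U \<ge> 0" "(u - U) * h 1 > 0" using hU h1 U u by auto
      moreover have "(1 - U) * h u = (1 - u) * h U + (u - U) * h 1 + (1 - U) * (r * p * ((u - U) * (1 - u)))"
        unfolding h_def by (simp add: power2_eq_square algebra_simps)
      moreover have "(1 - U) * (r * p * ((u - U) * (1 - u))) \<ge> 0" using U u rpos p by simp
      ultimately have "(1 - U) * h u > 0" by linarith
      then have "h u > 0" using U by (simp add: zero_less_mult_iff)
      then show ?thesis using v' by (simp add: h_def)
    qed
    then show ?thesis by (simp add: power2_eq_square algebra_simps)
  qed
  then show ?thesis by (simp add: N_def p_def q_def r_def mult_ac)
qed

section \<open>From the circle to the closed unit disc\<close>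

lemma norm_affine_unit_circle:
  fixes l :: real and y :: complex
  assumes "norm y = 1"
  shows "(norm (of_real l + of_real (1 - l) * y))\<^sup>2 = 1 - 4 * l * (1 - l) * ((1 - Re y) / 2)"
    and "(norm (y - of_real l))\<^sup>2 = (1 - l)\<^sup>2 + 4 * l * ((1 - Re y) / 2)"
    and "(norm (1 - y))\<^sup>2 = 4 * ((1 - Re y) / 2)"
proof -
  have "(Re y)\<^sup>2 + (Im y)\<^sup>2 = 1" using assms by (metis cmod_power2 power_one)
  then have i: "(Im y)\<^sup>2 = 1 - (Re y)\<^sup>2" by simp
  show "(norm (of_real l + of_real (1 - l) * y))\<^sup>2 = 1 - 4 * l * (1 - l) * ((1 - Re y) / 2)"
    unfolding cmod_power2 by (simp add: power_mult_distrib i) (simp add: power2_eq_square algebra_simps)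
  show "(norm (y - of_real l))\<^sup>2 = (1 - l)\<^sup>2 + 4 * l * ((1 - Re y) / 2)"
    unfolding cmod_power2 by (simp add: i) (simp add: power2_eq_square algebra_simps)
  show "(norm (1 - y))\<^sup>2 = 4 * ((1 - Re y) / 2)"
    unfolding cmod_power2 by (simp add: i) (simp add: power2_eq_square algebra_simps)
qed

text \<open>Multiplication by y - a turns the sum into y^m - a^m, and then every squared modulus is
  affine in u or v. The constraint v \<le> m^2 u is |1 - y^m| \<le> m |1 - y|. The point y = 1 is
  excluded because both sides agree there.\<close>

lemma circle_dominance:
  fixes a l :: real and y :: complex
  assumes am: "0 < a" "a < 1" "m \<ge> 6"
  defines "S \<equiv> (\<Sum>k<m. a ^ k)"
  assumes l: "(1 - a * S / real m) / (1 - a ^ m)\<^sup>2 \<le> l" and y: "norm y = 1" "y \<noteq> 1"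
  shows "norm (\<Sum>i<m. of_real a ^ (m - Suc i) * y ^ i) < S * norm (of_real l + of_real (1 - l) * y)"
proof -
  define V where "V = (\<Sum>i<m. of_real a ^ (m - Suc i) * y ^ i)"
  define u where "u = (1 - Re y) / 2"
  define v where "v = (1 - Re (y ^ m)) / 2"
  define A where "A = a ^ m"
  have ym: "norm (y ^ m) = 1" using y by (simp add: norm_power)
  have S: "(1 - a) * S = 1 - A" unfolding S_def A_def by (rule one_diff_power_eq[symmetric])
  have Spos: "S > 0" unfolding S_def using am by (intro sum_pos) (auto simp: lessThan_empty_iff)
  have "(norm (1 - y))\<^sup>2 > 0" using y by simp
  then have u: "0 < u" using norm_affine_unit_circle(3)[OF y(1)] by (simp add: u_def)
  have "\<bar>Re y\<bar> \<le> 1" "\<bar>Re (y ^ m)\<bar> \<le> 1" using abs_Re_le_cmod[of y] abs_Re_le_cmod[of "y ^ m"] y ym by auto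
  then have u1: "u \<le> 1" "v \<le> 1" by (auto simp: u_def v_def)
  have "norm (1 - y ^ m) \<le> real m * norm (1 - y)"
    using norm_power_diff[of 1 y m] y by simp
  then have "(norm (1 - y ^ m))\<^sup>2 \<le> (real m * norm (1 - y))\<^sup>2" by (intro power_mono) auto
  then have "4 * v \<le> (real m)\<^sup>2 * (4 * u)"
    unfolding power_mult_distrib norm_affine_unit_circle(3)[OF y(1)] norm_affine_unit_circle(3)[OF ym]
      u_def v_def .
  then have vu: "v \<le> (real m)\<^sup>2 * u" by simp
  have "(y - of_real a) * V = y ^ m - of_real A"
    unfolding V_def A_def by (simp add: power_diff_sumr2)
  then have "(norm (y - of_real a))\<^sup>2 * (norm V)\<^sup>2 = (norm (y ^ m - of_real A))\<^sup>2"
    by (simp flip: power_mult_distrib norm_mult)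
  then have eq: "((1 - a)\<^sup>2 + 4 * a * u) * (norm V)\<^sup>2 = (1 - A)\<^sup>2 + 4 * A * v"
    using norm_affine_unit_circle(2)[OF y(1)] norm_affine_unit_circle(2)[OF ym] by (simp add: u_def v_def)
  have d: "(1 - a)\<^sup>2 + 4 * a * u > 0" using am u by (intro add_nonneg_pos) auto
  have "((1 - a)\<^sup>2 + 4 * a * u) * (norm V)\<^sup>2
      < (1 - 4 * l * (1 - l) * u) * ((1 - A)\<^sup>2 + 4 * a * S\<^sup>2 * u)"
    unfolding eq using circle_comparison[OF am l[unfolded S_def] u u1 vu]
    by (simp add: S_def A_def)
  also have "(1 - A)\<^sup>2 + 4 * a * S\<^sup>2 * u = ((1 - a)\<^sup>2 + 4 * a * u) * S\<^sup>2"
    unfolding S[symmetric] power_mult_distrib by (simp add: algebra_simps)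
  finally have "(norm V)\<^sup>2 < (1 - 4 * l * (1 - l) * u) * S\<^sup>2"
    using d by (simp add: mult.left_commute[of "1 - 4 * l * (1 - l) * u"])
  also have "\<dots> = (S * norm (of_real l + of_real (1 - l) * y))\<^sup>2"
    using norm_affine_unit_circle(1)[OF y(1), of l] by (simp add: power_mult_distrib u_def)
  finally show ?thesis
    unfolding V_def[symmetric] by (rule power2_less_imp_less) (use Spos in auto)
qed

text \<open>Consecutive coefficients 1 - a^(k+1) differ by (1 - a) a^(k+1), so multiplication by 1 -
  y replaces them by a geometric progression; only the terms of degree 0 and 1 stay outside
  it.\<close>

lemma reversed_kernel_poly_identity:
  fixes a c y :: "'a :: field"
  shows "(1 - y) * (1 + c * (\<Sum>k<m. (1 - a ^ Suc k) * y ^ (m - k)))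
       = 1 + (c * (1 - a ^ m) - 1) * y - c * (1 - a) * y\<^sup>2 * (\<Sum>i<m. a ^ (m - Suc i) * y ^ i)"
proof -
  define V where "V = (\<Sum>i<m. a ^ (m - Suc i) * y ^ i)"
  have V': "(\<Sum>k<m. a ^ k * y ^ (m - Suc k)) = V" unfolding V_def
    by (rule sum.reindex_bij_witness[of _ "\<lambda>k. m - Suc k" "\<lambda>k. m - Suc k"]) auto
  have 1: "(1 - y) * (\<Sum>k<m. y ^ (m - Suc k)) = 1 - y ^ m"
    by (simp add: sum_power_reverse one_diff_power_eq)
  have 2: "(y - a) * V = y ^ m - a ^ m" unfolding V_def by (simp add: power_diff_sumr2)
  have "(\<Sum>k<m. (1 - a ^ Suc k) * y ^ (m - k)) = (\<Sum>k<m. y * y ^ (m - Suc k) - a * y * (a ^ k * y ^ (m - Suc k)))"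
  proof (rule sum.cong)
    fix k assume "k \<in> {..<m}"
    then have "y ^ (m - k) = y * y ^ (m - Suc k)" by (simp flip: power_Suc add: Suc_diff_Suc)
    then show "(1 - a ^ Suc k) * y ^ (m - k) = y * y ^ (m - Suc k) - a * y * (a ^ k * y ^ (m - Suc k))"
      by (simp add: algebra_simps)
  qed simp
  also have "\<dots> = y * (\<Sum>k<m. y ^ (m - Suc k)) - a * y * V"
    by (simp add: sum_subtractf sum_distrib_left[symmetric] V')
  finally have 3: "(\<Sum>k<m. (1 - a ^ Suc k) * y ^ (m - k)) = y * (\<Sum>k<m. y ^ (m - Suc k)) - a * y * V" .
  have "(1 - y) * (1 + c * (\<Sum>k<m. (1 - a ^ Suc k) * y ^ (m - k)))
      = (1 - y) + c * y * ((1 - y) * (\<Sum>k<m. y ^ (m - Suc k))) - c * a * y * (1 - y) * V"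
    unfolding 3 by (simp add: algebra_simps)
  also have "\<dots> = 1 + (c * (1 - a ^ m) - 1) * y - c * (1 - a) * y\<^sup>2 * V - c * y * ((y ^ m - a ^ m) - (y - a) * V)"
    unfolding 1 by (simp add: algebra_simps power2_eq_square)
  also have "\<dots> = 1 + (c * (1 - a ^ m) - 1) * y - c * (1 - a) * y\<^sup>2 * V" unfolding 2 by simp
  finally show ?thesis unfolding V_def .
qed

text \<open>For y = 1/x, (1 - y) times the reversed polynomial equals B (d y - y^2 V y / S), where B
  = c (1 - a^m), l = 1/B and d y = l + (1 - l) y. The upper bound on b gives the lower bound on l
  that \<open>circle_dominance\<close> asks for, and the maximum principle for V / d carries |V|
  \<le> S |d| into the disc.\<close>

lemma kernel_poly_roots:
  fixes a b :: real and x :: complex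
  assumes am: "0 < a" "a < 1" "m \<ge> 6" and b: "0 < b" "b \<le> real m * (1 - a ^ m)"
  defines "c \<equiv> b / (real m - (\<Sum>k=1..m. a ^ k))"
  assumes x: "norm x \<ge> 1"
  shows "x ^ m + of_real c * (\<Sum>k<m. of_real (1 - a ^ Suc k) * x ^ k) \<noteq> 0"
proof -
  define S where "S = (\<Sum>k<m. a ^ k)"
  define A where "A = a ^ m"
  have A: "0 < A" "A < 1" using am by (auto simp: A_def power_less_one_iff)
  have S: "(1 - a) * S = 1 - A" unfolding S_def A_def by (rule one_diff_power_eq[symmetric])
  have Spos: "S > 0" unfolding S_def using am by (intro sum_pos) (auto simp: lessThan_empty_iff)
  have aS: "(\<Sum>k=1..m. a ^ k) = a * S"
    unfolding S_def sum_distrib_left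
    by (rule sum.reindex_bij_witness[of _ Suc "\<lambda>k. k - 1"]) (auto simp flip: power_Suc)
  have "S \<le> (\<Sum>k<m. 1)" unfolding S_def using am by (intro sum_mono) (auto simp: power_le_one)
  then have "S \<le> real m" by simp
  moreover have "a * S < 1 * S" using am Spos by (intro mult_strict_right_mono) auto
  ultimately have "a * S < real m" by linarith
  then have cpos: "c > 0" using b unfolding c_def aS by simp
  define B where "B = c * (1 - A)"
  have B: "B > 0" using cpos A by (simp add: B_def)
  define l where "l = 1 / B"
  have l0: "(1 - a * S / real m) / (1 - A)\<^sup>2 \<le> l"
  proof -
    have "l = (real m - a * S) / (b * (1 - A))"
      using \<open>a * S < real m\<close> unfolding l_def B_def c_def aS by simp
    also have "\<dots> \<ge> (real m - a * S) / ((real m * (1 - A)) * (1 - A))"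
      using \<open>a * S < real m\<close> b A am(3) by (intro divide_left_mono mult_right_mono mult_pos_pos) (auto simp: A_def)
    finally show ?thesis using am by (simp add: power2_eq_square diff_divide_distrib mult_ac)
  qed
  have lh: "l > 1 / 2"
    using half_less_threshold(2)[OF am(1,2), of m] am(3) l0 unfolding S_def[symmetric] A_def[symmetric] by linarith
  define V where "V = (\<lambda>y::complex. \<Sum>i<m. of_real a ^ (m - Suc i) * y ^ i)"
  define d where "d = (\<lambda>y::complex. of_real l + of_real (1 - l) * y)"
  have dnz: "d y \<noteq> 0" if "norm y \<le> 1" for y
  proof
    assume "d y = 0"
    then have "of_real l = - (of_real (1 - l) * y)" by (simp add: d_def eq_neg_iff_add_eq_0)
    then have "norm (of_real l :: complex) = norm (of_real (1 - l) * y)" by (metis norm_minus_cancel)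
    then have "\<bar>l\<bar> = \<bar>1 - l\<bar> * norm y" by (simp only: norm_mult norm_of_real)
    also have "\<dots> \<le> \<bar>1 - l\<bar> * 1" using that by (intro mult_left_mono) auto
    finally show False using lh by simp
  qed
  have onV: "norm (V y) \<le> S * norm (d y)" if "norm y = 1" for y
  proof (cases "y = 1")
    case True
    have "V 1 = of_real S" unfolding V_def S_def by (simp add: sum_power_reverse)
    then show ?thesis using True Spos by (simp add: d_def)
  next
    case False
    then show ?thesis
      using circle_dominance[OF am, of l y] l0 that unfolding V_def d_def S_def A_def by simp
  qed
  have inV: "norm (V y) \<le> S * norm (d y)" if "norm y < 1" for y
  proof -
    have "norm (V y / d y) \<le> S"
    proof (rule maximum_modulus_frontier[of "\<lambda>y. V y / d y" "ball 0 1"])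
      show "(\<lambda>y. V y / d y) holomorphic_on interior (ball 0 1)"
        unfolding V_def using dnz by (intro holomorphic_intros) (auto simp: d_def intro!: holomorphic_intros)
      show "continuous_on (closure (ball 0 1)) (\<lambda>y. V y / d y)"
        unfolding V_def using dnz by (intro continuous_intros) (auto simp: d_def intro!: continuous_intros)
      show "norm (V z / d z) \<le> S" if "z \<in> frontier (ball 0 1)" for z
        using onV[of z] dnz[of z] that by (auto simp: norm_divide divide_simps)
    qed (use that in auto)
    then show ?thesis using dnz[of y] that by (auto simp: norm_divide divide_simps)
  qed
  define y where "y = inverse x"
  have xnz: "x \<noteq> 0" using x by auto
  have y: "norm y \<le> 1" "y \<noteq> 0" using x xnz by (auto simp: y_def norm_inverse inverse_le_1_iff)
  define Q where "Q = 1 + of_real c * (\<Sum>k<m. (1 - of_real a ^ Suc k) * y ^ (m - k))"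
  have "Q \<noteq> 0"
  \<comment> \<open>The factor 1 - y vanishes here, so this point is treated directly: all
    coefficients are nonnegative and the constant one is 1.\<close>
  proof (cases "y = 1")
    case True
    have "(\<Sum>k<m. (1 - a ^ Suc k)) \<ge> 0" using am by (intro sum_nonneg) (auto simp: power_le_one mult_le_one)
    then have "1 + c * (\<Sum>k<m. (1 - a ^ Suc k)) > 0" using cpos by (simp add: add_pos_nonneg)
    moreover have "Q = of_real (1 + c * (\<Sum>k<m. (1 - a ^ Suc k)))" by (simp add: Q_def True)
    ultimately show ?thesis by (metis less_irrefl of_real_eq_0_iff)
  next
    case False
    have "c * (1 - a) * S = B" by (simp add: B_def S[symmetric])
    then have cS: "c * (1 - a) = B / S" using Spos by (simp add: field_simps)
    have "(1 - y) * Q = 1 + of_real (B - 1) * y - of_real (c * (1 - a)) * y\<^sup>2 * V y"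
      unfolding Q_def reversed_kernel_poly_identity by (simp add: V_def B_def A_def)
    also have "\<dots> = of_real B * (d y - y\<^sup>2 * V y / of_real S)"
      unfolding cS using B Spos by (simp add: d_def l_def field_simps)
    finally have *: "(1 - y) * Q = of_real B * (d y - y\<^sup>2 * V y / of_real S)" .
    \<comment> \<open>Strictness comes from \<open>circle_dominance\<close> on the circle and from
      the factor y^2 inside it.\<close>
    have "norm (y\<^sup>2 * V y / of_real S) < norm (d y)"
    proof (cases "norm y = 1")
      case True
      then have "norm (V y) < S * norm (d y)"
        using circle_dominance[OF am, of l y] l0 False unfolding V_def d_def S_def A_def by simp
      then show ?thesis using True Spos by (simp add: norm_mult norm_divide norm_power field_simps)
    next
      case 2: False
      then have ylt: "norm y < 1" using y by simp
      have "norm (y\<^sup>2 * V y / of_real S) = (norm y)\<^sup>2 * (norm (V y) / S)"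
        using Spos by (simp add: norm_mult norm_divide norm_power)
      also have "\<dots> \<le> (norm y)\<^sup>2 * norm (d y)"
        using inV[OF ylt] Spos by (intro mult_left_mono) (auto simp: field_simps)
      also have "\<dots> < 1 * norm (d y)"
        using dnz[OF y(1)] ylt by (intro mult_strict_right_mono) (auto simp: power_less_one_iff)
      finally show ?thesis by simp
    qed
    then have "d y - y\<^sup>2 * V y / of_real S \<noteq> 0" by auto
    then have "(1 - y) * Q \<noteq> 0" using * B by simp
    then show ?thesis by auto
  qed
  moreover have "x ^ m * Q = x ^ m + of_real c * (\<Sum>k<m. of_real (1 - a ^ Suc k) * x ^ k)"
  proof -
    have "x ^ m * (\<Sum>k<m. (1 - of_real a ^ Suc k) * y ^ (m - k))
        = (\<Sum>k<m. of_real (1 - a ^ Suc k) * x ^ k)"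
      unfolding sum_distrib_left
    proof (rule sum.cong)
      fix k assume "k \<in> {..<m}"
      then have "x ^ m = x ^ k * x ^ (m - k)" by (simp flip: power_add)
      then show "x ^ m * ((1 - of_real a ^ Suc k) * y ^ (m - k)) = of_real (1 - a ^ Suc k) * x ^ k"
        using xnz by (simp add: y_def power_inverse)
    qed simp
    then show ?thesis by (simp add: Q_def distrib_left mult.left_commute[of "x ^ m"])
  qed
  ultimately show ?thesis using xnz by (metis mult_eq_0_iff power_not_zero)
qed

section \<open>Entire functions of growth below order two\<close>

text \<open>Factors 1 - z / z0 instead of z - z0 preserve the value at 0, so that the zero-free
  factor obtained later still takes the value f 0 there.\<close>

lemma entire_divide_zero:
  fixes f :: "complex \<Rightarrow> complex"
  assumes hol: "f holomorphic_on UNIV" and f0: "f 0 \<noteq> 0" and z0: "f z0 = 0"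
  obtains g n where "g holomorphic_on UNIV" "g z0 \<noteq> 0" "\<And>z. f z = (1 - z / z0) ^ n * g z"
proof -
  have nz: "z0 \<noteq> 0" using f0 z0 by auto
  have "\<not> f constant_on UNIV" using f0 z0 by (metis UNIV_I constant_on_def)
  then obtain g0 r n where r: "0 < r" and g0: "g0 holomorphic_on ball z0 r"
    and eq: "\<And>w. w \<in> ball z0 r \<Longrightarrow> f w = (w - z0) ^ n * g0 w"
    and ne: "\<And>w. w \<in> ball z0 r \<Longrightarrow> g0 w \<noteq> 0"
    using holomorphic_factor_zero_nonconstant[OF hol open_UNIV connected_UNIV UNIV_I z0] by metis
  define g where "g = (\<lambda>z. if z = z0 then g0 z else f z / (z - z0) ^ n)"
  have gball: "g z = g0 z" if "z \<in> ball z0 r" for z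
    using eq[OF that] by (auto simp: g_def)
  have "g holomorphic_on ball z0 r" using g0 by (rule holomorphic_transform) (simp add: gball)
  moreover have "g holomorphic_on - {z0}"
  proof (rule holomorphic_transform)
    show "(\<lambda>z. f z / (z - z0) ^ n) holomorphic_on - {z0}"
      by (intro holomorphic_intros holomorphic_on_subset[OF hol]) auto
  qed (auto simp: g_def)
  ultimately have "g holomorphic_on ball z0 r \<union> - {z0}" by (intro holomorphic_on_Un) auto
  moreover have "ball z0 r \<union> - {z0} = UNIV" using r by auto
  ultimately have g: "g holomorphic_on UNIV" by simp
  have fz: "f z = (z - z0) ^ n * g z" for z
    using eq[of z0] r by (cases "z = z0") (auto simp: g_def)
  show ?thesis
  proof (rule that[of "\<lambda>z. (- z0) ^ n * g z" n])
    show "(\<lambda>z. (- z0) ^ n * g z) holomorphic_on UNIV" using g by (intro holomorphic_intros)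
    show "(- z0) ^ n * g z0 \<noteq> 0" using nz ne[of z0] r by (simp add: g_def)
    show "f z = (1 - z / z0) ^ n * ((- z0) ^ n * g z)" for z
    proof -
      have "(1 - z / z0) ^ n * (- z0) ^ n = (z - z0) ^ n"
        unfolding power_mult_distrib[symmetric] using nz by (simp add: algebra_simps)
      then show ?thesis by (simp add: fz flip: mult.assoc)
    qed
  qed
qed

text \<open>Induction on the number of distinct zeros in the disc, which is finite since f 0
  \<noteq> 0 excludes the zero function. The list repeats each zero according to its
  multiplicity.\<close>

lemma entire_divide_zeros_in_disc:
  fixes f :: "complex \<Rightarrow> complex"
  assumes "f holomorphic_on UNIV" and "f 0 \<noteq> 0"
  shows "\<exists>zs h. h holomorphic_on UNIV \<and> (\<forall>z\<in>cball 0 R. h z \<noteq> 0) \<and>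
    (\<forall>z\<in>set zs. f z = 0 \<and> norm z \<le> R) \<and> (\<forall>z. f z = (\<Prod>\<zeta>\<leftarrow>zs. 1 - z / \<zeta>) * h z)"
  using assms
proof (induction "card {z \<in> cball 0 R. f z = 0}" arbitrary: f rule: less_induct)
  case less
  have fin: "finite {z \<in> cball 0 R. f z = 0}" if "f holomorphic_on UNIV" "f 0 \<noteq> 0" for f :: "complex \<Rightarrow> complex"
  proof (cases "f constant_on UNIV")
    case True
    then show ?thesis using that by (auto simp: constant_on_def)
  next
    case False
    then show ?thesis
      by (intro holomorphic_compact_finite_zeros[OF that(1)]) auto
  qed
  show ?case
  proof (cases "{z \<in> cball 0 R. f z = 0} = {}")
    case True
    then show ?thesis using less.prems by (intro exI[of _ "[]"] exI[of _ f]) auto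
  next
    case False
    then obtain z0 where z0: "z0 \<in> cball 0 R" "f z0 = 0" by blast
    obtain g n where g: "g holomorphic_on UNIV" "g z0 \<noteq> 0" and fg: "\<And>z. f z = (1 - z / z0) ^ n * g z"
      using entire_divide_zero[OF less.prems z0(2)] by metis
    have g0: "g 0 \<noteq> 0" using less.prems fg[of 0] by auto
    have sub: "g z = 0 \<Longrightarrow> f z = 0" for z using fg[of z] by simp
    have "{z \<in> cball 0 R. g z = 0} \<subset> {z \<in> cball 0 R. f z = 0}"
      using sub z0 g by blast
    then have "card {z \<in> cball 0 R. g z = 0} < card {z \<in> cball 0 R. f z = 0}"
      by (intro psubset_card_mono fin less.prems)
    from less.hyps[OF this g(1) g0] obtain zs h where h: "h holomorphic_on UNIV"
      "\<forall>z\<in>cball 0 R. h z \<noteq> 0" "\<forall>z\<in>set zs. g z = 0 \<and> norm z \<le> R"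
      "\<forall>z. g z = (\<Prod>\<zeta>\<leftarrow>zs. 1 - z / \<zeta>) * h z" by blast
    show ?thesis
    proof (intro exI[of _ "replicate n z0 @ zs"] exI[of _ h] conjI ballI allI)
      fix z assume "z \<in> set (replicate n z0 @ zs)"
      then show "f z = 0" "norm z \<le> R" using h(3) sub z0 by auto
    next
      fix z
      show "f z = (\<Prod>\<zeta>\<leftarrow>replicate n z0 @ zs. 1 - z / \<zeta>) * h z"
        by (simp only: fg[of z] h(4)[rule_format, of z] map_append map_replicate prod_list.append
            prod_list_replicate mult.assoc)
    qed (use h in auto)
  qed
qed

lemma has_field_derivative_prod_list_at_0:
  fixes zs :: "complex list"
  shows "((\<lambda>z. \<Prod>\<zeta>\<leftarrow>zs. 1 - z / \<zeta>) has_field_derivative - (\<Sum>\<zeta>\<leftarrow>zs. 1 / \<zeta>)) (at 0)"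
proof (induction zs)
  case (Cons y ys)
  have "((\<lambda>z. 1 - z / y) has_field_derivative 0 - 1 / y) (at 0)"
    by (intro DERIV_diff DERIV_const DERIV_cdivide DERIV_ident)
  from DERIV_mult[OF this Cons.IH] show ?case
    by (simp add: map_replicate_const prod_list_replicate algebra_simps)
qed simp

section \<open>Zero-free functions are nearly exponentials of linear functions\<close>

text \<open>Re L < A puts L closer to 0 than to 2 A, so L / (2 A - L) maps into the unit disc, and
  Schwarz' lemma applies after rescaling.\<close>

lemma Borel_Caratheodory:
  fixes L :: "complex \<Rightarrow> complex"
  assumes hol: "L holomorphic_on ball 0 R" and L0: "L 0 = 0"
    and Re: "\<And>z. norm z < R \<Longrightarrow> Re (L z) < A" and z: "norm z < R"
  shows "norm (L z) \<le> 2 * A * norm z / (R - norm z)"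
proof -
  have R: "R > 0" using z norm_ge_zero[of z] by linarith
  have A: "A > 0" using Re[of 0] R L0 by simp
  define \<phi> where "\<phi> = (\<lambda>w. L (of_real R * w) / (2 * of_real A - L (of_real R * w)))"
  have in_ball: "norm (of_real R * w) < R" if "norm w < 1" for w :: complex
    using that R by (simp add: norm_mult)
  have nz: "2 * of_real A - L (of_real R * w) \<noteq> 0" if "norm w < 1" for w
  proof
    assume "2 * of_real A - L (of_real R * w) = 0"
    then have "Re (L (of_real R * w)) = 2 * A" by (simp add: complex_eq_iff)
    then show False using Re[OF in_ball[OF that]] A by simp
  qed
  have lt: "norm (\<phi> w) < 1" if "norm w < 1" for w
  proof -
    define l where "l = L (of_real R * w)"
    have "(norm l)\<^sup>2 < (norm (2 * of_real A - l))\<^sup>2"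
    proof -
      have "A * (A - Re l) > 0" using A Re[OF in_ball[OF that]] by (simp add: l_def)
      then show ?thesis unfolding cmod_power2 by (simp add: power2_eq_square algebra_simps)
    qed
    then have "norm l < norm (2 * of_real A - l)" by (rule power2_less_imp_less) simp
    then show ?thesis using nz[OF that] by (simp add: \<phi>_def l_def norm_divide)
  qed
  have "\<phi> holomorphic_on ball 0 1"
    unfolding \<phi>_def
    by (intro holomorphic_intros holomorphic_on_compose_gen[OF _ hol, unfolded o_def])
       (use nz in_ball in auto)
  moreover have "\<phi> 0 = 0" by (simp add: \<phi>_def L0)
  moreover define w where "w = z / of_real R"
  moreover have w: "norm w < 1" using z R by (simp add: w_def norm_divide)
  ultimately have le: "norm (\<phi> w) \<le> norm w" using lt by (intro Schwarz_Lemma(1)) auto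
  have Lw: "L (of_real R * w) = L z" using R by (simp add: w_def)
  have "\<phi> w * (2 * of_real A - L z) = L z" using nz[OF w] unfolding \<phi>_def Lw by simp
  then have "L z = 2 * of_real A * \<phi> w - \<phi> w * L z" by (simp add: right_diff_distrib mult_ac)
  then have "norm (L z) \<le> norm (2 * of_real A * \<phi> w) + norm (\<phi> w * L z)"
    by (metis norm_triangle_ineq4)
  also have "\<dots> = 2 * A * norm (\<phi> w) + norm (\<phi> w) * norm (L z)" using A by (simp add: norm_mult)
  also have "\<dots> \<le> 2 * A * norm w + norm w * norm (L z)"
    using le A by (intro add_mono mult_left_mono mult_right_mono) auto
  finally have "(1 - norm w) * norm (L z) \<le> 2 * A * norm w" by (simp add: algebra_simps)
  then have "R * ((1 - norm w) * norm (L z)) \<le> R * (2 * A * norm w)" using R by simp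
  moreover have "R * norm w = norm z" using R by (simp add: w_def norm_divide)
  then have "R * ((1 - norm w) * norm (L z)) = (R - norm z) * norm (L z)"
    "R * (2 * A * norm w) = 2 * A * norm z"
    by (simp_all add: algebra_simps)
  ultimately have "(R - norm z) * norm (L z) \<le> 2 * A * norm z" by (simp only:)
  then show ?thesis using z by (simp add: pos_le_divide_eq mult.commute)
qed

text \<open>A logarithm of h / h 0 has real part below A, hence modulus at most 2 A on the half
  disc; Cauchy's inequality bounds its second derivative and Taylor's formula gives the error. That
  error scales like A / R^2, which is why growth below order two suffices.\<close>

lemma zero_free_exp_linear_approx:
  fixes h :: "complex \<Rightarrow> complex"
  assumes hol: "h holomorphic_on ball 0 R" and nz: "\<And>z. norm z < R \<Longrightarrow> h z \<noteq> 0"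
    and bd: "\<And>z. norm z < R \<Longrightarrow> norm (h z) < norm (h 0) * exp A"
    and z: "norm z \<le> R / 4" and R: "R > 0"
  obtains \<epsilon> where "h z = h 0 * exp (deriv h 0 / h 0 * z + \<epsilon>)" "norm \<epsilon> \<le> 64 * A * (norm z)\<^sup>2 / R\<^sup>2"
proof -
  have h0: "h 0 \<noteq> 0" using nz R by simp
  obtain L where L: "L holomorphic_on ball 0 R" "\<And>z. z \<in> ball 0 R \<Longrightarrow> h z / h 0 = exp (L z)"
  proof (rule contractible_imp_holomorphic_log[of "\<lambda>z. h z / h 0" "ball 0 R"])
    show "(\<lambda>z. h z / h 0) holomorphic_on ball 0 R" using hol h0 by (intro holomorphic_intros) auto
    show "contractible (ball (0::complex) R)" by (intro convex_imp_contractible convex_ball)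
  qed (use nz h0 in auto)
  define l where "l = (\<lambda>z. L z - L 0)"
  have "exp (L 0) = 1" using L(2)[of 0] R h0 by simp
  then have hl: "h z = h 0 * exp (l z)" if "norm z < R" for z
    using L(2)[of z] that h0 by (simp add: l_def exp_diff field_simps)
  have lhol: "l holomorphic_on ball 0 R" unfolding l_def using L(1) by (intro holomorphic_intros)
  have l0: "l 0 = 0" by (simp add: l_def)
  have Rel: "Re (l w) < A" if "norm w < R" for w
    using bd[OF that] hl[OF that] h0 by (simp add: norm_mult)
  have A: "A > 0" using Rel[of 0] l0 R by simp
  have lle: "norm (l w) \<le> 2 * A" if "norm w \<le> R / 2" for w
  proof -
    have "norm (l w) \<le> 2 * A * norm w / (R - norm w)"
      using that R by (intro Borel_Caratheodory[OF lhol l0 Rel]) auto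
    also have "\<dots> \<le> 2 * A * (R / 2) / (R - R / 2)"
      using that R A by (intro frac_le mult_left_mono mult_nonneg_nonneg) auto
    also have "\<dots> = 2 * A" using R by simp
    finally show ?thesis .
  qed
  have holball: "(deriv ^^ i) l holomorphic_on ball 0 R" for i
    using lhol by (intro holomorphic_higher_deriv) auto
  have der: "((deriv ^^ i) l has_field_derivative (deriv ^^ Suc i) l w) (at w within S)" if "norm w < R" for i w S
    using holomorphic_derivI[OF holball[of i] open_ball, of w S] that by simp
  \<comment> \<open>The circle of radius R/4 about w stays in the half disc; 64 = 2! * 2 *
    4^2.\<close>
  have d2: "norm ((deriv ^^ 2) l w) \<le> 64 * A / R\<^sup>2" if "w \<in> cball 0 (R / 4)" for w
  proof -
    have sub: "norm x \<le> R / 2" if "x \<in> cball w (R / 4)" for x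
    proof -
      have "norm x \<le> norm w + norm (x - w)" by (metis add_diff_cancel_left' diff_add_cancel norm_triangle_ineq add.commute)
      then show ?thesis using that \<open>w \<in> cball 0 (R / 4)\<close> by (simp add: dist_norm norm_minus_commute)
    qed
    have subs: "cball w (R / 4) \<subseteq> ball 0 R"
    proof
      fix x assume "x \<in> cball w (R / 4)"
      from sub[OF this] R show "x \<in> ball 0 R" by simp
    qed
    have "norm ((deriv ^^ 2) l w) \<le> fact 2 * (2 * A) / (R / 4) ^ 2"
    proof (rule Cauchy_inequality)
      show "l holomorphic_on ball w (R / 4)"
        by (rule holomorphic_on_subset[OF lhol]) (use subs ball_subset_cball in blast)
      show "continuous_on (cball w (R / 4)) l"
        by (rule continuous_on_subset[OF holomorphic_on_imp_continuous_on[OF lhol]]) (use subs in blast)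
      show "norm (l x) \<le> 2 * A" if "norm (w - x) = R / 4" for x
        using that by (intro lle sub) (auto simp: dist_norm)
    qed (use R in auto)
    then show ?thesis by (simp add: power_divide)
  qed
  have "norm ((deriv ^^ 0) l z - (\<Sum>i\<le>1. (deriv ^^ i) l 0 * (z - 0) ^ i / fact i))
      \<le> (64 * A / R\<^sup>2) * norm (z - 0) ^ Suc 1 / fact 1"
  proof (rule complex_Taylor[where S = "cball 0 (R / 4)" and f = "\<lambda>i. (deriv ^^ i) l"])
    show "((deriv ^^ i) l has_field_derivative (deriv ^^ Suc i) l x) (at x within cball 0 (R / 4))"
      if "x \<in> cball 0 (R / 4)" for i x using that R by (intro der) auto
    show "norm ((deriv ^^ Suc 1) l x) \<le> 64 * A / R\<^sup>2" if "x \<in> cball 0 (R / 4)" for x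
      using d2[OF that] by (simp add: numeral_2_eq_2)
  qed (use z R in auto)
  then have le: "norm (l z - deriv l 0 * z) \<le> 64 * A * (norm z)\<^sup>2 / R\<^sup>2"
    by (simp add: l0 power2_eq_square)
  have "(l has_field_derivative deriv l 0) (at 0)" using der[of 0 0 UNIV] R by simp
  then have "((\<lambda>z. h 0 * exp (l z)) has_field_derivative h 0 * deriv l 0) (at 0)"
    by (auto intro!: derivative_eq_intros simp: l0)
  then have "(h has_field_derivative h 0 * deriv l 0) (at 0)"
    by (rule DERIV_cong_ev[THEN iffD1, rotated 3])
       (auto simp: eventually_nhds hl intro!: exI[of _ "ball 0 R"] R)
  then have "deriv h 0 / h 0 = deriv l 0" using h0 by (simp add: DERIV_imp_deriv)
  then show ?thesis using le hl[of z] z R by (intro that[of "l z - deriv l 0 * z"]) auto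
qed

lemma norm_exp_minus_one_le:
  fixes w :: complex
  assumes "norm w \<le> 1 / 2"
  shows "norm (exp w - 1) \<le> 2 * norm w"
proof -
  have "norm (exp w - exp 0) \<le> 2 * norm (w - 0)"
  proof (rule field_differentiable_bound[of "cball 0 (1/2)" exp exp])
    show "norm (exp z) \<le> 2" if "z \<in> cball (0::complex) (1/2)" for z
      using that by (intro exp_bound_half) auto
  qed (use assms in \<open>auto intro!: derivative_eq_intros\<close>)
  then show ?thesis by simp
qed

text \<open>A substitute for Hadamard's factorisation: no infinite product is needed, because
  on a large disc \<open>f\<close> differs from the product over its zeros there by a zero-free factor whose
  logarithm is nearly linear.\<close>

lemma entire_approx_by_zeros:
  fixes f :: "complex \<Rightarrow> complex"
  assumes hol: "f holomorphic_on UNIV" and f0: "f 0 \<noteq> 0"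
    and growth: "\<And>e. e > 0 \<Longrightarrow> \<exists>C. \<forall>z. norm (f z) \<le> C * exp (e * (norm z)\<^sup>2)"
    and \<rho>: "\<rho> > 0" and e: "e > 0"
  obtains zs b where "\<And>\<zeta>. \<zeta> \<in> set zs \<Longrightarrow> f \<zeta> = 0"
    "b = deriv f 0 / f 0 + (\<Sum>\<zeta>\<leftarrow>zs. 1 / \<zeta>)"
    "\<And>z. norm z \<le> \<rho> \<Longrightarrow> norm (f z - f 0 * exp (b * z) * (\<Prod>\<zeta>\<leftarrow>zs. 1 - z / \<zeta>)) \<le> e"
proof -
  have "compact (f ` cball 0 \<rho>)"
    by (intro compact_continuous_image continuous_on_subset[OF holomorphic_on_imp_continuous_on[OF hol]]) auto
  then have "bounded (f ` cball 0 \<rho>)" by (rule compact_imp_bounded)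
  then obtain K where K: "K > 0" "\<And>z. norm z \<le> \<rho> \<Longrightarrow> norm (f z) \<le> K"
    unfolding bounded_pos by auto
  define \<eta> where "\<eta> = min (1 / 2) (e / (2 * K))"
  have \<eta>: "\<eta> > 0" "\<eta> \<le> 1 / 2" "K * (2 * \<eta>) \<le> e"
    using e K by (auto simp: \<eta>_def min_def field_simps)
  \<comment> \<open>\<open>d\<close> and \<open>R\<close> are tuned to the final error 64 A \<rho>^2
    / R^2 with A = D + 4 d R^2: it splits into 64 D \<rho>^2 / R^2 and 256 d \<rho>^2, each at most
    \<eta>/2. The summand 4 \<rho> of \<open>R\<close> puts the disc of radius \<rho> inside that of
    radius R/4.\<close>
  define d where "d = \<eta> / (512 * \<rho>\<^sup>2)"
  have d: "d > 0" using \<eta> \<rho> by (simp add: d_def)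
  obtain C where C: "\<And>z. norm (f z) \<le> C * exp (d * (norm z)\<^sup>2)" using growth[OF d] by blast
  have C0: "norm (f 0) \<le> C" using C[of 0] by simp
  moreover have "norm (f 0) > 0" using f0 by simp
  ultimately have Cpos: "C > 0" by linarith
  define D where "D = ln (C / norm (f 0)) + 1"
  have D: "D \<ge> 1" using C0 f0 Cpos by (simp add: D_def)
  define R where "R = 4 * \<rho> + 16 * \<rho> * D / \<eta>"
  have R1: "R \<ge> 4 * \<rho>" "R > 0" and R2: "R\<^sup>2 \<ge> 128 * \<rho>\<^sup>2 * D / \<eta>"
  proof -
    show "R \<ge> 4 * \<rho>" using \<rho> D \<eta> by (simp add: R_def)
    then show "R > 0" using \<rho> by simp
    have "2 * (4 * \<rho>) * (16 * \<rho> * D / \<eta>) \<le> R\<^sup>2"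
      unfolding R_def power2_sum by simp
    then show "R\<^sup>2 \<ge> 128 * \<rho>\<^sup>2 * D / \<eta>" by (simp add: power2_eq_square mult_ac)
  qed
  obtain zs h where h: "h holomorphic_on UNIV" "\<And>z. z \<in> cball 0 R \<Longrightarrow> h z \<noteq> 0"
    and zs: "\<And>z. z \<in> set zs \<Longrightarrow> f z = 0 \<and> norm z \<le> R"
    and fh: "\<And>z. f z = (\<Prod>\<zeta>\<leftarrow>zs. 1 - z / \<zeta>) * h z"
    using entire_divide_zeros_in_disc[OF hol f0, of R] by metis
  have zsnz: "\<zeta> \<noteq> 0" if "\<zeta> \<in> set zs" for \<zeta> using zs[OF that] f0 by auto
  have prod0: "(\<Prod>\<zeta>\<leftarrow>zs. 1 - 0 / \<zeta>) = 1" by (induction zs) auto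
  have h0: "h 0 = f 0" using fh[of 0] prod0 by simp
  define A where "A = D + d * (2 * R)\<^sup>2"
  \<comment> \<open>On the circle of radius 2 R every factor 1 - w / \<zeta> has modulus at least 1,
    since |\<zeta>| \<le> R. So h inherits the bound of f there, and the maximum principle extends
    it inward.\<close>
  have hb: "norm (h z) \<le> C * exp (d * (2 * R)\<^sup>2)" if "norm z < 2 * R" for z
  proof (rule maximum_modulus_frontier[of h "ball 0 (2 * R)"])
    fix w :: complex assume "w \<in> frontier (ball 0 (2 * R))"
    then have w: "norm w = 2 * R" using R1 by simp
    have "1 \<le> norm (\<Prod>\<zeta>\<leftarrow>zs. 1 - w / \<zeta>)"
    proof -
      have "1 \<le> norm (\<Prod>\<zeta>\<leftarrow>ys. 1 - w / \<zeta>)" if "set ys \<subseteq> set zs" for ys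
        using that
      proof (induction ys)
        case (Cons y ys)
        then have y: "norm y \<le> R" "y \<noteq> 0" using zs zsnz by auto
        have "2 \<le> norm (w / y)" using w y by (simp add: norm_divide field_simps)
        then have "1 \<le> norm (1 - w / y)" using norm_triangle_ineq3[of 1 "w / y"] by simp
        then have "1 * 1 \<le> norm (1 - w / y) * norm (\<Prod>\<zeta>\<leftarrow>ys. 1 - w / \<zeta>)"
          using Cons by (intro mult_mono) auto
        then show ?case by (simp add: norm_mult)
      qed simp
      then show ?thesis by simp
    qed
    then have "1 * norm (h w) \<le> norm (\<Prod>\<zeta>\<leftarrow>zs. 1 - w / \<zeta>) * norm (h w)" by (intro mult_right_mono) auto
    also have "\<dots> = norm (f w)" by (simp add: fh norm_mult)
    also have "\<dots> \<le> C * exp (d * (2 * R)\<^sup>2)" using C[of w] w by simp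
    finally show "norm (h w) \<le> C * exp (d * (2 * R)\<^sup>2)" by simp
  qed (use that in \<open>auto intro: holomorphic_on_subset[OF h(1)]
        continuous_on_subset[OF holomorphic_on_imp_continuous_on[OF h(1)]]\<close>)
  have hA: "norm (h z) < norm (h 0) * exp A" if "norm z < R" for z
  proof -
    have "norm (h z) \<le> C * exp (d * (2 * R)\<^sup>2)" using that R1 by (intro hb) auto
    also have "\<dots> < C * exp (d * (2 * R)\<^sup>2) * exp 1" using Cpos by simp
    also have "\<dots> = norm (h 0) * exp A"
      using Cpos f0 by (simp add: A_def D_def h0 exp_add)
    finally show ?thesis .
  qed
  define b where "b = deriv h 0 / h 0"
  have b: "b = deriv f 0 / f 0 + (\<Sum>\<zeta>\<leftarrow>zs. 1 / \<zeta>)"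
  proof -
    have "(h has_field_derivative deriv h 0) (at 0)"
      using holomorphic_derivI[OF h(1) open_UNIV UNIV_I] by simp
    then have "((\<lambda>z. (\<Prod>\<zeta>\<leftarrow>zs. 1 - z / \<zeta>) * h z) has_field_derivative
        - (\<Sum>\<zeta>\<leftarrow>zs. 1 / \<zeta>) * h 0 + deriv h 0 * (\<Prod>\<zeta>\<leftarrow>zs. 1 - 0 / \<zeta>)) (at 0)"
      by (rule DERIV_mult[OF has_field_derivative_prod_list_at_0])
    moreover have "(\<lambda>z. (\<Prod>\<zeta>\<leftarrow>zs. 1 - z / \<zeta>) * h z) = f" using fh by auto
    ultimately have "(f has_field_derivative - (\<Sum>\<zeta>\<leftarrow>zs. 1 / \<zeta>) * f 0 + deriv h 0) (at 0)"
      unfolding prod0 h0 by simp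
    then have "deriv f 0 = - (\<Sum>\<zeta>\<leftarrow>zs. 1 / \<zeta>) * f 0 + deriv h 0" by (rule DERIV_imp_deriv)
    then show ?thesis using f0 by (simp add: b_def h0 field_simps)
  qed
  show ?thesis
  proof (rule that[OF _ b])
    fix z :: complex assume z: "norm z \<le> \<rho>"
    obtain \<epsilon> where \<epsilon>: "h z = h 0 * exp (b * z + \<epsilon>)" "norm \<epsilon> \<le> 64 * A * (norm z)\<^sup>2 / R\<^sup>2"
      unfolding b_def
      by (rule zero_free_exp_linear_approx[of h R A z])
         (use h hA z R1 in \<open>auto intro: holomorphic_on_subset\<close>)
    have "64 * A * (norm z)\<^sup>2 / R\<^sup>2 \<le> 64 * A * \<rho>\<^sup>2 / R\<^sup>2"
      using z D d by (intro divide_right_mono mult_left_mono power_mono) (auto simp: A_def)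
    also have "\<dots> = 64 * D * \<rho>\<^sup>2 / R\<^sup>2 + 256 * d * \<rho>\<^sup>2"
      using R1 by (simp add: A_def field_simps)
    also have "256 * d * \<rho>\<^sup>2 = \<eta> / 2" using \<rho> by (simp add: d_def)
    also have "64 * D * \<rho>\<^sup>2 / R\<^sup>2 \<le> \<eta> / 2"
    proof -
      have "128 * \<rho>\<^sup>2 * D \<le> R\<^sup>2 * \<eta>" using R2 \<eta> by (simp add: field_simps)
      then show ?thesis using R1 by (simp add: field_simps)
    qed
    finally have e\<eta>: "norm \<epsilon> \<le> \<eta>" using \<epsilon>(2) by linarith
    define q where "q = f 0 * exp (b * z) * (\<Prod>\<zeta>\<leftarrow>zs. 1 - z / \<zeta>)"
    have "f z = q * exp \<epsilon>" by (simp add: fh[of z] \<epsilon>(1) h0 q_def exp_add)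
    then have "q = f z * exp (- \<epsilon>)" by (simp add: exp_minus)
    then have "norm (f z - q) = norm (f z) * norm (exp (- \<epsilon>) - 1)"
      by (simp add: norm_mult[symmetric] algebra_simps norm_minus_commute)
    also have "\<dots> \<le> K * (2 * \<eta>)"
      using K z e\<eta> \<eta> norm_exp_minus_one_le[of "- \<epsilon>"] by (intro mult_mono) auto
    finally show "norm (f z - f 0 * exp (b * z) * (\<Prod>\<zeta>\<leftarrow>zs. 1 - z / \<zeta>)) \<le> e"
      using \<eta> by (simp add: q_def)
  qed (use zs in auto)
qed

section \<open>Sums of symmetric imaginary shifts\<close>

lemma poly_prod_list_linear:
  fixes xs :: "'a :: comm_ring_1 list"
  shows "poly (\<Prod>x\<leftarrow>xs. [:-x, 1:]) z = (\<Prod>x\<leftarrow>xs. z - x)"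
  by (induction xs) (auto simp: algebra_simps)

lemma complex_poly_root_list:
  fixes p :: "complex poly"
  assumes "p \<noteq> 0"
  obtains ys where "\<And>z. poly p z = lead_coeff p * (\<Prod>\<zeta>\<leftarrow>ys. z - \<zeta>)"
    "length ys = degree p" "\<And>\<zeta>. \<zeta> \<in> set ys \<Longrightarrow> poly p \<zeta> = 0"
proof -
  define A where "A = proots p"
  have A: "size A = degree p" "p = smult (lead_coeff p) (\<Prod>x\<in>#A. [:-x, 1:])"
    unfolding A_def complex_poly_decompose_multiset by (simp_all add: size_proots_complex)
  obtain ys where ys: "mset ys = A" using ex_mset by blast
  have eq: "poly p z = lead_coeff p * (\<Prod>\<zeta>\<leftarrow>ys. z - \<zeta>)" for z
  proof -
    have "(\<Prod>x\<in>#A. [:-x, 1:]) = (\<Prod>x\<leftarrow>ys. [:-x, 1:])"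
      by (simp add: ys[symmetric] flip: prod_mset_prod_list)
    then show ?thesis by (subst A(2)) (simp add: poly_prod_list_linear)
  qed
  show ?thesis
  proof (rule that[OF eq])
    show "length ys = degree p" using A(1) ys by auto
    show "poly p \<zeta> = 0" if "\<zeta> \<in> set ys" for \<zeta>
      using that by (auto simp: eq prod_list_zero_iff)
  qed
qed

lemma norm_prod_list_mono:
  fixes f g :: "'a \<Rightarrow> complex"
  assumes "\<And>x. x \<in> set xs \<Longrightarrow> norm (f x) \<le> norm (g x)"
  shows "norm (\<Prod>x\<leftarrow>xs. f x) \<le> norm (\<Prod>x\<leftarrow>xs. g x)"
  using assms by (induction xs) (auto simp: norm_mult intro!: mult_mono)

lemma norm_prod_list_strict_mono:
  fixes f g :: "'a \<Rightarrow> complex"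
  assumes "\<And>x. x \<in> set xs \<Longrightarrow> norm (f x) < norm (g x)" and "xs \<noteq> []"
  shows "norm (\<Prod>x\<leftarrow>xs. f x) < norm (\<Prod>x\<leftarrow>xs. g x)"
  using assms(2,1)
proof (induction xs rule: list_nonempty_induct)
  case (cons x xs)
  have fg: "norm (f x) < norm (g x)" using cons by auto
  have "norm (f x) * norm (\<Prod>x\<leftarrow>xs. f x) < norm (g x) * norm (\<Prod>x\<leftarrow>xs. g x)"
    using cons fg le_less_trans[OF norm_ge_zero fg] by (intro mult_strict_mono) auto
  then show ?case by (simp add: norm_mult)
qed simp

text \<open>The distance to \<zeta> does not grow as long as z' stays between z and the mirror image
  of z in the horizontal line through \<zeta>.\<close>

lemma norm_diff_less_vertical:
  fixes z z' \<zeta> :: complex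
  assumes "Re z = Re z'"
  shows "Im z \<le> Im z' \<Longrightarrow> Im z' \<le> 2 * Im \<zeta> - Im z \<Longrightarrow> norm (z' - \<zeta>) \<le> norm (z - \<zeta>)"
    and "Im z < Im z' \<Longrightarrow> Im z' < 2 * Im \<zeta> - Im z \<Longrightarrow> norm (z' - \<zeta>) < norm (z - \<zeta>)"
proof -
  have eq: "(norm (z - \<zeta>))\<^sup>2 - (norm (z' - \<zeta>))\<^sup>2 = (Im z' - Im z) * (2 * Im \<zeta> - Im z - Im z')"
    unfolding cmod_power2 using assms by (simp add: power2_eq_square algebra_simps)
  show "norm (z' - \<zeta>) \<le> norm (z - \<zeta>)" if "Im z \<le> Im z'" "Im z' \<le> 2 * Im \<zeta> - Im z"
  proof (rule power2_le_imp_le)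
    have "0 \<le> (Im z' - Im z) * (2 * Im \<zeta> - Im z - Im z')" using that by (intro mult_nonneg_nonneg) auto
    then show "(norm (z' - \<zeta>))\<^sup>2 \<le> (norm (z - \<zeta>))\<^sup>2" using eq by linarith
  qed simp
  show "norm (z' - \<zeta>) < norm (z - \<zeta>)" if "Im z < Im z'" "Im z' < 2 * Im \<zeta> - Im z"
  proof (rule power2_less_imp_less)
    have "0 < (Im z' - Im z) * (2 * Im \<zeta> - Im z - Im z')" using that by (intro mult_pos_pos) auto
    then show "(norm (z' - \<zeta>))\<^sup>2 < (norm (z - \<zeta>))\<^sup>2" using eq by linarith
  qed simp
qed

text \<open>Below height \<kappa> + \<delta>/2, z is no farther from any root than z - \<i>
  \<delta>, so |p z| \<le> |p (z - \<i> \<delta>)|, and |x| < 1 = |u| forbids cancellation. The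
  degree bound is recorded so that a nonconstant p stays nonconstant.\<close>

lemma poly_shift_combination_roots:
  fixes p :: "complex poly" and u x :: complex
  assumes p0: "p \<noteq> 0" and roots: "\<And>z. poly p z = 0 \<Longrightarrow> \<kappa> \<le> Im z"
    and u: "norm u = 1" and x: "norm x < 1" and \<delta>: "\<delta> > 0"
  defines "p' \<equiv> smult u (pcompose p [:- \<i> * of_real \<delta>, 1:]) - smult x p"
  shows "p' \<noteq> 0" "degree p \<le> degree p'" "\<And>z. poly p' z = 0 \<Longrightarrow> \<kappa> + \<delta> / 2 \<le> Im z"
proof -
  have "u \<noteq> x" using u x by auto
  define r where "r = pcompose p [:- \<i> * of_real \<delta>, 1:]"
  have dr: "degree r = degree p" by (simp add: r_def degree_pcompose)
  have lr: "lead_coeff r = lead_coeff p" unfolding r_def by (subst lead_coeff_comp) auto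
  have p'r: "p' = smult u r - smult x p" by (simp add: p'_def r_def)
  have "coeff p' (degree p) = (u - x) * lead_coeff p"
    using lr dr unfolding p'r by (simp add: algebra_simps)
  then have nz: "coeff p' (degree p) \<noteq> 0" using p0 \<open>u \<noteq> x\<close> by simp
  then show "p' \<noteq> 0" by auto
  show "degree p \<le> degree p'" using nz by (rule le_degree)
  fix z assume z: "poly p' z = 0"
  show "\<kappa> + \<delta> / 2 \<le> Im z"
  proof (rule ccontr)
    assume "\<not> ?thesis"
    then have Imz: "Im z < \<kappa> + \<delta> / 2" by simp
    define w where "w = z - \<i> * of_real \<delta>"
    have "poly p w \<noteq> 0" using roots[of w] Imz \<delta> by (auto simp: w_def)
    obtain ys where ys: "\<And>z. poly p z = lead_coeff p * (\<Prod>\<zeta>\<leftarrow>ys. z - \<zeta>)"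
      "\<And>\<zeta>. \<zeta> \<in> set ys \<Longrightarrow> poly p \<zeta> = 0"
      using complex_poly_root_list[OF p0] by metis
    have "norm (\<Prod>\<zeta>\<leftarrow>ys. z - \<zeta>) \<le> norm (\<Prod>\<zeta>\<leftarrow>ys. w - \<zeta>)"
    proof (intro norm_prod_list_mono norm_diff_less_vertical(1))
      fix \<zeta> assume "\<zeta> \<in> set ys"
      then have "\<kappa> \<le> Im \<zeta>" using roots ys by auto
      then show "Im z \<le> 2 * Im \<zeta> - Im w" using Imz by (simp add: w_def)
    qed (use \<delta> in \<open>auto simp: w_def\<close>)
    then have le: "norm (poly p z) \<le> norm (poly p w)" by (simp add: ys(1) norm_mult mult_left_mono)
    have "u * poly p w = x * poly p z"
      using z by (simp add: p'_def poly_pcompose w_def algebra_simps)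
    then have "norm u * norm (poly p w) = norm x * norm (poly p z)" by (metis norm_mult)
    also have "\<dots> \<le> norm x * norm (poly p w)" using le by (intro mult_left_mono) auto
    also have "\<dots> < 1 * norm (poly p w)" using x \<open>poly p w \<noteq> 0\<close> by (intro mult_strict_right_mono) auto
    finally show False using u by simp
  qed
qed

definition shift_poly :: "real \<Rightarrow> complex poly \<Rightarrow> (complex \<Rightarrow> complex) \<Rightarrow> complex \<Rightarrow> complex" where
  "shift_poly \<delta> P q z = (\<Sum>k\<le>degree P. coeff P k * q (z - \<i> * of_real (real k * \<delta>)))"

lemma shift_poly_altdef:
  assumes "degree P \<le> n"
  shows "shift_poly \<delta> P q z = (\<Sum>k\<le>n. coeff P k * q (z - \<i> * of_real (real k * \<delta>)))"
  unfolding shift_poly_def using assms by (intro sum.mono_neutral_left) (auto intro: coeff_eq_0)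

lemma shift_poly_smult: "shift_poly \<delta> (smult c P) q z = c * shift_poly \<delta> P q z"
  by (simp add: shift_poly_altdef[OF degree_smult_le] shift_poly_def sum_distrib_left mult_ac)

text \<open>Multiplication of P by a linear factor corresponds to composition of operators, which
  allows P to be processed root by root.\<close>

lemma shift_poly_linear_factor:
  "shift_poly \<delta> ([:- x, 1:] * P) q z = shift_poly \<delta> P q (z - \<i> * of_real \<delta>) - x * shift_poly \<delta> P q z"
proof -
  define n where "n = degree P"
  have deg: "degree ([:- x, 1:] * P) \<le> Suc n"
    using degree_mult_le[of "[:- x, 1:]" P] by (simp add: n_def)
  have Q: "[:- x, 1:] * P = pCons 0 P - smult x P" by simp
  have "shift_poly \<delta> ([:- x, 1:] * P) q z
      = (\<Sum>k\<le>Suc n. coeff (pCons 0 P) k * q (z - \<i> * of_real (real k * \<delta>)))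
        - x * (\<Sum>k\<le>Suc n. coeff P k * q (z - \<i> * of_real (real k * \<delta>)))"
    unfolding shift_poly_altdef[OF deg] unfolding Q
    by (simp only: coeff_diff coeff_smult left_diff_distrib sum_subtractf sum_distrib_left mult.assoc)
  also have "(\<Sum>k\<le>Suc n. coeff P k * q (z - \<i> * of_real (real k * \<delta>))) = shift_poly \<delta> P q z"
    by (rule shift_poly_altdef[symmetric]) (simp add: n_def)
  also have "(\<Sum>k\<le>Suc n. coeff (pCons 0 P) k * q (z - \<i> * of_real (real k * \<delta>)))
      = shift_poly \<delta> P q (z - \<i> * of_real \<delta>)"
    unfolding sum.atMost_Suc_shift shift_poly_def n_def
    by (simp add: algebra_simps)
  finally show ?thesis .
qed

text \<open>Each linear factor raises the lower bound for the zeros by \<delta>/2. As b is real, the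
  shift multiplies exp (b z) by a number of modulus 1, which becomes the \<open>u\<close> of
  \<open>poly_shift_combination_roots\<close>.\<close>

lemma shift_poly_exp_poly:
  fixes p :: "complex poly" and b :: real
  assumes "p \<noteq> 0" and "\<And>z. poly p z = 0 \<Longrightarrow> 0 \<le> Im z" and "\<delta> > 0" and "\<And>x. x \<in> set xs \<Longrightarrow> norm x < 1"
  shows "\<exists>p'. p' \<noteq> 0 \<and> degree p \<le> degree p' \<and> (\<forall>z. poly p' z = 0 \<longrightarrow> real (length xs) * \<delta> / 2 \<le> Im z) \<and>
    (\<forall>z. shift_poly \<delta> (\<Prod>x\<leftarrow>xs. [:- x, 1:]) (\<lambda>z. exp (of_real b * z) * poly p z) z
        = exp (of_real b * z) * poly p' z)"
  using assms(4)
proof (induction xs)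
  case Nil
  then show ?case using assms by (intro exI[of _ p]) (auto simp: shift_poly_def)
next
  case (Cons x xs)
  let ?q = "\<lambda>z. exp (of_real b * z) * poly p z"
  obtain p1 where p1: "p1 \<noteq> 0" "degree p \<le> degree p1" "\<And>z. poly p1 z = 0 \<Longrightarrow> real (length xs) * \<delta> / 2 \<le> Im z"
    and eq: "\<And>z. shift_poly \<delta> (\<Prod>x\<leftarrow>xs. [:- x, 1:]) ?q z = exp (of_real b * z) * poly p1 z"
    using Cons by auto
  define u where "u = exp (- \<i> * of_real (b * \<delta>))"
  have u: "norm u = 1" by (simp add: u_def)
  define p2 where "p2 = smult u (pcompose p1 [:- \<i> * of_real \<delta>, 1:]) - smult x p1"
  have x: "norm x < 1" using Cons.prems by simp
  have p2: "p2 \<noteq> 0" "degree p1 \<le> degree p2" "\<And>z. poly p2 z = 0 \<Longrightarrow> real (length xs) * \<delta> / 2 + \<delta> / 2 \<le> Im z"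
    using poly_shift_combination_roots[of p1 "real (length xs) * \<delta> / 2" u x \<delta>] p1 u x assms(3)
    unfolding p2_def by blast+
  show ?case
  proof (intro exI[of _ p2] conjI allI impI)
    fix z
    have "exp (of_real b * (z - \<i> * of_real \<delta>)) = exp (of_real b * z) * u"
      unfolding u_def exp_add[symmetric] by (simp add: algebra_simps)
    then have "shift_poly \<delta> (\<Prod>x\<leftarrow>x # xs. [:- x, 1:]) ?q z
       = exp (of_real b * z) * (u * poly p1 (z - \<i> * of_real \<delta>) - x * poly p1 z)"
      by (simp only: list.map prod_list.Cons shift_poly_linear_factor eq) (simp add: algebra_simps)
    then show "shift_poly \<delta> (\<Prod>x\<leftarrow>x # xs. [:- x, 1:]) ?q z = exp (of_real b * z) * poly p2 z"
      by (simp add: p2_def poly_pcompose)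
  next
    fix z assume "poly p2 z = 0"
    from p2(3)[OF this] show "real (length (x # xs)) * \<delta> / 2 \<le> Im z" by (simp add: field_simps)
  qed (use p1 p2 in auto)
qed

text \<open>The one-sided sum \<open>E\<close> over the shifts towards \<open>-\<i>\<infinity>\<close> has all its zeros in the upper
  half-plane, so \<open>|E|\<close> dominates the modulus of its reflection in the lower half-plane.\<close>

lemma symmetric_shift_sum_nonzero:
  fixes \<beta> :: "nat \<Rightarrow> real" and zs :: "complex list" and b c \<delta> :: real
  assumes zs: "\<And>\<zeta>. \<zeta> \<in> set zs \<Longrightarrow> \<zeta> \<noteq> 0 \<and> Im \<zeta> = 0" and b: "zs = [] \<Longrightarrow> b = 0" and c: "c \<noteq> 0"
    and \<delta>: "\<delta> > 0" and m: "m \<ge> 1" "\<beta> m \<noteq> 0"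
    and roots: "\<And>x::complex. norm x \<ge> 1 \<Longrightarrow> (\<Sum>k\<le>m. of_real (\<beta> k) * x ^ k) \<noteq> 0"
    and z: "Im z < 0"
  defines "q \<equiv> \<lambda>z. of_real c * exp (of_real b * z) * (\<Prod>\<zeta>\<leftarrow>zs. 1 - z / \<zeta>)"
  shows "(\<Sum>k\<le>m. of_real (\<beta> k) * (q (z - \<i> * of_real (real k * \<delta>)) + q (z + \<i> * of_real (real k * \<delta>)))) \<noteq> 0"
\<comment> \<open>Without zeros there is no strict inequality to use. Since b = 0 here, q is
  constant and the sum reduces to 2 c P 1, which is nonzero because 1 is not a root of P.\<close>
proof (cases "zs = []")
  case True
  then have "q w = of_real c" for w using b by (simp add: q_def)
  then have "(\<Sum>k\<le>m. of_real (\<beta> k) * (q (z - \<i> * of_real (real k * \<delta>)) + q (z + \<i> * of_real (real k * \<delta>))))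
      = 2 * of_real c * (\<Sum>k\<le>m. of_real (\<beta> k) * 1 ^ k)"
    by (simp add: sum_distrib_left mult_ac)
  then show ?thesis using c roots[of 1] by simp
next
  case False
  define p where "p = smult (of_real c) (\<Prod>\<zeta>\<leftarrow>zs. [:1, - 1 / \<zeta>:])"
  have pp: "poly p w = of_real c * (\<Prod>\<zeta>\<leftarrow>zs. 1 - w / \<zeta>)" for w
  proof -
    have "poly (\<Prod>\<zeta>\<leftarrow>ys. [:1, - 1 / \<zeta>:]) w = (\<Prod>\<zeta>\<leftarrow>ys. 1 - w / \<zeta>)" for ys
      by (induction ys) (auto simp: algebra_simps)
    then show ?thesis by (simp add: p_def)
  qed
  have qp: "q w = exp (of_real b * w) * poly p w" for w by (simp add: q_def pp)
  have "degree (\<Prod>\<zeta>\<leftarrow>ys. [:1, - 1 / \<zeta>:]) = length ys \<and> (\<Prod>\<zeta>\<leftarrow>ys. [:1, - 1 / \<zeta>:]) \<noteq> 0"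
    if "set ys \<subseteq> set zs" for ys
    using that
  proof (induction ys)
    case (Cons y ys)
    then have y: "y \<noteq> 0" using zs by auto
    have "[:1, - 1 / y:] * (\<Prod>\<zeta>\<leftarrow>ys. [:1, - 1 / \<zeta>:]) \<noteq> 0" using Cons by (intro no_zero_divisors) auto
    moreover have "degree ([:1, - 1 / y:] * (\<Prod>\<zeta>\<leftarrow>ys. [:1, - 1 / \<zeta>:])) = Suc (length ys)"
      using Cons y by (subst degree_mult_eq) auto
    ultimately show ?case by (simp only: list.map prod_list.Cons list.size) simp
  qed auto
  from this[of zs] have degp: "degree p = length zs" and p0: "p \<noteq> 0" using c by (auto simp: p_def)
  have proots: "Im w = 0" if "poly p w = 0" for w
  proof -
    have "0 \<in> set (map (\<lambda>\<zeta>. 1 - w / \<zeta>) zs)" using that c by (simp add: pp prod_list_zero_iff)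
    then obtain \<zeta> where "\<zeta> \<in> set zs" "1 - w / \<zeta> = 0" by auto
    then show ?thesis using zs[of \<zeta>] by (auto simp: field_simps)
  qed
  define P where "P = (\<Sum>k\<le>m. monom (complex_of_real (\<beta> k)) k)"
  have coeffP: "coeff P k = (if k \<le> m then of_real (\<beta> k) else 0)" for k
    by (auto simp: P_def coeff_sum coeff_monom)
  have degP: "degree P = m"
    using m by (intro antisym degree_le le_degree) (auto simp: coeffP)
  have P0: "P \<noteq> 0" using m coeffP[of m] by auto
  have polyP: "poly P x = (\<Sum>k\<le>m. of_real (\<beta> k) * x ^ k)" for x
    by (simp add: P_def poly_sum poly_monom)
  define A where "A = proots P"
  have A: "size A = degree P" "P = smult (lead_coeff P) (\<Prod>x\<in>#A. [:-x, 1:])"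
    unfolding A_def complex_poly_decompose_multiset by (simp_all add: size_proots_complex)
  obtain xs where xs: "mset xs = A" using ex_mset by blast
  have PA: "P = smult (lead_coeff P) (\<Prod>x\<leftarrow>xs. [:-x, 1:])"
    by (subst A(2)) (simp add: xs[symmetric] flip: prod_mset_prod_list)
  have lenxs: "length xs = m" using A(1) xs degP by auto
  have xs1: "norm x < 1" if "x \<in> set xs" for x
  proof (rule ccontr)
    assume "\<not> ?thesis"
    then have "poly P x \<noteq> 0" using roots[of x] by (simp add: polyP)
    moreover have "poly P x = 0"
      using that by (subst PA) (auto simp: poly_prod_list_linear prod_list_zero_iff)
    ultimately show False by simp
  qed
  obtain p' where p': "p' \<noteq> 0" "degree p \<le> degree p'" "\<And>z. poly p' z = 0 \<Longrightarrow> real (length xs) * \<delta> / 2 \<le> Im z"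
    and eq: "\<And>z. shift_poly \<delta> (\<Prod>x\<leftarrow>xs. [:- x, 1:]) (\<lambda>z. exp (of_real b * z) * poly p z) z
        = exp (of_real b * z) * poly p' z"
    using shift_poly_exp_poly[OF p0 _ \<delta> xs1, where b = b] proots by force
  define E where "E = (\<lambda>z. \<Sum>k\<le>m. of_real (\<beta> k) * q (z - \<i> * of_real (real k * \<delta>)))"
  have E: "E w = lead_coeff P * (exp (of_real b * w) * poly p' w)" for w
  proof -
    have "E w = shift_poly \<delta> P q w" unfolding E_def shift_poly_def degP by (simp add: coeffP)
    also have "\<dots> = shift_poly \<delta> (smult (lead_coeff P) (\<Prod>x\<leftarrow>xs. [:-x, 1:])) q w" by (subst PA) simp
    also have "\<dots> = lead_coeff P * shift_poly \<delta> (\<Prod>x\<leftarrow>xs. [:-x, 1:]) q w" by (rule shift_poly_smult)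
    also have "q = (\<lambda>z. exp (of_real b * z) * poly p z)" using qp by auto
    finally show ?thesis by (simp add: eq)
  qed
  have cq: "cnj (q (cnj w)) = q w" for w
  proof -
    have "cnj (\<Prod>\<zeta>\<leftarrow>ys. 1 - cnj w / \<zeta>) = (\<Prod>\<zeta>\<leftarrow>ys. 1 - w / \<zeta>)" if "set ys \<subseteq> set zs" for ys
      using that zs by (induction ys) (auto simp: complex_eq_iff[of "cnj _"] intro!: arg_cong2[where f = "(*)"])
    then show ?thesis by (simp add: q_def exp_cnj)
  qed
  have cE: "cnj (E (cnj z)) = (\<Sum>k\<le>m. of_real (\<beta> k) * q (z + \<i> * of_real (real k * \<delta>)))"
  proof -
    have "cnj (q (cnj z - \<i> * of_real (real k * \<delta>))) = q (z + \<i> * of_real (real k * \<delta>))" for k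
      using cq[of "z + \<i> * of_real (real k * \<delta>)"] by simp
    then show ?thesis by (simp add: E_def)
  qed
  \<comment> \<open>The exponential has the same modulus at z and at its conjugate. The zeros of p'
    lie at height at least m \<delta>/2 > 0 and at least one exists, which makes the inequality
    strict.\<close>
  have "norm (E (cnj z)) < norm (E z)"
  proof -
    obtain ys where ys: "\<And>z. poly p' z = lead_coeff p' * (\<Prod>\<zeta>\<leftarrow>ys. z - \<zeta>)"
      "length ys = degree p'" "\<And>\<zeta>. \<zeta> \<in> set ys \<Longrightarrow> poly p' \<zeta> = 0"
      using complex_poly_root_list[OF p'(1)] by metis
    have "norm (\<Prod>\<zeta>\<leftarrow>ys. cnj z - \<zeta>) < norm (\<Prod>\<zeta>\<leftarrow>ys. z - \<zeta>)"
    proof (intro norm_prod_list_strict_mono norm_diff_less_vertical(2))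
      fix \<zeta> assume "\<zeta> \<in> set ys"
      then have "real m * \<delta> / 2 \<le> Im \<zeta>" using p'(3) ys(3) lenxs by auto
      moreover have "real m * \<delta> / 2 > 0" using m \<delta> by simp
      ultimately show "Im (cnj z) < 2 * Im \<zeta> - Im z" by simp
    next
      have "length ys > 0" using ys(2) p'(2) degp False by (cases zs) auto
      then show "ys \<noteq> []" by auto
    qed (use z in auto)
    then have "norm (poly p' (cnj z)) < norm (poly p' z)"
      using p'(1) by (simp add: ys(1) norm_mult)
    then show ?thesis using P0 by (simp add: E norm_mult)
  qed
  then have "E z + cnj (E (cnj z)) \<noteq> 0"
    by (metis complex_mod_cnj less_irrefl neg_eq_iff_add_eq_0 norm_minus_cancel add.commute)
  then show ?thesis unfolding cE unfolding E_def by (simp add: sum.distrib distrib_left)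
qed

text \<open>Hurwitz' theorem on the lower half-plane, with approximants of accuracy 1 / (n+1) on the
  disc of radius n+1. By f' 0 = 0, b is the sum of the reciprocals of real zeros, hence real, and it
  is 0 when the list is empty. Non-constancy of H is demanded by Hurwitz' theorem.\<close>

lemma symmetric_shift_sum_real_zeros:
  fixes f :: "complex \<Rightarrow> complex" and \<beta> :: "nat \<Rightarrow> real" and \<delta> :: real
  assumes hol: "f holomorphic_on UNIV" and f0: "f 0 \<noteq> 0" "f 0 \<in> \<real>" and df0: "deriv f 0 = 0"
    and growth: "\<And>e. e > 0 \<Longrightarrow> \<exists>C. \<forall>z. norm (f z) \<le> C * exp (e * (norm z)\<^sup>2)"
    and fz: "\<And>z. f z = 0 \<Longrightarrow> Im z = 0"
    and \<delta>: "\<delta> > 0" and m: "m \<ge> 1" "\<beta> m \<noteq> 0"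
    and roots: "\<And>x::complex. norm x \<ge> 1 \<Longrightarrow> (\<Sum>k\<le>m. of_real (\<beta> k) * x ^ k) \<noteq> 0"
  defines "H \<equiv> \<lambda>z. (\<Sum>k\<le>m. of_real (\<beta> k) *
      (f (z - \<i> * of_real (real k * \<delta>)) + f (z + \<i> * of_real (real k * \<delta>))))"
  assumes nonconst: "\<not> H constant_on {z. Im z < 0}"
    and z: "Im z < 0"
  shows "H z \<noteq> 0"
proof -
  obtain c where c: "f 0 = of_real c" using f0(2) by (auto elim: Reals_cases)
  define Q where "Q = (\<lambda>(n::nat) zs b. (\<forall>\<zeta>\<in>set zs. f \<zeta> = 0) \<and> b = deriv f 0 / f 0 + (\<Sum>\<zeta>\<leftarrow>zs. 1 / \<zeta>) \<and>
    (\<forall>z. norm z \<le> real (Suc n) \<longrightarrow>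
       norm (f z - f 0 * exp (b * z) * (\<Prod>\<zeta>\<leftarrow>zs. 1 - z / \<zeta>)) \<le> 1 / real (Suc n)))"
  have "\<exists>zs b. Q n zs b" for n
    by (rule entire_approx_by_zeros[OF hol f0(1) growth, of "real (Suc n)" "1 / real (Suc n)"])
       (auto simp: Q_def)
  then obtain zs b where Q: "\<And>n. Q n (zs n) (b n)" by metis
  have zs: "\<And>n \<zeta>. \<zeta> \<in> set (zs n) \<Longrightarrow> f \<zeta> = 0"
    and b: "\<And>n. b n = (\<Sum>\<zeta>\<leftarrow>zs n. 1 / \<zeta>)"
    and ap: "\<And>n z. norm z \<le> real (Suc n) \<Longrightarrow>
       norm (f z - f 0 * exp (b n * z) * (\<Prod>\<zeta>\<leftarrow>zs n. 1 - z / \<zeta>)) \<le> 1 / real (Suc n)"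
    using Q unfolding Q_def df0 by (simp, simp, blast)
  have breal: "b n = of_real (Re (b n))" for n
  proof -
    have "Im (\<Sum>\<zeta>\<leftarrow>ys. 1 / \<zeta>) = 0" if "\<And>\<zeta>. \<zeta> \<in> set ys \<Longrightarrow> Im \<zeta> = 0" for ys :: "complex list"
      using that by (induction ys) (auto simp: Im_divide)
    then have "Im (b n) = 0" unfolding b using zs fz by auto
    then show ?thesis by (simp add: complex_eq_iff)
  qed
  define q where "q = (\<lambda>n z. of_real c * exp (of_real (Re (b n)) * z) * (\<Prod>\<zeta>\<leftarrow>zs n. 1 - z / \<zeta>))"
  have qap: "norm (q n z - f z) \<le> 1 / real (Suc n)" if "norm z \<le> real (Suc n)" for n z
    using ap[OF that] unfolding q_def c breal[symmetric] by (simp add: norm_minus_commute)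
  define Hn where "Hn = (\<lambda>n z. (\<Sum>k\<le>m. of_real (\<beta> k) *
      (q n (z - \<i> * of_real (real k * \<delta>)) + q n (z + \<i> * of_real (real k * \<delta>)))))"
  have qhol: "q n holomorphic_on UNIV" for n
  proof -
    have "(\<lambda>z. \<Prod>\<zeta>\<leftarrow>ys. 1 - z / \<zeta>) holomorphic_on UNIV" if "0 \<notin> set ys" for ys :: "complex list"
      using that by (induction ys) (auto intro!: holomorphic_intros)
    moreover have "0 \<notin> set (zs n)" using zs f0 by auto
    ultimately show ?thesis unfolding q_def by (intro holomorphic_intros) auto
  qed
  have comp: "(\<lambda>z. g (z + w)) holomorphic_on S" if "g holomorphic_on UNIV" for g :: "complex \<Rightarrow> complex" and w S
  proof -
    have "(\<lambda>z. z + w) holomorphic_on S" by (intro holomorphic_intros)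
    from holomorphic_on_compose_gen[OF this that] show ?thesis by (simp add: o_def)
  qed
  have comp': "(\<lambda>z. g (z - w)) holomorphic_on S" if "g holomorphic_on UNIV" for g :: "complex \<Rightarrow> complex" and w S
    using comp[OF that, of "- w" S] by simp
  show ?thesis
  proof (rule Hurwitz_no_zeros[of "{z. Im z < 0}" Hn H])
    show "open {z. Im z < 0}" by (rule open_halfspace_Im_lt)
    show "connected {z. Im z < 0}" by (intro convex_connected convex_halfspace_Im_lt)
    show "Hn n holomorphic_on {z. Im z < 0}" for n
      unfolding Hn_def by (intro holomorphic_intros comp comp' qhol)
    show "H holomorphic_on {z. Im z < 0}"
      unfolding H_def by (intro holomorphic_intros comp comp' hol)
    show "Hn n w \<noteq> 0" if "w \<in> {z. Im z < 0}" for n w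
    proof -
      have 1: "\<zeta> \<noteq> 0 \<and> Im \<zeta> = 0" if "\<zeta> \<in> set (zs n)" for \<zeta> using zs[OF that] fz f0 by auto
      have 2: "Re (b n) = 0" if "zs n = []" using that b by simp
      have 3: "c \<noteq> 0" using f0 c by auto
      have "Im w < 0" using that by simp
      show ?thesis
        unfolding Hn_def q_def
        by (rule symmetric_shift_sum_nonzero) (use 1 2 3 \<delta> m roots \<open>Im w < 0\<close> in auto)
    qed
    show "uniform_limit K Hn H sequentially" if K: "compact K" "K \<subseteq> {z. Im z < 0}" for K
    proof (rule uniform_limitI)
      fix e :: real assume e: "e > 0"
      obtain r where r: "\<And>w. w \<in> K \<Longrightarrow> norm w \<le> r"
        using compact_imp_bounded[OF K(1)] unfolding bounded_iff by blast
      define B where "B = (\<Sum>k\<le>m. 2 * \<bar>\<beta> k\<bar>)"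
      have B: "B \<ge> 0" unfolding B_def by (intro sum_nonneg) auto
      \<comment> \<open>All shifts of points of K lie in the disc of radius r + m \<delta>, so the
        approximation must be valid there.\<close>
      have "eventually (\<lambda>n. real n \<ge> r + real m * \<delta>) sequentially"
        by (rule eventually_ge_at_top[THEN eventually_compose_filterlim[OF _ filterlim_real_sequentially]])
      moreover have "eventually (\<lambda>n. real n \<ge> (B + 1) / e) sequentially"
        by (rule eventually_ge_at_top[THEN eventually_compose_filterlim[OF _ filterlim_real_sequentially]])
      ultimately show "\<forall>\<^sub>F n in sequentially. \<forall>x\<in>K. dist (Hn n x) (H x) < e"
      proof eventually_elim
        case (elim n)
        show ?case
        proof
          fix x assume x: "x \<in> K"
          have small: "norm (q n w - f w) \<le> 1 / real (Suc n)" if "norm w \<le> r + real m * \<delta>" for w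
            using that elim by (intro qap) auto
          have kb: "norm (x - \<i> * of_real (real k * \<delta>)) \<le> r + real m * \<delta>"
            "norm (x + \<i> * of_real (real k * \<delta>)) \<le> r + real m * \<delta>" if "k \<le> m" for k
          proof -
            have kd: "norm (\<i> * of_real (real k * \<delta>) :: complex) \<le> real m * \<delta>"
              using that \<delta> by (simp add: norm_mult mult_right_mono)
            show "norm (x - \<i> * of_real (real k * \<delta>)) \<le> r + real m * \<delta>"
              by (rule order.trans[OF norm_triangle_ineq4 add_mono[OF r[OF x] kd]])
            show "norm (x + \<i> * of_real (real k * \<delta>)) \<le> r + real m * \<delta>"
              by (rule order.trans[OF norm_triangle_ineq add_mono[OF r[OF x] kd]])
          qed
          have "norm (Hn n x - H x) \<le> (\<Sum>k\<le>m. \<bar>\<beta> k\<bar> * (2 / real (Suc n)))"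
            unfolding Hn_def H_def sum_subtractf[symmetric] right_diff_distrib[symmetric]
          proof (rule sum_norm_le)
            fix k assume "k \<in> {..m}"
            then have k: "k \<le> m" by simp
            let ?u = "x - \<i> * of_real (real k * \<delta>)" and ?v = "x + \<i> * of_real (real k * \<delta>)"
            have "norm ((q n ?u + q n ?v) - (f ?u + f ?v)) \<le> norm (q n ?u - f ?u) + norm (q n ?v - f ?v)"
              by (metis add_diff_add norm_triangle_ineq)
            also have "\<dots> \<le> 1 / real (Suc n) + 1 / real (Suc n)" by (intro add_mono small kb k)
            finally have "norm ((q n ?u + q n ?v) - (f ?u + f ?v)) \<le> 2 / real (Suc n)" by simp
            then have "\<bar>\<beta> k\<bar> * norm ((q n ?u + q n ?v) - (f ?u + f ?v)) \<le> \<bar>\<beta> k\<bar> * (2 / real (Suc n))"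
              by (intro mult_left_mono) auto
            then show "norm (of_real (\<beta> k) * ((q n ?u + q n ?v) - (f ?u + f ?v))) \<le> \<bar>\<beta> k\<bar> * (2 / real (Suc n))"
              by (simp only: norm_mult norm_of_real)
          qed
          also have "\<dots> = B / real (Suc n)"
            by (simp add: B_def sum_divide_distrib mult.commute)
          also have "\<dots> < e"
          proof -
            have "B + 1 \<le> real n * e" using elim(2) e by (simp add: field_simps)
            also have "\<dots> \<le> real (Suc n) * e" using e by simp
            finally show ?thesis using B by (simp add: field_simps)
          qed
          finally show "dist (Hn n x) (H x) < e" by (simp add: dist_norm)
        qed
      qed
    qed
  qed (use nonconst z in auto)
qed

section \<open>Moments of the kernel \<open>exp (- s cosh t)\<close>\<close>

text \<open>Dominated convergence for difference quotients; the mean value inequality on the ball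
  bounds them by g.\<close>

lemma has_field_derivative_lebesgue_integral:
  fixes F F' :: "complex \<Rightarrow> 'a \<Rightarrow> complex"
  assumes r: "r > 0"
    and int: "\<And>z. z \<in> ball z0 r \<Longrightarrow> integrable M (F z)"
    and der: "\<And>z t. z \<in> ball z0 r \<Longrightarrow> ((\<lambda>z. F z t) has_field_derivative F' z t) (at z)"
    and bd: "\<And>z t. z \<in> ball z0 r \<Longrightarrow> norm (F' z t) \<le> g t"
    and g: "integrable M g" and meas: "F' z0 \<in> borel_measurable M"
  shows "((\<lambda>z. integral\<^sup>L M (F z)) has_field_derivative integral\<^sup>L M (F' z0)) (at z0)"
proof -
  have z0: "z0 \<in> ball z0 r" using r by simp
  have "((\<lambda>z. integral\<^sup>L M (F z)) has_field_derivative integral\<^sup>L M (F' z0)) (at z0 within ball z0 r)"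
    unfolding has_field_derivative_iff tendsto_at_iff_sequentially
  proof (intro allI impI)
    fix X :: "nat \<Rightarrow> complex"
    assume X: "\<forall>i. X i \<in> ball z0 r - {z0}" and lim: "X \<longlonglongrightarrow> z0"
    then have Xb: "X i \<in> ball z0 r" and Xn: "X i \<noteq> z0" for i by auto
    define s where "s = (\<lambda>i t. (F (X i) t - F z0 t) / (X i - z0))"
    have "(\<lambda>i. integral\<^sup>L M (s i)) \<longlonglongrightarrow> integral\<^sup>L M (F' z0)"
    proof (rule integral_dominated_convergence[where w = g])
      show "s i \<in> borel_measurable M" for i
        unfolding s_def using int[OF Xb[of i]] int[OF z0] by measurable
      show "AE t in M. (\<lambda>i. s i t) \<longlonglongrightarrow> F' z0 t"
      proof (rule AE_I2)
        fix t
        have "((\<lambda>z. F z t) has_field_derivative F' z0 t) (at z0 within ball z0 r)"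
          using der[OF z0] by (rule has_field_derivative_at_within)
        then show "(\<lambda>i. s i t) \<longlonglongrightarrow> F' z0 t"
          unfolding has_field_derivative_iff tendsto_at_iff_sequentially using X lim
          by (auto simp: s_def o_def)
      qed
      show "AE t in M. norm (s i t) \<le> g t" for i
      proof (rule AE_I2)
        fix t
        have "norm (F (X i) t - F z0 t) \<le> g t * norm (X i - z0)"
          by (rule field_differentiable_bound[of "ball z0 r" "\<lambda>z. F z t" "\<lambda>z. F' z t"])
             (use Xb z0 bd der in \<open>auto intro: has_field_derivative_at_within\<close>)
        then show "norm (s i t) \<le> g t" using Xn[of i] by (simp add: s_def norm_divide field_simps)
      qed
    qed (use g meas in auto)
    moreover have "integral\<^sup>L M (s i) = (integral\<^sup>L M (F (X i)) - integral\<^sup>L M (F z0)) / (X i - z0)" for i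
      unfolding s_def using int[OF Xb[of i]] int[OF z0] by simp
    ultimately show "((\<lambda>y. (integral\<^sup>L M (F y) - integral\<^sup>L M (F z0)) / (y - z0)) \<circ> X) \<longlonglongrightarrow> integral\<^sup>L M (F' z0)"
      by (simp add: o_def)
  qed
  then show ?thesis using at_within_open[OF z0 open_ball] by simp
qed

text \<open>The term of order four lets cosh t absorb every multiple of t^2, which is the source of
  the growth below order two.\<close>

lemma cosh_ge_quartic: "1 + x\<^sup>2 / 2 + x ^ 4 / 24 \<le> cosh (x :: real)"
proof -
  have "(\<Sum>n<5. if even n then x ^ n /\<^sub>R fact n else 0) \<le> (\<Sum>n. if even n then x ^ n /\<^sub>R fact n else 0)"
    using cosh_converges[of x] by (intro sum_le_suminf) (auto simp: sums_iff)
  moreover have "(\<Sum>n<5. if even n then x ^ n /\<^sub>R fact n else 0) = 1 + x\<^sup>2 / 2 + x ^ 4 / 24"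
    by (simp add: lessThan_nat_numeral fact_numeral divide_simps)
  ultimately show ?thesis using cosh_converges[of x] by (simp add: sums_iff)
qed

lemma cosh_le_exp_abs: "cosh x \<le> exp \<bar>x :: real\<bar>"
proof -
  define e where "e = exp \<bar>x\<bar>"
  have "exp x \<le> e" "exp (- x) \<le> e" by (auto simp: e_def)
  then show ?thesis unfolding cosh_field_def e_def[symmetric] by (simp add: field_simps)
qed

text \<open>The constant 6 (\<kappa> + 1)^2 / s is the value at the vertex of the parabola (\<kappa>
  + 1) x - s x^2 / 24, taken at x = t^2.\<close>

lemma exp_square_cosh_bound:
  fixes s \<kappa> :: real
  assumes "s > 0"
  shows "exp (\<kappa> * t\<^sup>2 - s * cosh t) \<le> exp (6 * (\<kappa> + 1)\<^sup>2 / s) * exp (- t\<^sup>2 / 2)"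
proof -
  have "0 \<le> (s / 24) * (t\<^sup>2 - 12 * (\<kappa> + 1) / s)\<^sup>2" using assms by simp
  also have "\<dots> = s * (t ^ 4 / 24) - (\<kappa> + 1) * t\<^sup>2 + 6 * (\<kappa> + 1)\<^sup>2 / s"
    using assms by (simp add: power2_eq_square field_simps eval_nat_numeral)
  finally have 1: "\<kappa> * t\<^sup>2 + t\<^sup>2 - s * (t ^ 4 / 24) \<le> 6 * (\<kappa> + 1)\<^sup>2 / s"
    by (simp add: distrib_right)
  have "t ^ 4 / 24 \<le> cosh t" using cosh_ge_quartic[of t] zero_le_power2[of t] by linarith
  then have "s * (t ^ 4 / 24) \<le> s * cosh t" using assms by (intro mult_left_mono) auto
  then have "\<kappa> * t\<^sup>2 - s * cosh t \<le> 6 * (\<kappa> + 1)\<^sup>2 / s + (- t\<^sup>2 / 2)"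
    using 1 zero_le_power2[of t] by linarith
  then show ?thesis by (simp flip: exp_add)
qed

lemma integrable_gaussian: "integrable lborel (\<lambda>t::real. exp (- t\<^sup>2 / 2))"
proof -
  have "integrable lborel (\<lambda>t. sqrt (2 * pi) * std_normal_density t)"
    by (intro integrable_mult_right) auto
  then show ?thesis by (simp add: std_normal_density_def)
qed

lemma integrable_exp_square_cosh:
  assumes "s > 0"
  shows "integrable lborel (\<lambda>t::real. exp (\<kappa> * t\<^sup>2 - s * cosh t))"
  by (rule Bochner_Integration.integrable_bound[OF integrable_mult_right[OF integrable_gaussian, of "exp (6 * (\<kappa> + 1)\<^sup>2 / s)"]])
     (use exp_square_cosh_bound[OF assms] in \<open>auto intro!: borel_measurable_continuous_onI continuous_intros\<close>)

lemma exp_abs_cosh_bound: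
  fixes s k :: real
  assumes "s > 0"
  shows "exp (k * \<bar>t\<bar> - s * cosh t) \<le> exp (k\<^sup>2 + 24 / s) * exp (- t\<^sup>2 / 2)"
proof -
  have "0 \<le> (\<bar>t\<bar> - k / 2)\<^sup>2 + 3 * k\<^sup>2 / 4" by simp
  also have "\<dots> = t\<^sup>2 - k * \<bar>t\<bar> + k\<^sup>2" by (simp add: power2_diff power_divide)
  finally have "exp (k * \<bar>t\<bar> - s * cosh t) \<le> exp (k\<^sup>2) * exp (1 * t\<^sup>2 - s * cosh t)"
    by (simp flip: exp_add)
  also have "\<dots> \<le> exp (k\<^sup>2) * (exp (6 * (1 + 1)\<^sup>2 / s) * exp (- t\<^sup>2 / 2))"
    by (intro mult_left_mono exp_square_cosh_bound assms) auto
  finally show ?thesis by (simp add: exp_add)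
qed

lemma integrable_exp_abs_cosh:
  assumes "s > 0"
  shows "integrable lborel (\<lambda>t::real. exp (k * \<bar>t\<bar> - s * cosh t))"
  by (rule Bochner_Integration.integrable_bound[OF integrable_mult_right[OF integrable_gaussian, of "exp (k\<^sup>2 + 24 / s)"]])
     (use exp_abs_cosh_bound[OF assms] in \<open>auto intro!: borel_measurable_continuous_onI continuous_intros\<close>)

lemma sinh_cosh_of_real:
  "sinh (complex_of_real x) = of_real (sinh x)" "cosh (complex_of_real x) = of_real (cosh x)"
  by (simp_all add: sinh_field_def cosh_field_def exp_of_real flip: of_real_minus)

text \<open>For real s > 0 the integral with j = 0 is twice the Bessel function of s with index \<i>
  z, and j counts derivatives in s up to sign. The parameter s is complex so that these are complex
  derivatives.\<close>

definition cosh_kernel :: "nat \<Rightarrow> complex \<Rightarrow> complex \<Rightarrow> real \<Rightarrow> complex" where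
  "cosh_kernel j z s t = of_real (cosh t ^ j) * exp (- s * of_real (cosh t)) * exp (\<i> * z * of_real t)"

definition cosh_moment :: "nat \<Rightarrow> complex \<Rightarrow> complex \<Rightarrow> complex" where
  "cosh_moment j z s = (LINT t|lborel. cosh_kernel j z s t)"

lemma borel_measurable_cosh_kernel [measurable]: "cosh_kernel j z s \<in> borel_measurable borel"
proof -
  have "continuous_on UNIV (cosh_kernel j z s)"
    unfolding cosh_kernel_def by (intro continuous_intros)
  then show ?thesis by (rule borel_measurable_continuous_onI)
qed

lemma norm_cosh_kernel_le:
  assumes "\<bar>Im z\<bar> \<le> k" "c \<le> Re s"
  shows "norm (cosh_kernel j z s t) \<le> exp ((real j + k) * \<bar>t\<bar> - c * cosh t)"
proof -
  have c1: "cosh t \<ge> 1" by (rule cosh_real_ge_1)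
  have "norm (cosh_kernel j z s t) = cosh t ^ j * exp (- Re s * cosh t) * exp (- Im z * t)"
    using c1 by (simp add: cosh_kernel_def norm_mult norm_power)
  also have "\<dots> \<le> exp \<bar>t\<bar> ^ j * exp (- c * cosh t) * exp (k * \<bar>t\<bar>)"
  proof (intro mult_mono power_mono cosh_le_exp_abs)
    show "exp (- Re s * cosh t) \<le> exp (- c * cosh t)" using assms c1 by (simp add: mult_right_mono)
    have "- Im z * t \<le> \<bar>Im z\<bar> * \<bar>t\<bar>" by (metis abs_ge_self abs_minus_cancel abs_mult)
    also have "\<dots> \<le> k * \<bar>t\<bar>" using assms by (intro mult_right_mono) auto
    finally show "exp (- Im z * t) \<le> exp (k * \<bar>t\<bar>)" by simp
  qed (use c1 in auto)
  also have "\<dots> = exp ((real j + k) * \<bar>t\<bar> - c * cosh t)"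
    by (simp add: exp_of_nat_mult[symmetric] exp_add[symmetric] algebra_simps)
  finally show ?thesis .
qed

lemma integrable_cosh_kernel:
  assumes "Re s > 0"
  shows "integrable lborel (cosh_kernel j z s)"
  by (rule Bochner_Integration.integrable_bound[OF integrable_exp_abs_cosh[OF assms, of "real j + \<bar>Im z\<bar>"]])
     (use norm_cosh_kernel_le[of z "\<bar>Im z\<bar>" "Re s" s j] in auto)

lemma cosh_moment_has_derivative_scale:
  assumes s: "Re s > 0"
  shows "(cosh_moment j z has_field_derivative - cosh_moment (Suc j) z s) (at s)"
proof -
  define c where "c = Re s / 2"
  have c: "c > 0" using s by (simp add: c_def)
  have Re: "c \<le> Re w" if "w \<in> ball s c" for w
  proof -
    have "\<bar>Re (s - w)\<bar> < c" using abs_Re_le_cmod[of "s - w"] that by (simp add: dist_norm)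
    then have "\<bar>Re s - Re w\<bar> < c" by simp
    moreover have "Re s = 2 * c" by (simp add: c_def)
    ultimately show ?thesis by linarith
  qed
  have "((\<lambda>w. LINT t|lborel. cosh_kernel j z w t) has_field_derivative
      (LINT t|lborel. - cosh_kernel (Suc j) z s t)) (at s)"
  proof (rule has_field_derivative_lebesgue_integral[OF c])
    fix w assume w: "w \<in> ball s c"
    show "integrable lborel (cosh_kernel j z w)" using Re[OF w] c by (intro integrable_cosh_kernel) auto
    fix t
    show "((\<lambda>w. cosh_kernel j z w t) has_field_derivative - cosh_kernel (Suc j) z w t) (at w)"
      unfolding cosh_kernel_def by (auto intro!: derivative_eq_intros)
    show "norm (- cosh_kernel (Suc j) z w t) \<le> exp ((real (Suc j) + \<bar>Im z\<bar>) * \<bar>t\<bar> - c * cosh t)"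
      unfolding norm_minus_cancel by (intro norm_cosh_kernel_le Re w) auto
  qed (use integrable_exp_abs_cosh[OF c] in auto)
  then show ?thesis unfolding cosh_moment_def[abs_def] by simp
qed

lemma cosh_moment_entire:
  assumes s: "Re s > 0"
  shows "(\<lambda>z. cosh_moment j z s) holomorphic_on UNIV"
proof -
  have "((\<lambda>w. LINT t|lborel. cosh_kernel j w s t) has_field_derivative
      (LINT t|lborel. \<i> * of_real t * cosh_kernel j z s t)) (at z)" for z
  proof (rule has_field_derivative_lebesgue_integral[OF zero_less_one])
    fix w assume w: "w \<in> ball z 1"
    show "integrable lborel (cosh_kernel j w s)" by (intro integrable_cosh_kernel s)
    fix t
    show "((\<lambda>w. cosh_kernel j w s t) has_field_derivative \<i> * of_real t * cosh_kernel j w s t) (at w)"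
      unfolding cosh_kernel_def by (auto intro!: derivative_eq_intros)
    have "\<bar>Im (z - w)\<bar> < 1" using abs_Im_le_cmod[of "z - w"] w by (simp add: dist_norm)
    then have "\<bar>Im w\<bar> \<le> \<bar>Im z\<bar> + 1" by simp
    then have "norm (cosh_kernel j w s t) \<le> exp ((real j + (\<bar>Im z\<bar> + 1)) * \<bar>t\<bar> - Re s * cosh t)"
      by (intro norm_cosh_kernel_le) auto
    moreover have "\<bar>t\<bar> \<le> exp \<bar>t\<bar>" using exp_ge_add_one_self[of "\<bar>t\<bar>"] by linarith
    ultimately have "\<bar>t\<bar> * norm (cosh_kernel j w s t)
        \<le> exp \<bar>t\<bar> * exp ((real j + (\<bar>Im z\<bar> + 1)) * \<bar>t\<bar> - Re s * cosh t)"
      by (intro mult_mono) auto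
    then show "norm (\<i> * of_real t * cosh_kernel j w s t) \<le> exp ((real j + \<bar>Im z\<bar> + 2) * \<bar>t\<bar> - Re s * cosh t)"
      by (simp add: norm_mult exp_add[symmetric] algebra_simps)
  qed (use integrable_exp_abs_cosh[OF s] in auto)
  then show ?thesis
    unfolding cosh_moment_def by (auto simp: holomorphic_on_open)
qed

section \<open>Bessel's equation, asymptotics and zeros\<close>

text \<open>The corresponding combination of kernels is the t-derivative of (- s sinh t - \<i> z)
  times the kernel, which vanishes at both infinities. As the moments are derivatives in s up to
  sign, this is the modified Bessel equation with index \<i> z.\<close>

lemma cosh_moment_bessel_equation:
  fixes s :: real
  assumes s: "s > 0"
  shows "of_real s ^ 2 * cosh_moment 2 z (of_real s) - of_real s * cosh_moment 1 z (of_real s)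
       = (of_real s ^ 2 - z ^ 2) * cosh_moment 0 z (of_real s)"
proof -
  define \<Psi> where "\<Psi> = (\<lambda>t::real. (- of_real (s * sinh t) - \<i> * z) * cosh_kernel 0 z (of_real s) t)"
  define \<psi> where "\<psi> = (\<lambda>t::real. of_real s ^ 2 * cosh_kernel 2 z (of_real s) t - of_real s * cosh_kernel 1 z (of_real s) t
       - (of_real s ^ 2 - z ^ 2) * cosh_kernel 0 z (of_real s) t)"
  have int: "integrable lborel \<psi>"
    unfolding \<psi>_def using s by (intro Bochner_Integration.integrable_diff integrable_mult_right integrable_cosh_kernel) auto
  have der: "(\<Psi> has_vector_derivative \<psi> t) (at t)" for t
  proof -
    define \<Psi>c where "\<Psi>c = (\<lambda>x::complex. (- (of_real s * sinh x) - \<i> * z) *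
      (exp (- of_real s * cosh x) * exp (\<i> * z * x)))"
    have "(\<Psi>c has_field_derivative \<psi> t) (at (of_real t))"
    proof -
      have sq: "sinh (of_real t :: complex) ^ 2 = cosh (of_real t) ^ 2 - 1"
        using cosh_square_eq[of "of_real t :: complex"] by simp
      have "(\<Psi>c has_field_derivative
        (- (of_real s * cosh (of_real t))) * (exp (- of_real s * cosh (of_real t)) * exp (\<i> * z * of_real t)) +
        (- (of_real s * sinh (of_real t)) - \<i> * z) * (exp (- of_real s * cosh (of_real t)) * exp (\<i> * z * of_real t)
          * (- of_real s * sinh (of_real t) + \<i> * z))) (at (of_real t))"
        unfolding \<Psi>c_def by (auto intro!: derivative_eq_intros simp: algebra_simps)
      also have "(- (of_real s * cosh (of_real t))) * (exp (- of_real s * cosh (of_real t)) * exp (\<i> * z * of_real t)) +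
        (- (of_real s * sinh (of_real t)) - \<i> * z) * (exp (- of_real s * cosh (of_real t)) * exp (\<i> * z * of_real t)
          * (- of_real s * sinh (of_real t) + \<i> * z)) =
        (of_real s ^ 2 * sinh (of_real t) ^ 2 - of_real s * cosh (of_real t) + z ^ 2) *
          (exp (- of_real s * cosh (of_real t)) * exp (\<i> * z * of_real t))"
        by (simp add: algebra_simps power2_eq_square)
      also have "\<dots> = \<psi> t"
        unfolding sq \<psi>_def cosh_kernel_def by (simp add: algebra_simps sinh_cosh_of_real)
      finally show ?thesis .
    qed
    then have "((\<lambda>x. \<Psi>c (of_real x)) has_vector_derivative \<psi> t) (at t)"
      by (rule has_vector_derivative_real_field)
    moreover have "\<Psi> = (\<lambda>x. \<Psi>c (of_real x))"
      by (auto simp: \<Psi>_def \<Psi>c_def cosh_kernel_def sinh_cosh_of_real)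
    ultimately show ?thesis by simp
  qed
  have cont: "isCont \<psi> t" for t
  proof -
    have "continuous_on UNIV \<psi>" unfolding \<psi>_def cosh_kernel_def by (intro continuous_intros)
    then show ?thesis by (simp add: continuous_on_eq_continuous_at)
  qed
  define C where "C = (s + norm z) * exp ((1 + \<bar>Im z\<bar>)\<^sup>2 + 24 / s)"
  have bd: "norm (\<Psi> t) \<le> C * exp (- t\<^sup>2 / 2)" for t
  proof -
    have "\<bar>sinh t\<bar> \<le> cosh t" by (simp add: abs_le_iff sinh_le_cosh_real) (metis cosh_minus sinh_le_cosh_real sinh_minus)
    then have sh: "\<bar>sinh t\<bar> \<le> exp \<bar>t\<bar>" using cosh_le_exp_abs[of t] by linarith
    have "norm (- of_real (s * sinh t) - \<i> * z) \<le> norm (of_real (s * sinh t) :: complex) + norm (\<i> * z)"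
      by (metis norm_minus_cancel norm_triangle_ineq4)
    also have "\<dots> = s * \<bar>sinh t\<bar> + norm z" using s by (simp add: norm_mult abs_mult)
    also have "\<dots> \<le> s * exp \<bar>t\<bar> + norm z * exp \<bar>t\<bar>"
      using sh s by (intro add_mono mult_left_mono) (auto simp: mult_le_cancel_left1)
    finally have "norm (- of_real (s * sinh t) - \<i> * z) \<le> (s + norm z) * exp \<bar>t\<bar>" by (simp add: algebra_simps)
    then have "norm (\<Psi> t) \<le> ((s + norm z) * exp \<bar>t\<bar>) * exp ((real 0 + \<bar>Im z\<bar>) * \<bar>t\<bar> - s * cosh t)"
      unfolding \<Psi>_def norm_mult using s by (intro mult_mono norm_cosh_kernel_le) auto
    also have "\<dots> = (s + norm z) * exp ((1 + \<bar>Im z\<bar>) * \<bar>t\<bar> - s * cosh t)"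
      by (simp add: exp_add[symmetric] algebra_simps)
    also have "\<dots> \<le> C * exp (- t\<^sup>2 / 2)"
      unfolding C_def mult.assoc using s by (intro mult_left_mono exp_abs_cosh_bound) auto
    finally show ?thesis .
  qed
  have top: "(\<Psi> \<longlongrightarrow> 0) at_top"
  proof (rule Lim_null_comparison[OF always_eventually])
    show "\<forall>t. norm (\<Psi> t) \<le> C * exp (- t\<^sup>2 / 2)" using bd by blast
    have "((\<lambda>t::real. exp (- t\<^sup>2 / 2)) \<longlongrightarrow> 0) at_top" by real_asymp
    then show "((\<lambda>t. C * exp (- t\<^sup>2 / 2)) \<longlongrightarrow> 0) at_top" by (rule tendsto_mult_right_zero)
  qed
  have bot: "(\<Psi> \<longlongrightarrow> 0) at_bot"
  proof (rule Lim_null_comparison[OF always_eventually])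
    show "\<forall>t. norm (\<Psi> t) \<le> C * exp (- t\<^sup>2 / 2)" using bd by blast
    have "((\<lambda>t::real. exp (- t\<^sup>2 / 2)) \<longlongrightarrow> 0) at_bot" by real_asymp
    then show "((\<lambda>t. C * exp (- t\<^sup>2 / 2)) \<longlongrightarrow> 0) at_bot" by (rule tendsto_mult_right_zero)
  qed
  have "(LBINT t=-\<infinity>..\<infinity>. \<psi> t) = 0 - 0"
  proof (rule interval_integral_FTC_integrable[where F = \<Psi>])
    show "set_integrable lborel (einterval (- \<infinity>) \<infinity>) \<psi>" using int by (simp add: set_integrable_def)
  qed (use der cont top bot in \<open>auto simp: ereal_tendsto_simps\<close>)
  then have "integral\<^sup>L lborel \<psi> = 0"
    by (simp add: interval_lebesgue_integral_def set_lebesgue_integral_def)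
  moreover have "integral\<^sup>L lborel \<psi> = of_real s ^ 2 * cosh_moment 2 z (of_real s) - of_real s * cosh_moment 1 z (of_real s)
       - (of_real s ^ 2 - z ^ 2) * cosh_moment 0 z (of_real s)"
    unfolding \<psi>_def cosh_moment_def using s
    by (simp add: integrable_cosh_kernel Bochner_Integration.integral_diff)
  ultimately show ?thesis by simp
qed

text \<open>The value at 0 may vanish, as it does for the integrand in
  \<open>Xi_S2_values_differ\<close>.\<close>

lemma integral_lborel_pos:
  fixes f :: "real \<Rightarrow> real"
  assumes "integrable lborel f" and "\<And>t. t \<noteq> 0 \<Longrightarrow> f t > 0" and "f 0 \<ge> 0"
  shows "integral\<^sup>L lborel f > 0"
proof -
  have nonneg: "f t \<ge> 0" for t using assms(2)[of t] assms(3) by (cases "t = 0") auto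
  have "integral\<^sup>L lborel f \<noteq> 0"
  proof
    assume "integral\<^sup>L lborel f = 0"
    then have "AE t in lborel. f t = 0"
      using assms(1) nonneg by (subst (asm) integral_nonneg_eq_0_iff_AE) auto
    then have "AE t::real in lborel. t \<in> {0}"
      by eventually_elim (use assms(2) in force)
    moreover have "AE t::real in lborel. t \<noteq> 0" by (rule AE_lborel_singleton)
    ultimately have "AE t::real in lborel. False" by eventually_elim auto
    then show False by (simp add: eventually_False ae_filter_eq_bot_iff)
  qed
  moreover have "integral\<^sup>L lborel f \<ge> 0" using nonneg by simp
  ultimately show ?thesis by simp
qed

lemma cosh_moment_of_imaginary:
  "cosh_moment 0 (\<i> * of_real y) (of_real s) = of_real (LINT t|lborel. exp (- s * cosh t - y * t))"
proof -
  have "cosh_kernel 0 (\<i> * of_real y) (of_real s) t = of_real (exp (- s * cosh t - y * t))" for t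
    unfolding cosh_kernel_def by (simp add: exp_of_real[symmetric] exp_diff exp_minus field_simps)
  then show ?thesis by (simp add: cosh_moment_def)
qed

lemma cosh_moment_imaginary_nonzero:
  assumes "s > 0"
  shows "cosh_moment 0 (\<i> * of_real y) (of_real s) \<noteq> 0"
proof -
  have "integrable lborel (\<lambda>t. exp (- s * cosh t - y * t))"
  proof (rule Bochner_Integration.integrable_bound[OF integrable_exp_abs_cosh[OF assms, of "\<bar>y\<bar>"]])
    show "(\<lambda>t. exp (- s * cosh t - y * t)) \<in> borel_measurable lborel"
      by (auto intro!: borel_measurable_continuous_onI continuous_intros)
    have "- y * t \<le> \<bar>y\<bar> * \<bar>t\<bar>" for t by (metis abs_ge_self abs_minus_cancel abs_mult)
    then show "AE t in lborel. norm (exp (- s * cosh t - y * t)) \<le> norm (exp (\<bar>y\<bar> * \<bar>t\<bar> - s * cosh t))"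
      by auto
  qed
  then have "(LINT t|lborel. exp (- s * cosh t - y * t)) > 0" by (rule integral_lborel_pos) auto
  then show ?thesis unfolding cosh_moment_of_imaginary by simp
qed

text \<open>Laplace's method: for s = r^2 and t replaced by t / r, the exponent r^2 (cosh (t / r) -
  1) tends to t^2 / 2. The nonzero limit shows that the moment cannot vanish for all large
  s.\<close>

lemma cosh_moment_laplace_asymptotics:
  "(\<lambda>n. of_real (real (Suc n) * exp ((real (Suc n))\<^sup>2)) * cosh_moment 0 z (of_real ((real (Suc n))\<^sup>2)))
     \<longlonglongrightarrow> of_real (sqrt (2 * pi))"
proof -
  define r where "r = (\<lambda>n. real (Suc n))"
  define \<phi> where "\<phi> = (\<lambda>n t. of_real (exp (- ((r n)\<^sup>2 * (cosh (t / r n) - 1)))) * exp (\<i> * z * of_real (t / r n)))"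
  have r: "r n \<ge> 1" "r n > 0" for n by (auto simp: r_def)
  have eq: "of_real (r n * exp ((r n)\<^sup>2)) * cosh_moment 0 z (of_real ((r n)\<^sup>2)) = (LINT t|lborel. \<phi> n t)" for n
  proof -
    have "cosh_moment 0 z (of_real ((r n)\<^sup>2))
        = \<bar>1 / r n\<bar> *\<^sub>R (LINT t|lborel. cosh_kernel 0 z (of_real ((r n)\<^sup>2)) (0 + (1 / r n) * t))"
      unfolding cosh_moment_def using r(2)[of n] by (intro lborel_integral_real_affine) auto
    then have "of_real (r n * exp ((r n)\<^sup>2)) * cosh_moment 0 z (of_real ((r n)\<^sup>2))
        = of_real (exp ((r n)\<^sup>2)) * (LINT t|lborel. cosh_kernel 0 z (of_real ((r n)\<^sup>2)) (t / r n))"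
      using r(2)[of n] by (simp add: scaleR_conv_of_real)
    also have "\<dots> = (LINT t|lborel. of_real (exp ((r n)\<^sup>2)) * cosh_kernel 0 z (of_real ((r n)\<^sup>2)) (t / r n))"
      by (rule integral_mult_right_zero[symmetric])
    also have "\<dots> = (LINT t|lborel. \<phi> n t)"
    proof (rule arg_cong[where f = "integral\<^sup>L lborel"], rule ext)
      fix t
      have "exp (- of_real ((r n)\<^sup>2) * complex_of_real (cosh (t / r n))) = of_real (exp (- ((r n)\<^sup>2 * cosh (t / r n))))"
        by (simp flip: exp_of_real)
      moreover have "exp ((r n)\<^sup>2) * exp (- ((r n)\<^sup>2 * cosh (t / r n))) = exp (- ((r n)\<^sup>2 * (cosh (t / r n) - 1)))"
        by (simp add: exp_add[symmetric] algebra_simps)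
      ultimately show "of_real (exp ((r n)\<^sup>2)) * cosh_kernel 0 z (of_real ((r n)\<^sup>2)) (t / r n) = \<phi> n t"
        unfolding cosh_kernel_def \<phi>_def by (simp flip: mult.assoc of_real_mult)
    qed
    finally show ?thesis .
  qed
  define L where "L = (\<lambda>t::real. complex_of_real (exp (- t\<^sup>2 / 2)))"
  \<comment> \<open>Majorant from r^2 (cosh (t / r) - 1) \<ge> t^2 / 2 and |z| |t| \<le> 4 |z|^2 +
    t^2 / 4.\<close>
  define w where "w = (\<lambda>t::real. exp (4 * (norm z)\<^sup>2) * exp (- (t / 2)\<^sup>2 ))"
  have "(\<lambda>n. LINT t|lborel. \<phi> n t) \<longlonglongrightarrow> (LINT t|lborel. L t)"
  proof (rule integral_dominated_convergence[where w = w])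
    show "L \<in> borel_measurable lborel" unfolding L_def
      by (auto intro!: borel_measurable_continuous_onI continuous_intros)
    show "\<phi> n \<in> borel_measurable lborel" for n
      unfolding \<phi>_def using r(2)[of n]
      by (auto intro!: borel_measurable_continuous_onI continuous_intros)
    show "integrable lborel w"
    proof -
      have "integrable lborel (\<lambda>t. exp (- (0 + (1 / sqrt 2) * t)\<^sup>2 / 2))"
        by (rule lborel_integrable_real_affine[OF integrable_gaussian]) auto
      then show ?thesis unfolding w_def by (simp add: power_divide)
    qed
    show "AE t in lborel. (\<lambda>n. \<phi> n t) \<longlonglongrightarrow> L t"
    proof (rule AE_I2)
      fix t :: real
      have "(\<lambda>n. (r n)\<^sup>2 * (cosh (t / r n) - 1)) \<longlonglongrightarrow> t\<^sup>2 / 2"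
        unfolding r_def by (real_asymp simp: power2_eq_square)
      then have "(\<lambda>n. exp (- ((r n)\<^sup>2 * (cosh (t / r n) - 1)))) \<longlonglongrightarrow> exp (- (t\<^sup>2 / 2))"
        by (intro tendsto_intros)
      moreover have "(\<lambda>n. t / r n) \<longlonglongrightarrow> 0" unfolding r_def by real_asymp
      then have "(\<lambda>n. exp (\<i> * z * of_real (t / r n))) \<longlonglongrightarrow> exp (\<i> * z * of_real 0)"
        by (intro tendsto_intros)
      ultimately have "(\<lambda>n. \<phi> n t) \<longlonglongrightarrow> of_real (exp (- (t\<^sup>2 / 2))) * exp (\<i> * z * of_real 0)"
        unfolding \<phi>_def by (intro tendsto_mult tendsto_of_real)
      then show "(\<lambda>n. \<phi> n t) \<longlonglongrightarrow> L t" by (simp add: L_def)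
    qed
    show "AE t in lborel. norm (\<phi> n t) \<le> w t" for n
    proof (rule AE_I2)
      fix t :: real
      have "(t / r n) ^ 4 \<ge> 0" by simp
      then have "(t / r n)\<^sup>2 / 2 \<le> cosh (t / r n) - 1"
        using cosh_ge_quartic[of "t / r n"] by linarith
      then have "(r n)\<^sup>2 * ((t / r n)\<^sup>2 / 2) \<le> (r n)\<^sup>2 * (cosh (t / r n) - 1)" by (intro mult_left_mono) auto
      then have 1: "t\<^sup>2 / 2 \<le> (r n)\<^sup>2 * (cosh (t / r n) - 1)" using r(2)[of n] by (simp add: power_divide)
      have "norm (exp (\<i> * z * of_real (t / r n))) \<le> exp (norm (\<i> * z * of_real (t / r n)))" by (rule norm_exp)
      also have "\<dots> \<le> exp (norm z * \<bar>t\<bar>)"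
      proof -
        have "\<bar>t / r n\<bar> \<le> \<bar>t\<bar>" using r[of n] by (simp add: divide_le_eq mult_le_cancel_left1)
        then have "norm z * \<bar>t / r n\<bar> \<le> norm z * \<bar>t\<bar>" by (rule mult_left_mono) simp
        then show ?thesis by (simp only: norm_mult norm_of_real norm_ii mult_1 exp_le_cancel_iff)
      qed
      finally have 2: "norm (exp (\<i> * z * of_real (t / r n))) \<le> exp (norm z * \<bar>t\<bar>)" .
      have "norm (\<phi> n t) \<le> exp (- (t\<^sup>2 / 2)) * exp (norm z * \<bar>t\<bar>)"
        unfolding \<phi>_def norm_mult using 1 2 by (intro mult_mono) auto
      also have "\<dots> = exp (norm z * \<bar>t\<bar> - t\<^sup>2 / 2)" by (simp add: exp_add[symmetric])
      also have "\<dots> \<le> exp (4 * (norm z)\<^sup>2 - (t / 2)\<^sup>2)"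
      proof -
        have "0 \<le> (\<bar>t\<bar> / 2 - norm z)\<^sup>2 + 3 * (norm z)\<^sup>2" by simp
        also have "\<dots> = t\<^sup>2 / 4 - norm z * \<bar>t\<bar> + 4 * (norm z)\<^sup>2" by (simp add: power2_diff power_divide)
        finally show ?thesis by (simp add: power_divide)
      qed
      also have "\<dots> = w t" by (simp add: w_def exp_add[symmetric])
      finally show "norm (\<phi> n t) \<le> w t" .
    qed
  qed
  moreover have "(LINT t|lborel. L t) = of_real (sqrt (2 * pi))"
  proof -
    have "(LINT t|lborel. exp (- t\<^sup>2 / 2)) = (LINT t|lborel. sqrt (2 * pi) * std_normal_density t)"
      by (simp add: std_normal_density_def)
    also have "\<dots> = sqrt (2 * pi)" by simp
    finally show ?thesis unfolding L_def by simp
  qed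
  ultimately have "(\<lambda>n. LINT t|lborel. \<phi> n t) \<longlonglongrightarrow> of_real (sqrt (2 * pi))" by simp
  then show ?thesis unfolding eq[symmetric] unfolding r_def .
qed

lemma has_real_derivative_Re_Im:
  fixes f :: "complex \<Rightarrow> complex"
  assumes "(f has_field_derivative d) (at (of_real s))"
  shows "((\<lambda>s. Re (f (of_real s))) has_real_derivative Re d) (at s)"
    and "((\<lambda>s. Im (f (of_real s))) has_real_derivative Im d) (at s)"
proof -
  have "((\<lambda>s. f (of_real s)) has_vector_derivative d) (at s)"
    using assms by (rule has_vector_derivative_real_field)
  then show "((\<lambda>s. Re (f (of_real s))) has_real_derivative Re d) (at s)"
    "((\<lambda>s. Im (f (of_real s))) has_real_derivative Im d) (at s)"
    unfolding has_real_derivative_iff_has_vector_derivative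
    by (auto intro: bounded_linear.has_vector_derivative bounded_linear_Re bounded_linear_Im)
qed

text \<open>As a function of \<open>s\<close>, \<open>w = cosh_moment 0 z s\<close> solves Bessel's equation, a Sturm--Liouville
  problem with spectral parameter \<open>z\<^sup>2\<close>. The Wronskian of \<open>w\<close> and its conjugate is monotone with
  derivative \<open>Im (z\<^sup>2) |w|\<^sup>2 / s\<close> and vanishes at infinity, so it cannot vanish at a zero of \<open>w\<close>.\<close>

lemma cosh_moment_zero_imp:
  fixes a :: real
  assumes a: "a > 0" and zero: "cosh_moment 0 z (of_real a) = 0"
  shows "Im (z\<^sup>2) = 0"
proof (rule ccontr)
  assume nz: "Im (z\<^sup>2) \<noteq> 0"
  define \<kappa> where "\<kappa> = Im (z\<^sup>2)"
  define w where "w = (\<lambda>s::real. cosh_moment 0 z (of_real s))"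
  define v where "v = (\<lambda>s::real. cosh_moment 1 z (of_real s))"
  \<comment> \<open>The additional factor \<kappa> makes the derivative \<kappa>^2 |w|^2 / s
    nonnegative for either sign of Im (z^2).\<close>
  define J where "J = (\<lambda>s. \<kappa> * (s * (Im (v s) * Re (w s) - Re (v s) * Im (w s))))"
  have derJ: "(J has_real_derivative (\<kappa>\<^sup>2 * (norm (w s))\<^sup>2 / s)) (at s)" if s: "s > 0" for s
  proof -
    define y where "y = cosh_moment 2 z (of_real s)"
    have "(cosh_moment 0 z has_field_derivative - v s) (at (of_real s))"
      using cosh_moment_has_derivative_scale[of "of_real s" 0 z] s by (simp add: v_def)
    note this = has_real_derivative_Re_Im[OF this]
    then have dw: "((\<lambda>s. Re (w s)) has_real_derivative Re (- v s)) (at s)"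
      "((\<lambda>s. Im (w s)) has_real_derivative Im (- v s)) (at s)"
      by (simp_all only: w_def)
    have "(cosh_moment 1 z has_field_derivative - y) (at (of_real s))"
      using cosh_moment_has_derivative_scale[of "of_real s" 1 z] s by (simp add: y_def numeral_2_eq_2)
    note this = has_real_derivative_Re_Im[OF this]
    then have dv: "((\<lambda>s. Re (v s)) has_real_derivative Re (- y)) (at s)"
      "((\<lambda>s. Im (v s)) has_real_derivative Im (- y)) (at s)"
      by (simp_all only: v_def)
    have "(J has_real_derivative \<kappa> * ((Im (v s) * Re (w s) - Re (v s) * Im (w s)) +
        s * (Re (y) * Im (w s) - Im y * Re (w s)))) (at s)"
    proof -
      have "((\<lambda>s. Im (v s) * Re (w s) - Re (v s) * Im (w s)) has_real_derivative
          (Im (- y) * Re (w s) + Re (- v s) * Im (v s)) - (Re (- y) * Im (w s) + Im (- v s) * Re (v s))) (at s)"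
        by (intro DERIV_diff DERIV_mult dv dw)
      from DERIV_cmult[OF DERIV_mult[OF DERIV_ident this], of \<kappa>] show ?thesis
        unfolding J_def by (rule DERIV_cong) (simp add: algebra_simps)
    qed
    moreover have "(Im (v s) * Re (w s) - Re (v s) * Im (w s)) + s * (Re y * Im (w s) - Im y * Re (w s))
        = \<kappa> * (norm (w s))\<^sup>2 / s"
    proof -
      have ode: "of_real s ^ 2 * y - of_real s * v s = (of_real s ^ 2 - z ^ 2) * w s"
        using cosh_moment_bessel_equation[OF s, of z] by (simp add: y_def v_def w_def)
      \<comment> \<open>Multiplying the equation by the conjugate of w and taking imaginary parts
        removes the real coefficient s^2.\<close>
      have "Im ((of_real s ^ 2 * y - of_real s * v s) * cnj (w s)) = - \<kappa> * (norm (w s))\<^sup>2"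
        unfolding ode mult.assoc complex_norm_square[symmetric]
        by (simp add: \<kappa>_def flip: of_real_power)
      moreover have "Im ((of_real s ^ 2 * y - of_real s * v s) * cnj (w s))
         = - s * ((Im (v s) * Re (w s) - Re (v s) * Im (w s)) + s * (Re y * Im (w s) - Im y * Re (w s)))"
        by (simp add: power2_eq_square algebra_simps)
      ultimately show ?thesis using s by (simp add: field_simps)
    qed
    ultimately show ?thesis by (simp add: power2_eq_square mult.assoc)
  qed
  have mono: "J s \<le> J t" if "a \<le> s" "s \<le> t" for s t
  proof (rule DERIV_nonneg_imp_nondecreasing[OF that(2)])
    fix x assume "s \<le> x" "x \<le> t"
    then have "x > 0" using that a by linarith
    then show "\<exists>y. (J has_real_derivative y) (at x) \<and> 0 \<le> y"
      by (intro exI[of _ "\<kappa>\<^sup>2 * (norm (w x))\<^sup>2 / x"]) (simp add: derJ)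
  qed
  have J0: "J a = 0" using zero by (simp add: J_def w_def)
  define K where "K = (\<lambda>j. LINT t|lborel. exp ((real j + \<bar>Im z\<bar>) * \<bar>t\<bar> - 1 * cosh t))"
  \<comment> \<open>Since cosh t \<ge> 1, a factor exp (1 - s) can be extracted; it outweighs the
    factor s in \<open>J\<close>.\<close>
  have bd: "norm (cosh_moment j z (of_real s)) \<le> exp (1 - s) * K j" if "s \<ge> 1" for j s
  proof -
    have "norm (cosh_moment j z (of_real s)) \<le> (LINT t|lborel. norm (cosh_kernel j z (of_real s) t))"
      unfolding cosh_moment_def by (rule integral_norm_bound)
    also have "\<dots> \<le> (LINT t|lborel. exp (1 - s) * exp ((real j + \<bar>Im z\<bar>) * \<bar>t\<bar> - 1 * cosh t))"
    proof (rule integral_mono)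
      show "integrable lborel (\<lambda>t. norm (cosh_kernel j z (of_real s) t))"
        using that by (intro integrable_norm integrable_cosh_kernel) auto
      show "integrable lborel (\<lambda>t. exp (1 - s) * exp ((real j + \<bar>Im z\<bar>) * \<bar>t\<bar> - 1 * cosh t))"
        by (intro integrable_mult_right integrable_exp_abs_cosh) auto
      fix t
      have "norm (cosh_kernel j z (of_real s) t) \<le> exp ((real j + \<bar>Im z\<bar>) * \<bar>t\<bar> - s * cosh t)"
        by (rule norm_cosh_kernel_le) auto
      also have "\<dots> \<le> exp ((1 - s) + ((real j + \<bar>Im z\<bar>) * \<bar>t\<bar> - 1 * cosh t))"
      proof -
        have "(s - 1) * 1 \<le> (s - 1) * cosh t" using that cosh_real_ge_1[of t] by (intro mult_left_mono) auto
        then show ?thesis by (simp add: algebra_simps)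
      qed
      finally show "norm (cosh_kernel j z (of_real s) t) \<le> exp (1 - s) * exp ((real j + \<bar>Im z\<bar>) * \<bar>t\<bar> - 1 * cosh t)"
        by (simp add: exp_add)
    qed
    also have "\<dots> = exp (1 - s) * K j" by (simp add: K_def)
    finally show ?thesis .
  qed
  have limJ: "(J \<longlongrightarrow> 0) at_top"
  proof (rule Lim_null_comparison)
    show "\<forall>\<^sub>F s in at_top. norm (J s) \<le> (\<bar>\<kappa>\<bar> * K 1 * K 0 * exp 2) * (s * exp (- 2 * s))"
      using eventually_ge_at_top[of 1]
    proof eventually_elim
      case (elim s)
      have "Im (v s) * Re (w s) - Re (v s) * Im (w s) = Im (v s * cnj (w s))" by simp
      then have "norm (J s) = \<bar>\<kappa>\<bar> * (s * \<bar>Im (v s * cnj (w s))\<bar>)"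
        using elim by (simp add: J_def abs_mult)
      also have "\<dots> \<le> \<bar>\<kappa>\<bar> * (s * (norm (v s) * norm (w s)))"
        using abs_Im_le_cmod[of "v s * cnj (w s)"] elim
        by (intro mult_left_mono) (auto simp: norm_mult)
      also have "\<dots> \<le> \<bar>\<kappa>\<bar> * (s * ((exp (1 - s) * K 1) * (exp (1 - s) * K 0)))"
        unfolding v_def w_def using elim
        by (intro mult_left_mono mult_mono bd) (auto intro: order.trans[OF norm_ge_zero bd])
      also have "\<dots> = (\<bar>\<kappa>\<bar> * K 1 * K 0) * s * exp ((1 - s) + (1 - s))"
        by (simp only: exp_add mult_ac)
      also have "(1 - s) + (1 - s) = 2 + (- 2 * s)" by simp
      finally show ?case by (simp only: exp_add mult_ac)
    qed
    have "((\<lambda>s::real. s * exp (- 2 * s)) \<longlongrightarrow> 0) at_top" by real_asymp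
    then show "((\<lambda>s. (\<bar>\<kappa>\<bar> * K 1 * K 0 * exp 2) * (s * exp (- 2 * s))) \<longlongrightarrow> 0) at_top"
      by (rule tendsto_mult_right_zero)
  qed
  have Jz: "J s = 0" if "s \<ge> a" for s
  proof -
    have "J s \<le> 0"
    proof (rule tendsto_lowerbound[OF limJ])
      show "\<forall>\<^sub>F t in at_top. J s \<le> J t"
        using eventually_ge_at_top[of s] by eventually_elim (use mono that in auto)
    qed simp
    moreover have "0 \<le> J s" using mono[of a s] that J0 by simp
    ultimately show ?thesis by simp
  qed
  \<comment> \<open>\<open>J\<close> is constant beyond a, so its derivative vanishes and w with it;
    this contradicts the Laplace asymptotics.\<close>
  have wz: "w s = 0" if s: "s > a" for s
  proof -
    have "((\<lambda>_. 0) has_real_derivative 0) (at s)" by simp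
    then have "(J has_real_derivative 0) (at s)"
      by (rule has_field_derivative_transform_within_open[of _ _ _ "{a<..}"]) (use s Jz in auto)
    then have "\<kappa>\<^sup>2 * (norm (w s))\<^sup>2 / s = 0" using derJ[of s] s a DERIV_unique by fastforce
    then show ?thesis using nz s a by (simp add: \<kappa>_def)
  qed
  have "\<forall>\<^sub>F n in sequentially. real n \<ge> max a 1"
    by (rule eventually_ge_at_top[THEN eventually_compose_filterlim[OF _ filterlim_real_sequentially]])
  then have "\<forall>\<^sub>F n in sequentially. of_real (real (Suc n) * exp ((real (Suc n))\<^sup>2))
      * cosh_moment 0 z (of_real ((real (Suc n))\<^sup>2)) = 0"
  proof eventually_elim
    case (elim n)
    have "a < real (Suc n) * 1" using elim by simp
    also have "\<dots> \<le> (real (Suc n))\<^sup>2" unfolding power2_eq_square by (intro mult_left_mono) auto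
    finally have "cosh_moment 0 z (of_real ((real (Suc n))\<^sup>2)) = 0" using wz unfolding w_def by blast
    then show ?case by simp
  qed
  from tendsto_cong[OF this] cosh_moment_laplace_asymptotics[of z]
  have "(\<lambda>n::nat. 0::complex) \<longlonglongrightarrow> of_real (sqrt (2 * pi))" by blast
  then have "complex_of_real (sqrt (2 * pi)) = 0" using LIMSEQ_unique tendsto_const by blast
  then show False by simp
qed

text \<open>Real z^2 leaves only the two axes, and on the imaginary axis the integrand is
  positive.\<close>

lemma cosh_moment_real_zeros:
  fixes a :: real
  assumes "a > 0" and "cosh_moment 0 z (of_real a) = 0"
  shows "Im z = 0"
proof (rule ccontr)
  assume "Im z \<noteq> 0"
  then have "Re z = 0" using cosh_moment_zero_imp[OF assms] by (simp add: power2_eq_square)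
  then have "z = \<i> * of_real (Im z)" by (simp add: complex_eq_iff)
  then show False using cosh_moment_imaginary_nonzero[OF assms(1), of "Im z"] assms(2) by simp
qed

text \<open>|z| |t| \<le> e |z|^2 + t^2 / (4 e), and exp (t^2 / (4 e)) remains integrable against
  exp (- a cosh t).\<close>

lemma cosh_moment_growth:
  fixes a e :: real
  assumes "a > 0" "e > 0"
  shows "\<exists>C. \<forall>z. norm (cosh_moment 0 z (of_real a)) \<le> C * exp (e * (norm z)\<^sup>2)"
proof (intro exI allI)
  fix z
  have "norm (cosh_moment 0 z (of_real a)) \<le> (LINT t|lborel. norm (cosh_kernel 0 z (of_real a) t))"
    unfolding cosh_moment_def by (rule integral_norm_bound)
  also have "\<dots> \<le> (LINT t|lborel. exp (e * (norm z)\<^sup>2) * exp ((1 / (4 * e)) * t\<^sup>2 - a * cosh t))"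
  proof (rule integral_mono)
    show "integrable lborel (\<lambda>t. norm (cosh_kernel 0 z (of_real a) t))"
      using assms by (intro integrable_norm integrable_cosh_kernel) auto
    show "integrable lborel (\<lambda>t. exp (e * (norm z)\<^sup>2) * exp ((1 / (4 * e)) * t\<^sup>2 - a * cosh t))"
      using assms by (intro integrable_mult_right integrable_exp_square_cosh) auto
    fix t
    have "norm (cosh_kernel 0 z (of_real a) t) \<le> exp ((real 0 + norm z) * \<bar>t\<bar> - a * cosh t)"
      using abs_Im_le_cmod by (intro norm_cosh_kernel_le) auto
    also have "\<dots> \<le> exp (e * (norm z)\<^sup>2 + ((1 / (4 * e)) * t\<^sup>2 - a * cosh t))"
    proof -
      have "0 \<le> e * (norm z - \<bar>t\<bar> / (2 * e))\<^sup>2" using assms by simp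
      also have "\<dots> = e * (norm z)\<^sup>2 - norm z * \<bar>t\<bar> + (1 / (4 * e)) * t\<^sup>2"
        using assms by (simp add: power2_diff power_divide power_mult_distrib) (simp add: field_simps power2_eq_square)
      finally show ?thesis by simp
    qed
    finally show "norm (cosh_kernel 0 z (of_real a) t) \<le> exp (e * (norm z)\<^sup>2) * exp ((1 / (4 * e)) * t\<^sup>2 - a * cosh t)"
      by (simp only: exp_add)
  qed
  also have "\<dots> = (LINT t|lborel. exp ((1 / (4 * e)) * t\<^sup>2 - a * cosh t)) * exp (e * (norm z)\<^sup>2)" by simp
  finally show "norm (cosh_moment 0 z (of_real a)) \<le> (LINT t|lborel. exp ((1 / (4 * e)) * t\<^sup>2 - a * cosh t)) * exp (e * (norm z)\<^sup>2)" .
qed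

lemma cosh_moment_minus: "cosh_moment j (- z) s = cosh_moment j z s"
proof -
  have "cosh_moment j z s = \<bar>-1\<bar> *\<^sub>R (LINT t|lborel. cosh_kernel j z s (0 + (-1) * t))"
    unfolding cosh_moment_def by (rule lborel_integral_real_affine) auto
  also have "\<dots> = cosh_moment j (- z) s" by (simp add: cosh_moment_def cosh_kernel_def)
  finally show ?thesis by simp
qed

lemma deriv_cosh_moment_0:
  assumes "Re s > 0"
  shows "deriv (\<lambda>z. cosh_moment j z s) 0 = 0"
proof -
  define f where "f = (\<lambda>z. cosh_moment j z s)"
  have d: "(f has_field_derivative deriv f 0) (at 0)"
    using holomorphic_derivI[OF cosh_moment_entire[OF assms, of j] open_UNIV UNIV_I] by (simp add: f_def)
  then have "((\<lambda>z. f (- z)) has_field_derivative deriv f 0 * (- 1)) (at 0)"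
    by (intro DERIV_chain2[where f = f]) (auto intro!: derivative_eq_intros)
  moreover have "(\<lambda>z. f (- z)) = f" by (auto simp: f_def cosh_moment_minus)
  ultimately have "deriv f 0 = deriv f 0 * (- 1)" using d DERIV_unique by metis
  then show ?thesis by (simp add: f_def eq_neg_iff_add_eq_0)
qed

text \<open>The integral over the line is folded at 0: the kernel plus its reflection is twice the
  integrand of \<open>bessel_K\<close>.\<close>

lemma G_eq_cosh_moment:
  fixes a :: real
  assumes a: "a > 0"
  shows "2 * G a \<nu> = cosh_moment 0 (- \<i> * \<nu>) (of_real a)"
proof -
  define h where "h = cosh_kernel 0 (- \<i> * \<nu>) (of_real a)"
  have hint: "integrable lborel h" unfolding h_def using a by (intro integrable_cosh_kernel) auto
  have hint': "integrable lborel (\<lambda>t. h (- t))"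
    using lborel_integrable_real_affine[OF hint, of "-1" 0] by simp
  have "integral\<^sup>L lborel h = (LINT t|lborel. indicator {0..} t *\<^sub>R h t + indicator {..<0} t *\<^sub>R h t)"
    by (intro Bochner_Integration.integral_cong) (auto simp: indicator_def)
  also have "\<dots> = (LINT t|lborel. indicator {0..} t *\<^sub>R h t) + (LINT t|lborel. indicator {..<0} t *\<^sub>R h t)"
    by (intro Bochner_Integration.integral_add integrable_mult_indicator hint) auto
  also have "(LINT t|lborel. indicator {..<0} t *\<^sub>R h t)
      = \<bar>-1\<bar> *\<^sub>R (LINT t|lborel. indicator {..<0} (0 + (-1) * t) *\<^sub>R h (0 + (-1) * t))"
    by (rule lborel_integral_real_affine) auto
  also have "\<dots> = (LINT t|lborel. indicator {..<0} (- t) *\<^sub>R h (- t))" by simp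
  also have "\<dots> = (LINT t|lborel. indicator {0..} t *\<^sub>R h (- t))"
  proof (rule integral_cong_AE)
    have [measurable]: "h \<in> borel_measurable borel" by (simp add: h_def)
    show "(\<lambda>t. indicator {..<0} (- t) *\<^sub>R h (- t)) \<in> borel_measurable lborel"
      "(\<lambda>t. indicator {0..} t *\<^sub>R h (- t)) \<in> borel_measurable lborel" by measurable
    have "AE t::real in lborel. t \<noteq> 0" by (rule AE_lborel_singleton)
    then show "AE t in lborel. indicator {..<0} (- t) *\<^sub>R h (- t) = indicator {0..} t *\<^sub>R h (- t)"
      by eventually_elim (auto simp: indicator_def)
  qed
  also have "(LINT t|lborel. indicator {0..} t *\<^sub>R h t) + (LINT t|lborel. indicator {0..} t *\<^sub>R h (- t))
      = (LINT t|lborel. indicator {0..} t *\<^sub>R h t + indicator {0..} t *\<^sub>R h (- t))"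
    by (intro Bochner_Integration.integral_add[symmetric] integrable_mult_indicator hint hint') auto
  also have "\<dots> = (LINT t|lborel. 2 * (indicator {0..} t *\<^sub>R (of_real (exp (- a * cosh t)) * cosh (\<nu> * of_real t))))"
  proof (intro Bochner_Integration.integral_cong refl)
    fix t
    have "h t + h (- t) = 2 * (of_real (exp (- a * cosh t)) * cosh (\<nu> * of_real t))"
      unfolding h_def cosh_kernel_def cosh_field_def by (simp add: exp_of_real[symmetric] algebra_simps)
    then show "indicator {0..} t *\<^sub>R h t + indicator {0..} t *\<^sub>R h (- t)
        = 2 * (indicator {0..} t *\<^sub>R (of_real (exp (- a * cosh t)) * cosh (\<nu> * of_real t)))"
      by (simp add: scaleR_right_distrib[symmetric])
  qed
  also have "\<dots> = 2 * G a \<nu>"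
    by (simp only: G_def bessel_K_def set_lebesgue_integral_def integral_mult_right_zero)
  finally show ?thesis by (simp add: h_def cosh_moment_def)
qed

section \<open>The kernels \<open>Phi\<close> and \<open>Phi_S2\<close>\<close>

lemma power4_le_exp:
  fixes y :: real
  assumes "y \<ge> 0"
  shows "y ^ 4 / 256 \<le> exp y"
proof -
  have "(y / 4) ^ 4 \<le> exp (y / 4) ^ 4"
    using exp_ge_add_one_self[of "y / 4"] assms by (intro power_mono) linarith+
  also have "\<dots> = exp y" by (simp flip: exp_of_nat_mult)
  finally show ?thesis by (simp add: power_divide)
qed

definition Phi_term :: "real \<Rightarrow> nat \<Rightarrow> real" where
  "Phi_term t n = (2 * pi\<^sup>2 * real (Suc n) ^ 4 * exp (9 * t / 4)
                  - 3 * pi * (real (Suc n))\<^sup>2 * exp (5 * t / 4))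
                 * exp (- pi * (real (Suc n))\<^sup>2 * exp t)"

text \<open>Dividing N^4 X^3 by (N^2 X)^4 leaves 1 / (N^4 X): decay in t = ln X together with
  summability in N.\<close>

lemma Phi_term_bound:
  assumes "t \<ge> 0"
  shows "\<bar>Phi_term t n\<bar> \<le> (2 * pi\<^sup>2 + 3 * pi) * (256 / pi ^ 4) * exp (- t) * (1 / (real (Suc n))\<^sup>2)"
proof -
  define N where "N = real (Suc n)"
  have N: "N \<ge> 1" by (simp add: N_def)
  define X where "X = exp t"
  have X: "X \<ge> 1" using assms by (simp add: X_def)
  define c where "c = 2 * pi\<^sup>2 + 3 * pi"
  have c: "c > 0" by (simp add: c_def add_pos_pos)
  have e: "exp (9 * t / 4) \<le> X ^ 3" "exp (5 * t / 4) \<le> X ^ 3"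
    unfolding X_def exp_of_nat_mult[symmetric] using assms by auto
  have "\<bar>2 * pi\<^sup>2 * N ^ 4 * exp (9 * t / 4) - 3 * pi * N\<^sup>2 * exp (5 * t / 4)\<bar>
      \<le> 2 * pi\<^sup>2 * N ^ 4 * exp (9 * t / 4) + 3 * pi * N\<^sup>2 * exp (5 * t / 4)"
    by (intro order.trans[OF abs_triangle_ineq4]) (auto simp: abs_mult)
  also have "\<dots> \<le> 2 * pi\<^sup>2 * N ^ 4 * X ^ 3 + 3 * pi * N ^ 4 * X ^ 3"
    using e N by (intro add_mono mult_mono mult_left_mono power_increasing) auto
  also have "\<dots> = c * N ^ 4 * X ^ 3" by (simp add: c_def algebra_simps)
  finally have 1: "\<bar>2 * pi\<^sup>2 * N ^ 4 * exp (9 * t / 4) - 3 * pi * N\<^sup>2 * exp (5 * t / 4)\<bar> \<le> c * N ^ 4 * X ^ 3" .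
  have "(pi * N\<^sup>2 * X) ^ 4 / 256 \<le> exp (pi * N\<^sup>2 * X)" using X by (intro power4_le_exp) auto
  then have "exp (- (pi * N\<^sup>2 * X)) \<le> 256 / (pi * N\<^sup>2 * X) ^ 4"
    using N X by (simp add: exp_minus field_simps)
  then have "c * N ^ 4 * X ^ 3 * exp (- (pi * N\<^sup>2 * X)) \<le> c * N ^ 4 * X ^ 3 * (256 / (pi * N\<^sup>2 * X) ^ 4)"
    using c N X by (intro mult_left_mono) auto
  also have "\<dots> = c * (256 / pi ^ 4) * (1 / X) * (1 / N ^ 4)"
    using N X by (simp add: power_mult_distrib field_simps eval_nat_numeral)
  also have "\<dots> \<le> c * (256 / pi ^ 4) * (1 / X) * (1 / N\<^sup>2)"
    using c N X by (intro mult_left_mono divide_left_mono power_increasing) auto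
  finally have 2: "c * N ^ 4 * X ^ 3 * exp (- (pi * N\<^sup>2 * X)) \<le> c * (256 / pi ^ 4) * (1 / X) * (1 / N\<^sup>2)" .
  have "\<bar>Phi_term t n\<bar> \<le> c * N ^ 4 * X ^ 3 * exp (- (pi * N\<^sup>2 * X))"
    unfolding Phi_term_def N_def[symmetric] X_def[symmetric] abs_mult
    using 1 by (intro mult_mono) auto
  also note 2
  finally show ?thesis by (simp add: N_def X_def c_def exp_minus inverse_eq_divide)
qed

lemma summable_inverse_Suc_squares: "summable (\<lambda>n. 1 / (real (Suc n))\<^sup>2)"
proof -
  have "summable (\<lambda>n. inverse ((real (Suc n))\<^sup>2))"
    using inverse_power_summable[of 2, where ?'a = real] by (subst summable_Suc_iff) simp
  then show ?thesis by (simp add: inverse_eq_divide)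
qed

lemma summable_Phi_term:
  assumes "t \<ge> 0"
  shows "summable (Phi_term t)"
proof (rule summable_comparison_test')
  show "summable (\<lambda>n. (2 * pi\<^sup>2 + 3 * pi) * (256 / pi ^ 4) * exp (- t) * (1 / (real (Suc n))\<^sup>2))"
    by (rule summable_mult[OF summable_inverse_Suc_squares])
qed (unfold real_norm_def, rule Phi_term_bound[OF assms])

lemma Phi_tendsto_0: "(Phi \<longlongrightarrow> 0) at_top"
proof (rule Lim_null_comparison)
  define K where "K = (2 * pi\<^sup>2 + 3 * pi) * (256 / pi ^ 4) * (\<Sum>n. 1 / (real (Suc n))\<^sup>2)"
  show "\<forall>\<^sub>F t in at_top. norm (Phi t) \<le> K * exp (- t)"
    using eventually_ge_at_top[of 0]
  proof eventually_elim
    case (elim t)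
    let ?g = "\<lambda>n. (2 * pi\<^sup>2 + 3 * pi) * (256 / pi ^ 4) * exp (- t) * (1 / (real (Suc n))\<^sup>2)"
    have "norm (\<Sum>n. Phi_term t n) \<le> (\<Sum>n. ?g n)"
      using Phi_term_bound[OF elim] by (intro norm_suminf_le summable_mult summable_inverse_Suc_squares) auto
    also have "\<dots> = (2 * pi\<^sup>2 + 3 * pi) * (256 / pi ^ 4) * exp (- t) * (\<Sum>n. 1 / (real (Suc n))\<^sup>2)"
      by (rule suminf_mult[OF summable_inverse_Suc_squares])
    also have "(\<Sum>n. Phi_term t n) = Phi t" by (simp add: Phi_def Phi_term_def)
    finally show ?case by (simp add: K_def mult_ac)
  qed
  have "((\<lambda>t::real. exp (- t)) \<longlongrightarrow> 0) at_top" by real_asymp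
  then show "((\<lambda>t. K * exp (- t)) \<longlongrightarrow> 0) at_top" by (rule tendsto_mult_right_zero)
qed

lemma exp_pi_ge: "23 \<le> exp pi"
proof -
  have "(\<Sum>n<12. (3141 / 1000) ^ n /\<^sub>R fact n) \<le> exp (3141 / 1000 :: real)"
    using exp_converges[of "3141 / 1000 :: real"] unfolding sums_iff
    by (metis (no_types, lifting) finite_lessThan sum_le_suminf scaleR_nonneg_nonneg zero_le_power
        inverse_nonnegative_iff_nonnegative fact_ge_zero zero_le_divide_iff zero_le_numeral)
  moreover have "(\<Sum>n<12. (3141 / 1000) ^ n /\<^sub>R fact n) \<ge> (23 :: real)"
    by (simp add: lessThan_nat_numeral fact_numeral power_divide)
  moreover have "exp (3141 / 1000) \<le> exp pi" using pi_approx by simp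
  ultimately show ?thesis by linarith
qed

text \<open>All terms of the series for Phi 0 are nonnegative, and the first alone gives beta \<ge>
  exp pi (1/2 - 3 / (4 pi)) - 1. With 23 for exp pi and 3.141 for pi this exceeds 5 by less than
  0.01.\<close>

lemma beta_gt_5: "beta > 5"
proof -
  have nonneg: "Phi_term 0 n \<ge> 0" for n
  proof -
    define N where "N = real (Suc n)"
    have N: "N \<ge> 1" by (simp add: N_def)
    have "3 * 1 \<le> (2 * pi) * N\<^sup>2" using N pi_gt3 by (intro mult_mono) auto
    then have "(pi * N\<^sup>2) * 3 \<le> (pi * N\<^sup>2) * ((2 * pi) * N\<^sup>2)" by (intro mult_left_mono) auto
    then have "3 * pi * N\<^sup>2 \<le> 2 * pi\<^sup>2 * N ^ 4" by (simp add: power2_eq_square eval_nat_numeral mult_ac)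
    then show ?thesis by (simp add: Phi_term_def N_def)
  qed
  have "Phi 0 = (\<Sum>n. Phi_term 0 n)" by (simp add: Phi_def Phi_term_def)
  also have "\<dots> \<ge> (\<Sum>n\<in>{0}. Phi_term 0 n)"
    using nonneg by (intro sum_le_suminf summable_Phi_term) auto
  finally have "Phi 0 \<ge> (2 * pi\<^sup>2 - 3 * pi) * exp (- pi)" by (simp add: Phi_term_def)
  then have "exp (2 * pi) * ((2 * pi\<^sup>2 - 3 * pi) * exp (- pi)) / (4 * pi\<^sup>2) \<le> exp (2 * pi) * Phi 0 / (4 * pi\<^sup>2)"
    by (intro divide_right_mono mult_left_mono) auto
  moreover have "exp (2 * pi) * ((2 * pi\<^sup>2 - 3 * pi) * exp (- pi)) / (4 * pi\<^sup>2) = exp pi * (1 / 2 - 3 / (4 * pi))"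
  proof -
    have "exp (2 * pi) * exp (- pi) = exp pi" by (simp flip: exp_add)
    then have "exp (2 * pi) * ((2 * pi\<^sup>2 - 3 * pi) * exp (- pi)) = exp pi * (2 * pi\<^sup>2 - 3 * pi)"
      by (metis mult.commute mult.left_commute)
    moreover have "exp pi * (2 * pi\<^sup>2 - 3 * pi) / (4 * pi\<^sup>2) = exp pi * (1 / 2 - 3 / (4 * pi))"
      by (simp add: field_simps power2_eq_square)
    ultimately show ?thesis by (simp only:)
  qed
  moreover have "exp pi * (1 / 2 - 3 / (4 * pi)) \<ge> 23 * (1 / 2 - 3 / (4 * 3.141))"
  proof (rule mult_mono[OF exp_pi_ge])
    have "3 / (4 * pi) \<le> 3 / (4 * 3.141)" using pi_approx by (intro divide_left_mono) auto
    then show "1 / 2 - 3 / (4 * 3.141) \<le> 1 / 2 - 3 / (4 * pi)" by simp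
  qed auto
  ultimately show ?thesis unfolding beta_def by simp
qed

section \<open>The transform of \<open>Phi_S2\<close> as a sum of shifts\<close>

text \<open>The isolated term cosh (9 t / 4) is the frequency k = m in steps of 9 / (4 m); giving it
  the coefficient 1 merges it with the sum.\<close>

definition coeff_S2 :: "nat \<Rightarrow> real \<Rightarrow> nat \<Rightarrow> real" where
  "coeff_S2 m a k = (if k < m then c_S2 m a * c_k a k else 1)"

lemma sum_coeff_S2:
  fixes h :: "nat \<Rightarrow> 'a :: real_algebra_1"
  shows "(\<Sum>k\<le>m. of_real (coeff_S2 m a k) * h k)
       = h m + of_real (c_S2 m a) * (\<Sum>k<m. of_real (c_k a k) * h k)"
proof -
  have "(\<Sum>k\<le>m. of_real (coeff_S2 m a k) * h k) = (\<Sum>k<m. of_real (coeff_S2 m a k) * h k) + h m"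
    by (simp add: lessThan_Suc_atMost[symmetric] coeff_S2_def)
  also have "(\<Sum>k<m. of_real (coeff_S2 m a k) * h k) = of_real (c_S2 m a) * (\<Sum>k<m. of_real (c_k a k) * h k)"
    unfolding sum_distrib_left by (intro sum.cong) (auto simp: coeff_S2_def mult.assoc)
  finally show ?thesis by (simp add: add.commute)
qed

lemma g_S2_eq_sum:
  assumes "m \<ge> 1"
  shows "g_S2 m a t = (\<Sum>k\<le>m. coeff_S2 m a k * cosh (real k * (9 / (4 * real m)) * t))"
  using sum_coeff_S2[of m a "\<lambda>k. cosh (real k * (9 / (4 * real m)) * t)"] assms
  by (simp add: g_S2_def mult_ac)

lemma sum_powers_less:
  fixes a :: real
  assumes "0 < a" "a < 1" "m \<ge> 1"
  shows "(\<Sum>k=1..m. a ^ k) < real m"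
proof -
  have "(\<Sum>k=1..m. a ^ k) < (\<Sum>k=1..m. 1)"
    using assms by (intro sum_strict_mono) (auto simp: power_less_one_iff)
  then show ?thesis by simp
qed

lemma c_S2_pos:
  assumes "0 < a" "a < 1" "m \<ge> 1"
  shows "c_S2 m a > 0"
  using sum_powers_less[OF assms] beta_gt_5 unfolding c_S2_def by (intro divide_pos_pos) auto

lemma coeff_S2_nonneg:
  assumes "0 < a" "a < 1" "m \<ge> 1"
  shows "coeff_S2 m a k \<ge> 0"
  using c_S2_pos[OF assms] assms by (auto simp: coeff_S2_def c_k_def power_le_one mult_le_one)

lemma g_S2_pos:
  assumes "0 < a" "a < 1" "m \<ge> 1"
  shows "g_S2 m a t > 0"
proof -
  have "0 < coeff_S2 m a m * cosh (real m * (9 / (4 * real m)) * t)" by (simp add: coeff_S2_def cosh_real_pos)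
  also have "\<dots> \<le> g_S2 m a t"
    unfolding g_S2_eq_sum[OF assms(3)]
    by (rule member_le_sum) (auto intro!: mult_nonneg_nonneg coeff_S2_nonneg assms)
  finally show ?thesis .
qed

lemma Phi_S2_tendsto_0:
  assumes "m \<ge> 1"
  shows "(Phi_S2 m a \<longlongrightarrow> 0) at_top"
proof -
  have "((\<lambda>t. cosh (\<kappa> * t) * exp (- 2 * pi * cosh t)) \<longlongrightarrow> 0) at_top" for \<kappa> :: real
  proof (rule Lim_null_comparison[OF always_eventually], rule allI)
    fix t :: real
    have "norm (cosh (\<kappa> * t) * exp (- 2 * pi * cosh t)) \<le> exp (\<bar>\<kappa> * t\<bar>) * exp (- 2 * pi * cosh t)"
      using cosh_le_exp_abs[of "\<kappa> * t"] by simp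
    also have "\<dots> = exp (\<bar>\<kappa>\<bar> * \<bar>t\<bar> - (2 * pi) * cosh t)" by (simp add: exp_add[symmetric] abs_mult)
    also have "\<dots> \<le> exp (\<bar>\<kappa>\<bar>\<^sup>2 + 24 / (2 * pi)) * exp (- t\<^sup>2 / 2)" by (rule exp_abs_cosh_bound) simp
    finally show "norm (cosh (\<kappa> * t) * exp (- 2 * pi * cosh t)) \<le> exp (\<bar>\<kappa>\<bar>\<^sup>2 + 24 / (2 * pi)) * exp (- t\<^sup>2 / 2)" .
  next
    have "((\<lambda>t::real. exp (- t\<^sup>2 / 2)) \<longlongrightarrow> 0) at_top" by real_asymp
    then show "((\<lambda>t. exp (\<bar>\<kappa>\<bar>\<^sup>2 + 24 / (2 * pi)) * exp (- t\<^sup>2 / 2)) \<longlongrightarrow> 0) at_top"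
      by (rule tendsto_mult_right_zero)
  qed
  then have "((\<lambda>t. \<Sum>k\<le>m. (4 * pi\<^sup>2 * coeff_S2 m a k) *
      (cosh (real k * (9 / (4 * real m)) * t) * exp (- 2 * pi * cosh t))) \<longlongrightarrow> 0) at_top"
    by (intro tendsto_null_sum tendsto_mult_right_zero)
  moreover have "Phi_S2 m a = (\<lambda>t. \<Sum>k\<le>m. (4 * pi\<^sup>2 * coeff_S2 m a k) *
      (cosh (real k * (9 / (4 * real m)) * t) * exp (- 2 * pi * cosh t)))"
    unfolding Phi_S2_def[abs_def] g_S2_eq_sum[OF assms]
    by (simp add: sum_distrib_left sum_distrib_right mult_ac)
  ultimately show ?thesis by simp
qed

lemma Phi_S2_0:
  assumes "0 < a" "a < 1" "m \<ge> 1"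
  shows "Phi_S2 m a 0 = Phi 0"
proof -
  define D where "D = real m - (\<Sum>k=1..m. a ^ k)"
  have D: "D > 0" using sum_powers_less[OF assms] by (simp add: D_def)
  \<comment> \<open>The denominator of \<open>c_S2\<close> is exactly this sum, so g at 0 equals 1 +
    beta.\<close>
  have "(\<Sum>k<m. c_k a k) = D"
  proof -
    have "(\<Sum>k<m. a ^ (k + 1)) = (\<Sum>k=1..m. a ^ k)"
      by (rule sum.reindex_bij_witness[of _ "\<lambda>k. k - 1" Suc]) auto
    then show ?thesis by (simp add: c_k_def sum_subtractf D_def)
  qed
  moreover have "c_S2 m a = beta / D" by (simp only: c_S2_def D_def)
  ultimately have "g_S2 m a 0 = 1 + beta" using D by (simp add: g_S2_def)
  then have "Phi_S2 m a 0 = 4 * pi\<^sup>2 * (exp (2 * pi) * Phi 0 / (4 * pi\<^sup>2)) * exp (- (2 * pi))"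
    by (simp add: Phi_S2_def beta_def)
  also have "\<dots> = (exp (2 * pi) * exp (- (2 * pi))) * Phi 0" by simp
  also have "exp (2 * pi) * exp (- (2 * pi)) = 1" by (simp flip: exp_add)
  finally show ?thesis by simp
qed

text \<open>Each exponential in 2 cosh (k \<delta> t) amounts to an imaginary shift of z; the
  halving turns 4 pi^2 into 2 pi^2.\<close>

lemma
  fixes z :: complex and a :: real
  assumes m: "m \<ge> 1"
  defines "\<delta> \<equiv> 9 / (4 * real m)" and "f \<equiv> \<lambda>z. cosh_moment 0 z (of_real (2 * pi))"
  shows integrable_S2_transform: "integrable lborel (\<lambda>t. of_real (Phi_S2 m a t) * exp (\<i> * z * of_real t))"
    and Xi_S2_eq_shift_sum: "Xi_S2 m a (2 * z) = of_real (2 * pi\<^sup>2) *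
      (\<Sum>k\<le>m. of_real (coeff_S2 m a k) * (f (z - \<i> * of_real (real k * \<delta>)) + f (z + \<i> * of_real (real k * \<delta>))))"
proof -
  let ?K = "\<lambda>z. cosh_kernel 0 z (of_real (2 * pi))"
  have int: "integrable lborel (?K w)" for w by (intro integrable_cosh_kernel) auto
  have eq: "of_real (Phi_S2 m a t) * exp (\<i> * z * of_real t) = of_real (2 * pi\<^sup>2) *
      (\<Sum>k\<le>m. of_real (coeff_S2 m a k) * (?K (z - \<i> * of_real (real k * \<delta>)) t + ?K (z + \<i> * of_real (real k * \<delta>)) t))" for t
  proof -
    have "?K (z - \<i> * of_real (real k * \<delta>)) t + ?K (z + \<i> * of_real (real k * \<delta>)) t
        = 2 * of_real (cosh (real k * \<delta> * t)) * (of_real (exp (- 2 * pi * cosh t)) * exp (\<i> * z * of_real t))" for k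
    proof -
      define x where "x = real k * \<delta> * t"
      have 1: "\<i> * (z - \<i> * of_real (real k * \<delta>)) * of_real t = \<i> * z * of_real t + of_real x"
        "\<i> * (z + \<i> * of_real (real k * \<delta>)) * of_real t = \<i> * z * of_real t + of_real (- x)"
        by (simp_all add: x_def algebra_simps)
      have 2: "exp (- of_real (2 * pi) * complex_of_real (cosh t)) = of_real (exp (- 2 * pi * cosh t))"
        by (simp flip: exp_of_real)
      have 3: "exp (complex_of_real x) + exp (of_real (- x)) = 2 * of_real (cosh x)"
        by (simp add: cosh_field_def exp_of_real flip: of_real_minus)
      have "?K (z - \<i> * of_real (real k * \<delta>)) t + ?K (z + \<i> * of_real (real k * \<delta>)) t
          = of_real (exp (- 2 * pi * cosh t)) * exp (\<i> * z * of_real t) * (exp (of_real x) + exp (of_real (- x)))"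
        unfolding cosh_kernel_def 1 2 exp_add by (simp add: algebra_simps)
      also have "\<dots> = 2 * of_real (cosh x) * (of_real (exp (- 2 * pi * cosh t)) * exp (\<i> * z * of_real t))"
        unfolding 3 by (simp only: mult_ac)
      finally show ?thesis unfolding x_def .
    qed
    then have "(\<Sum>k\<le>m. of_real (coeff_S2 m a k) * (?K (z - \<i> * of_real (real k * \<delta>)) t + ?K (z + \<i> * of_real (real k * \<delta>)) t))
        = 2 * of_real (g_S2 m a t) * (of_real (exp (- 2 * pi * cosh t)) * exp (\<i> * z * of_real t))"
      unfolding g_S2_eq_sum[OF m] \<delta>_def by (simp add: sum_distrib_left sum_distrib_right mult_ac)
    then show ?thesis by (simp add: Phi_S2_def mult_ac)
  qed
  show "integrable lborel (\<lambda>t. of_real (Phi_S2 m a t) * exp (\<i> * z * of_real t))"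
    unfolding eq by (intro integrable_mult_right Bochner_Integration.integrable_sum Bochner_Integration.integrable_add int)
  have "Xi_S2 m a (2 * z) = (LINT t|lborel. of_real (Phi_S2 m a t) * exp (\<i> * z * of_real t))"
    by (simp add: Xi_S2_def)
  also have "\<dots> = of_real (2 * pi\<^sup>2) * (\<Sum>k\<le>m. of_real (coeff_S2 m a k) *
      ((LINT t|lborel. ?K (z - \<i> * of_real (real k * \<delta>)) t) + (LINT t|lborel. ?K (z + \<i> * of_real (real k * \<delta>)) t)))"
    unfolding eq
    by (simp only: integral_mult_right_zero Bochner_Integration.integral_sum Bochner_Integration.integral_add
        integrable_mult_right Bochner_Integration.integrable_add int)
  finally show "Xi_S2 m a (2 * z) = of_real (2 * pi\<^sup>2) *
      (\<Sum>k\<le>m. of_real (coeff_S2 m a k) * (f (z - \<i> * of_real (real k * \<delta>)) + f (z + \<i> * of_real (real k * \<delta>))))"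
    by (simp add: f_def cosh_moment_def)
qed

lemma Xi_S2_minus:
  assumes "m \<ge> 1"
  shows "Xi_S2 m a (- z) = Xi_S2 m a z"
proof -
  have "cosh_moment 0 (- (z / 2) - w) s + cosh_moment 0 (- (z / 2) + w) s
      = cosh_moment 0 (z / 2 - w) s + cosh_moment 0 (z / 2 + w) s" for w s
  proof -
    have "- (z / 2) - w = - (z / 2 + w)" "- (z / 2) + w = - (z / 2 - w)" by simp_all
    then show ?thesis by (simp only: cosh_moment_minus add.commute)
  qed
  then show ?thesis
    using Xi_S2_eq_shift_sum[OF assms, of a "z / 2"] Xi_S2_eq_shift_sum[OF assms, of a "- (z / 2)"] by simp
qed

text \<open>Supplies the non-constancy in the lower half-plane for Hurwitz' theorem. Evenness in z
  turns twice the difference into the integral of \<open>Phi_S2\<close> times 2 (cosh (2 t) - cosh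
  t), which is positive away from t = 0.\<close>

lemma Xi_S2_values_differ:
  assumes a: "0 < a" "a < 1" and m: "m \<ge> 1"
  shows "Xi_S2 m a (2 * (- 2 * \<i>)) \<noteq> Xi_S2 m a (2 * (- \<i>))"
proof
  assume eq: "Xi_S2 m a (2 * (- 2 * \<i>)) = Xi_S2 m a (2 * (- \<i>))"
  define F where "F = (\<lambda>z t. of_real (Phi_S2 m a t) * exp (\<i> * z * complex_of_real t))"
  define h where "h = (\<lambda>t. Phi_S2 m a t * (2 * (cosh (2 * t) - cosh t)))"
  have int: "integrable lborel (F z)" for z unfolding F_def by (rule integrable_S2_transform[OF m])
  have XF: "Xi_S2 m a (2 * z) = integral\<^sup>L lborel (F z)" for z by (simp add: Xi_S2_def F_def)
  have hF: "complex_of_real (h t) = F (- 2 * \<i>) t + F (2 * \<i>) t - (F (- \<i>) t + F \<i> t)" for t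
  proof -
    have ex: "\<i> * (- 2 * \<i>) * complex_of_real t = of_real (2 * t)" "\<i> * (2 * \<i>) * complex_of_real t = of_real (- (2 * t))"
      "\<i> * (- \<i>) * complex_of_real t = of_real t" "\<i> * \<i> * complex_of_real t = of_real (- t)"
      by (simp_all add: algebra_simps)
    have "F (- 2 * \<i>) t + F (2 * \<i>) t - (F (- \<i>) t + F \<i> t)
        = of_real (Phi_S2 m a t * exp (2 * t) + Phi_S2 m a t * exp (- (2 * t))
            - (Phi_S2 m a t * exp t + Phi_S2 m a t * exp (- t)))"
      unfolding F_def ex exp_of_real by simp
    also have "Phi_S2 m a t * exp (2 * t) + Phi_S2 m a t * exp (- (2 * t))
            - (Phi_S2 m a t * exp t + Phi_S2 m a t * exp (- t)) = h t"
      by (simp add: h_def cosh_field_def field_simps)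
    finally show ?thesis by simp
  qed
  have hint: "integrable lborel (\<lambda>t. complex_of_real (h t))"
    unfolding hF by (intro Bochner_Integration.integrable_diff Bochner_Integration.integrable_add int)
  have "(LINT t|lborel. complex_of_real (h t))
      = integral\<^sup>L lborel (F (- 2 * \<i>)) + integral\<^sup>L lborel (F (2 * \<i>)) - (integral\<^sup>L lborel (F (- \<i>)) + integral\<^sup>L lborel (F \<i>))"
    unfolding hF by (simp only: Bochner_Integration.integral_diff Bochner_Integration.integral_add
        Bochner_Integration.integrable_add int)
  also have "\<dots> = 0"
    using eq Xi_S2_minus[OF m, of a "2 * (2 * \<i>)"] Xi_S2_minus[OF m, of a "2 * \<i>"]
    unfolding XF[symmetric] by simp
  finally have "integral\<^sup>L lborel h = 0" by simp
  moreover have "integral\<^sup>L lborel h > 0"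
  proof (rule integral_lborel_pos)
    show "integrable lborel h" using hint by (simp add: complex_of_real_integrable_eq)
    fix t :: real assume t: "t \<noteq> 0"
    have "t\<^sup>2 > 0" "t ^ 4 \<ge> 0" using t by auto
    then have c: "cosh t > 1" using cosh_ge_quartic[of t] by linarith
    have "(2 * cosh t + 1) * (cosh t - 1) > 0" using c by (intro mult_pos_pos) auto
    then have "cosh (2 * t) > cosh t" unfolding cosh_double_cosh by (simp add: power2_eq_square algebra_simps)
    then show "h t > 0" using g_S2_pos[OF a m, of t] by (simp add: h_def Phi_S2_def)
  qed (simp add: h_def)
  ultimately show False by simp
qed

theorem theorem2:
  fixes a \<mu> :: real and m :: nat
  assumes "0 < a" and "a < 1"
    and "\<mu> > 0" and "\<mu> * (1 - a powr \<mu>) = beta"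
    and "int m \<ge> \<lceil>\<mu>\<rceil>"
  shows "(\<forall>z::complex. Xi_S2 m a (2 * z) =
            4 * of_real (pi\<^sup>2) * (G (2 * pi) (\<i> * z + 9 / 4) + G (2 * pi) (\<i> * z - 9 / 4))
            + 4 * of_real (pi\<^sup>2) * of_real (c_S2 m a) *
              (\<Sum>k<m. of_real (c_k a k) *
                 (G (2 * pi) (\<i> * z + 9 * of_nat k / (4 * of_nat m))
                  + G (2 * pi) (\<i> * z - 9 * of_nat k / (4 * of_nat m)))))
       \<and> ((\<lambda>t. Phi_S2 m a t - Phi t) \<longlongrightarrow> 0) at_top
       \<and> Phi_S2 m a 0 = Phi 0
       \<and> Xi_S2 m a holomorphic_on UNIV
       \<and> (\<forall>z. Xi_S2 m a z = 0 \<longrightarrow> z \<in> \<real>)"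
proof -
  have m\<mu>: "\<mu> \<le> real m" using assms(5) by linarith
  have beta_le: "beta \<le> real m * (1 - a ^ m)"
  proof -
    have "a powr real m \<le> a powr \<mu>" using assms m\<mu> by (intro powr_mono') auto
    then have "a ^ m \<le> a powr \<mu>" using assms by (simp add: powr_realpow)
    then have "\<mu> * (1 - a powr \<mu>) \<le> real m * (1 - a ^ m)"
      using m\<mu> assms(1-3) by (intro mult_mono) (auto simp: powr_le1)
    then show ?thesis using assms(4) by simp
  qed
  have m6: "m \<ge> 6"
  proof -
    have "5 < real m * (1 - a ^ m)" using beta_le beta_gt_5 by simp
    also have "\<dots> \<le> real m * 1" using assms by (intro mult_left_mono) auto
    finally show ?thesis by simp
  qed
  then have m1: "m \<ge> 1" by simp
  define \<delta> where "\<delta> = 9 / (4 * real m)"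
  have \<delta>: "\<delta> > 0" using m1 by (simp add: \<delta>_def)
  define f where "f = (\<lambda>z. cosh_moment 0 z (of_real (2 * pi)))"
  define H where "H = (\<lambda>z. \<Sum>k\<le>m. of_real (coeff_S2 m a k) *
      (f (z - \<i> * of_real (real k * \<delta>)) + f (z + \<i> * of_real (real k * \<delta>))))"
  have XH: "Xi_S2 m a (2 * z) = of_real (2 * pi\<^sup>2) * H z" for z
    unfolding H_def f_def \<delta>_def by (rule Xi_S2_eq_shift_sum[OF m1])
  have fhol: "f holomorphic_on UNIV" unfolding f_def by (rule cosh_moment_entire) simp
  have formula: "Xi_S2 m a (2 * z) =
            4 * of_real (pi\<^sup>2) * (G (2 * pi) (\<i> * z + 9 / 4) + G (2 * pi) (\<i> * z - 9 / 4))
            + 4 * of_real (pi\<^sup>2) * of_real (c_S2 m a) *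
              (\<Sum>k<m. of_real (c_k a k) *
                 (G (2 * pi) (\<i> * z + 9 * of_nat k / (4 * of_nat m))
                  + G (2 * pi) (\<i> * z - 9 * of_nat k / (4 * of_nat m))))" for z
  proof -
    define h where "h = (\<lambda>k. G (2 * pi) (\<i> * z + 9 * of_nat k / (4 * of_nat m))
                  + G (2 * pi) (\<i> * z - 9 * of_nat k / (4 * of_nat m)))"
    have fh: "f (z - \<i> * of_real (real k * \<delta>)) + f (z + \<i> * of_real (real k * \<delta>)) = 2 * h k" for k
    proof -
      have "- \<i> * (\<i> * z + 9 * of_nat k / (4 * of_nat m)) = z - \<i> * of_real (real k * \<delta>)"
        "- \<i> * (\<i> * z - 9 * of_nat k / (4 * of_nat m)) = z + \<i> * of_real (real k * \<delta>)"
        by (simp_all add: \<delta>_def algebra_simps)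
      then show ?thesis
        using G_eq_cosh_moment[of "2 * pi" "\<i> * z + 9 * of_nat k / (4 * of_nat m)"]
          G_eq_cosh_moment[of "2 * pi" "\<i> * z - 9 * of_nat k / (4 * of_nat m)"]
        by (simp add: h_def f_def distrib_left)
    qed
    have "Xi_S2 m a (2 * z) = of_real (4 * pi\<^sup>2) * (\<Sum>k\<le>m. of_real (coeff_S2 m a k) * h k)"
      unfolding XH H_def fh by (simp add: sum_distrib_left mult_ac)
    also have "\<dots> = of_real (4 * pi\<^sup>2) * (h m + of_real (c_S2 m a) * (\<Sum>k<m. of_real (c_k a k) * h k))"
      by (simp only: sum_coeff_S2)
    also have "h m = G (2 * pi) (\<i> * z + 9 / 4) + G (2 * pi) (\<i> * z - 9 / 4)"
      using m1 by (simp add: h_def)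
    finally show ?thesis by (simp add: h_def distrib_left mult.assoc)
  qed
  \<comment> \<open>Both kernels tend to 0 separately.\<close>
  have "((\<lambda>t. Phi_S2 m a t - Phi t) \<longlongrightarrow> 0 - 0) at_top"
    by (intro tendsto_diff Phi_S2_tendsto_0 Phi_tendsto_0 m1)
  moreover have hol: "Xi_S2 m a holomorphic_on UNIV"
  proof -
    have comp: "(\<lambda>z. f (z / 2 + w)) holomorphic_on UNIV" for w
    proof -
      have "(\<lambda>z. z / 2 + w) holomorphic_on UNIV" by (intro holomorphic_intros) auto
      from holomorphic_on_compose_gen[OF this fhol] show ?thesis by (simp add: o_def)
    qed
    have "(\<lambda>z. of_real (2 * pi\<^sup>2) * (\<Sum>k\<le>m. of_real (coeff_S2 m a k) *
      (f (z / 2 + (- (\<i> * of_real (real k * \<delta>)))) + f (z / 2 + \<i> * of_real (real k * \<delta>))))) holomorphic_on UNIV"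
      by (intro holomorphic_intros comp)
    moreover have "Xi_S2 m a = (\<lambda>z. of_real (2 * pi\<^sup>2) * (\<Sum>k\<le>m. of_real (coeff_S2 m a k) *
      (f (z / 2 + (- (\<i> * of_real (real k * \<delta>)))) + f (z / 2 + \<i> * of_real (real k * \<delta>)))))"
      using XH[of "_ / 2"] by (auto simp: H_def)
    ultimately show ?thesis by simp
  qed
  moreover have low: "H z \<noteq> 0" if "Im z < 0" for z
    unfolding H_def
  proof (rule symmetric_shift_sum_real_zeros[OF fhol])
    show "f 0 \<noteq> 0"
      using cosh_moment_imaginary_nonzero[of "2 * pi" 0] by (simp add: f_def)
    show "f 0 \<in> \<real>"
      using cosh_moment_of_imaginary[of 0 "2 * pi"] by (simp add: f_def)
    show "deriv f 0 = 0" unfolding f_def by (rule deriv_cosh_moment_0) simp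
    show "\<exists>C. \<forall>z. norm (f z) \<le> C * exp (e * (norm z)\<^sup>2)" if "e > 0" for e
      unfolding f_def by (rule cosh_moment_growth) (use that in auto)
    show "Im z = 0" if "f z = 0" for z
      using that unfolding f_def by (intro cosh_moment_real_zeros[of "2 * pi"]) auto
    show "(\<Sum>k\<le>m. of_real (coeff_S2 m a k) * x ^ k) \<noteq> 0" if "norm x \<ge> 1" for x :: complex
      unfolding sum_coeff_S2 c_S2_def
      using kernel_poly_roots[OF assms(1,2) m6 _ beta_le that] beta_gt_5 by (simp add: c_k_def)
    show "\<not> (\<lambda>z. \<Sum>k\<le>m. of_real (coeff_S2 m a k) *
      (f (z - \<i> * of_real (real k * \<delta>)) + f (z + \<i> * of_real (real k * \<delta>)))) constant_on {z. Im z < 0}"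
      unfolding H_def[symmetric]
    proof
      assume "H constant_on {z. Im z < 0}"
      then have "H (- 2 * \<i>) = H (- \<i>)" by (auto simp: constant_on_def)
      then show False using Xi_S2_values_differ[OF assms(1,2) m1] unfolding XH by simp
    qed
  qed (use \<delta> m1 that in \<open>auto simp: coeff_S2_def\<close>)
  have "z \<in> \<real>" if z: "Xi_S2 m a z = 0" for z
  proof -
    have "H (z / 2) = 0" using XH[of "z / 2"] z by simp
    then have "\<not> Im z < 0" using low[of "z / 2"] by auto
    \<comment> \<open>Evenness moves a zero from the upper to the lower half-plane.\<close>
    moreover have "H (- z / 2) = 0" using XH[of "- z / 2"] Xi_S2_minus[OF m1, of a z] z by simp
    then have "\<not> Im z > 0" using low[of "- z / 2"] by auto
    ultimately show ?thesis by (simp add: complex_is_Real_iff)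
  qed
  ultimately show ?thesis using formula Phi_S2_0[OF assms(1,2) m1] by simp
qed

end
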